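(* Let $\mathbf{X}=(X_1,\ldots,X_N)^T:(\Omega,\mathcal{F})\to(\mathbb{A}^N,\mathcal{B}^N)$ be a vector of $N\in\mathbb{N}$ input random variables fulfilling Assumptions A and B (stated in the context). For $\emptyset\neq u\subseteq\{1,\ldots,N\}$ and $\mathbf{X}_u=(X_{i_1},\ldots,X_{i_{|u|}})^T$, denote by $\{\Psi_{u,\mathbf{j}_u}(\mathbf{X}_u):\mathbf{j}_u\in\mathbb{N}^{|u|}\}$ the set of multivariate orthonormal polynomials consistent with the probability measure $f_{\mathbf{X}_u}(\mathbf{x}_u)d\mathbf{x}_u$. Then: (1) any random variable $y(\mathbf{X})\in L^2(\Omega,\mathcal{F},\mathbb{P})$ can be hierarchically expanded as a Fourier-like series, referred to as the PDD of $$y(\mathbf{X})\sim y_\emptyset+\sum_{\emptyset\neq u\subseteq\{1,\ldots,N\}}\sum_{l=|u|}^{\infty}\sum_{\substack{\mathbf{j}_u\in\mathbb{N}^{|u|}\\|\mathbf{j}_u|=l}}C_{u,\mathbf{j}_u}\Psi_{u,\mathbf{j}_u}(\mathbf{X}_u)=y_\emptyset+\sum_{\emptyset\neq u\subseteq\{1,\ldots,N\}}\sum_{\mathbf{j}_u\in\mathbb{N}^{|u|}}C_{u,\mathbf{j}_u}\Psi_{u,\mathbf{j}_u}(\mathbf{X}_u),$$ where the expansion coefficients $y_\emptyset\in\mathbb{R}$ and $C_{u,\mathbf{j}_u}\in\mathbb{R}$, $\emptyset\neq u\subseteq\{1,\ldots,N\}$, $\mathbf{j}_u\in\mathbb{N}^{|u|}$,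 are defined by $$y_\emptyset:=\mathbb{E}[y(\mathbf{X})]=\int_{\mathbb{A}^N}y(\mathbf{x})f_{\mathbf{X}}(\mathbf{x})d\mathbf{x},\qquad C_{u,\mathbf{j}_u}:=\mathbb{E}[y(\mathbf{X})\Psi_{u,\mathbf{j}_u}(\mathbf{X}_u)]=\int_{\mathbb{A}^N}y(\mathbf{x})\Psi_{u,\mathbf{j}_u}(\mathbf{x}_u)f_{\mathbf{X}}(\mathbf{x})d\mathbf{x};$$ and (2) the PDD of $y(\mathbf{X})\in L^2(\Omega,\mathcal{F},\mathbb{P})$ converges to $y(\mathbf{X})$ in mean-square; furthermore, the PDD converges in probability and in distribution.
   Context: $\mathbb{N}=\{1,2,\ldots\}$, $\mathbb{N}_0=\mathbb{N}\cup\{0\}$. $(\Omega,\mathcal{F},\mathbb{P})$ is a complete probability space with expectation $\mathbb{E}$; $\mathbb{A}^{\{i\}}\subseteq\mathbb{R}$, $\mathbb{A}^N=\times_{i=1}^N\mathbb{A}^{\{i\}}$, $\mathcal{B}^N$ is the Borel $\sigma$-algebra on $\mathbb{A}^N$. Here $y(\mathbf{X})=y(X_1,\ldots,X_N)$ is a real-valued random variable given by a measurable function $y$ of $\mathbf{X}$, with $\mathbb{E}[y^2(\mathbf{X})]<\infty$. Assumption A: (1) each $X_i$ has an absolutely continuous marginal distribution function and a continuous marginal density $f_{X_i}$ with bounded or unbounded support $\mathbb{A}^{\{i\}}\subseteq\mathbb{R}$; (2) $X_1,\ldots,X_N$ are statistically independent (not necessarily identically distributed), so $\mathbf{X}$ has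 joint density $f_{\mathbf{X}}(\mathbf{x})=\prod_{i=1}^N f_{X_i}(x_i)$; (3) each $X_i$ has finite moments $\mu_{i,l}=\mathbb{E}[X_i^l]$ of all orders $l\in\mathbb{N}_0$. Assumption B: each $X_i$, $i=1,\ldots,N$, satisfies at least one of: (1) $f_{X_i}$ has compact support, i.e. $\mathbb{P}(a_i\le X_i\le b_i)=1$ for some $a_i,b_i\in\mathbb{R}$; (2) $\liminf_{l\to\infty}(\mu_{i,2l})^{1/2l}/(2l)<\infty$; (3) $\sum_{l\in\mathbb{N}}1/(\mu_{i,2l})^{1/2l}=\infty$; (4) there is a real $a>0$ with $\int_{\mathbb{A}^{\{i\}}}\exp(a|x_i|)f_{X_i}(x_i)dx_i<\infty$; (5) $f_{X_i}$ is symmetric, differentiable and strictly positive, and there is a real $a>0$ such that $\int_{\mathbb{A}^{\{i\}}}-\frac{\ln f_{X_i}(x_i)}{1+x_i^2}dx_i=\infty$ and $\frac{-x_i\,df_{X_i}(x_i)/dx_i}{f_{X_i}(x_i)}\to\infty$ as $x_i\to\infty$, $x_i\ge a$. For each $i$, $\{P_{\{i\},j}: j\in\mathbb{N}_0\}$ is a set of univariate orthogonal polynomials for $f_{X_i}dx_i$: nonzero real polynomials, $P_{\{i\},j}$ of degree $j$, with $\mathbb{E}[P_{\{i\},j}(X_i)P_{\{i\},k}(X_i)]=0$ for $j\neq k$ and $0<\mathbb{E}[P_{\{i\},j}^2(X_i)]<\infty$; $\Psi_{\{i\},j}=P_{\{i\},j}/\sqrt{\mathbb{E}[P_{\{i\},j}^2(X_i)]}$.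 For $\emptyset\ne u=\{i_1,\ldots,i_{|u|}\}$ and a multi-index $\mathbf{j}_u=(j_{i_1},\ldots,j_{i_{|u|}})$ of degree $|\mathbf{j}_u|=j_{i_1}+\cdots+j_{i_{|u|}}$, $\Psi_{u,\mathbf{j}_u}(\mathbf{x}_u)=\prod_{i\in u}\Psi_{\{i\},j_i}(x_i)$, and $f_{\mathbf{X}_u}(\mathbf{x}_u)=\prod_{i\in u}f_{X_i}(x_i)$. In the expansion all components of $\mathbf{j}_u$ are positive. PDD stands for polynomial dimensional decomposition; $\sim$ denotes association of the formal series, whose convergence is the content of (2).
   Formalization: In Assumption B(5), the quotient -x f'(x)/f(x) is required to be (weakly) increasing on [a,∞) as well as tend to infinity (Lin's condition); with mere divergence the statement is false already for N = 1. *)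

theory Defs
  imports "HOL-Probability.Probability"
begin

abbreviation borel_box :: "nat \<Rightarrow> (nat \<Rightarrow> real set) \<Rightarrow> (nat \<Rightarrow> real) measure" where
  "borel_box N A \<equiv> (\<Pi>\<^sub>M i\<in>{1..N}. restrict_space borel (A i))"

definition input_vec :: "nat \<Rightarrow> (nat \<Rightarrow> 'w \<Rightarrow> real) \<Rightarrow> 'w \<Rightarrow> nat \<Rightarrow> real" where
  "input_vec N X \<omega> = (\<lambda>i\<in>{1..N}. X i \<omega>)"

definition moment :: "'w measure \<Rightarrow> ('w \<Rightarrow> real) \<Rightarrow> nat \<Rightarrow> real" where
  "moment M Z l = (LINT \<omega>|M. Z \<omega> ^ l)"

text \<open>The set \<open>S\<close> is the support of the density \<open>f\<close>. It is fixed only up to boundary points, so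
  that both the closed support and its interior are covered; the density is required to be
  continuous on \<open>S\<close>, not across the boundary of \<open>S\<close> (uniform and exponential distributions).\<close>

definition continuous_density_on ::
  "'w measure \<Rightarrow> ('w \<Rightarrow> real) \<Rightarrow> (real \<Rightarrow> real) \<Rightarrow> real set \<Rightarrow> bool" where
  "continuous_density_on M Z f S \<longleftrightarrow>
     distributed M lborel Z (\<lambda>x. ennreal (f x)) \<and>
     (\<forall>x. 0 \<le> f x) \<and>
     S \<in> sets borel \<and>
     {x. f x \<noteq> 0} \<subseteq> S \<and> S \<subseteq> closure {x. f x \<noteq> 0} \<and>
     continuous_on S f"

definition assumption_A ::
  "'w measure \<Rightarrow> nat \<Rightarrow> (nat \<Rightarrow> real set) \<Rightarrow> (nat \<Rightarrow> 'w \<Rightarrow> real) \<Rightarrow> (nat \<Rightarrow> real \<Rightarrow> real) \<Rightarrow> bool" where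
  "assumption_A M N A X f \<longleftrightarrow>
     (\<forall>i\<in>{1..N}. continuous_density_on M (X i) (f i) (A i)) \<and>
     prob_space.indep_vars M (\<lambda>_. borel) X {1..N} \<and>
     (\<forall>i\<in>{1..N}. \<forall>l. integrable M (\<lambda>\<omega>. X i \<omega> ^ l))"

text \<open>The extended-valued Lebesgue integral of \<open>g\<close> over \<open>S\<close> exists and equals \<open>+\<infinity>\<close>
  (\<^const>\<open>ennreal\<close> truncates negative reals to \<open>0\<close>).\<close>

definition set_integral_is_top :: "real set \<Rightarrow> (real \<Rightarrow> real) \<Rightarrow> bool" where
  "set_integral_is_top S g \<longleftrightarrow>
     (\<integral>\<^sup>+x\<in>S. ennreal (g x) \<partial>lborel) = \<infinity> \<and> (\<integral>\<^sup>+x\<in>S. ennreal (- g x) \<partial>lborel) < \<infinity>"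

text \<open>The Krein--Lin condition. The density is strictly positive on the whole real line, and
  \<open>- x f'(x) / f(x)\<close> tends to infinity on \<open>[a, \<infinity>)\<close> in the sense of Lin's condition, i.e. it
  increases (weakly) to infinity there. Without monotonicity the threshold \<open>a\<close> would play no role,
  and the condition would not imply that the polynomials are dense: take \<open>- ln f\<close> to be, up to
  slowly growing smooth corrections, a step function with the value \<open>x\<^sub>k\<close> on \<open>[x\<^sub>k, x\<^sub>k\<^sub>+\<^sub>1)\<close> for
  a sufficiently fast growing sequence.\<close>

definition krein_lin :: "real set \<Rightarrow> (real \<Rightarrow> real) \<Rightarrow> bool" where
  "krein_lin S f \<longleftrightarrow>
     (\<forall>x. f (- x) = f x) \<and> (\<forall>x. f differentiable (at x)) \<and> (\<forall>x. 0 < f x) \<and>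
     (\<exists>a>0. set_integral_is_top S (\<lambda>x. - ln (f x) / (1 + x\<^sup>2)) \<and>
        mono_on {a..} (\<lambda>x. - x * deriv f x / f x) \<and>
        filterlim (\<lambda>x. - x * deriv f x / f x) at_top at_top)"

definition assumption_B ::
  "'w measure \<Rightarrow> nat \<Rightarrow> (nat \<Rightarrow> real set) \<Rightarrow> (nat \<Rightarrow> 'w \<Rightarrow> real) \<Rightarrow> (nat \<Rightarrow> real \<Rightarrow> real) \<Rightarrow> bool" where
  "assumption_B M N A X f \<longleftrightarrow> (\<forall>i\<in>{1..N}.
     (\<exists>a b. measure M {\<omega>\<in>space M. a \<le> X i \<omega> \<and> X i \<omega> \<le> b} = 1) \<or>
     liminf (\<lambda>l. ereal (moment M (X i) (2 * l) powr (1 / real (2 * l)) / real (2 * l))) < \<infinity> \<or>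
     (\<Sum>l. ennreal (1 / moment M (X i) (2 * Suc l) powr (1 / real (2 * Suc l)))) = \<infinity> \<or>
     (\<exists>a>0. set_integrable lborel (A i) (\<lambda>x. exp (a * \<bar>x\<bar>) * f i x)) \<or>
     krein_lin (A i) (f i))"

definition orthogonal_polynomials ::
  "'w measure \<Rightarrow> ('w \<Rightarrow> real) \<Rightarrow> (nat \<Rightarrow> real poly) \<Rightarrow> bool" where
  "orthogonal_polynomials M Z p \<longleftrightarrow>
     (\<forall>j. p j \<noteq> 0 \<and> degree (p j) = j) \<and>
     (\<forall>j k. j \<noteq> k \<longrightarrow> (LINT \<omega>|M. poly (p j) (Z \<omega>) * poly (p k) (Z \<omega>)) = 0) \<and>
     (\<forall>j. integrable M (\<lambda>\<omega>. (poly (p j) (Z \<omega>))\<^sup>2) \<and> 0 < (LINT \<omega>|M. (poly (p j) (Z \<omega>))\<^sup>2))"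

definition uni_Psi ::
  "'w measure \<Rightarrow> (nat \<Rightarrow> 'w \<Rightarrow> real) \<Rightarrow> (nat \<Rightarrow> nat \<Rightarrow> real poly) \<Rightarrow> nat \<Rightarrow> nat \<Rightarrow> real \<Rightarrow> real" where
  "uni_Psi M X P i j x = poly (P i j) x / sqrt (LINT \<omega>|M. (poly (P i j) (X i \<omega>))\<^sup>2)"

definition multi_Psi ::
  "'w measure \<Rightarrow> (nat \<Rightarrow> 'w \<Rightarrow> real) \<Rightarrow> (nat \<Rightarrow> nat \<Rightarrow> real poly) \<Rightarrow>
     nat set \<Rightarrow> (nat \<Rightarrow> nat) \<Rightarrow> (nat \<Rightarrow> real) \<Rightarrow> real" where
  "multi_Psi M X P u j x = (\<Prod>i\<in>u. uni_Psi M X P i (j i) (x i))"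

definition multi_indices :: "nat set \<Rightarrow> (nat \<Rightarrow> nat) set" where
  "multi_indices u = u \<rightarrow>\<^sub>E {1..}"

definition multi_degree :: "nat set \<Rightarrow> (nat \<Rightarrow> nat) \<Rightarrow> nat" where
  "multi_degree u j = (\<Sum>i\<in>u. j i)"

definition nonempty_subsets :: "nat \<Rightarrow> nat set set" where
  "nonempty_subsets N = {u. u \<noteq> {} \<and> u \<subseteq> {1..N}}"

definition pdd_index :: "nat \<Rightarrow> (nat set \<times> (nat \<Rightarrow> nat)) set" where
  "pdd_index N = (SIGMA u:nonempty_subsets N. multi_indices u)"

definition pdd_mean ::
  "'w measure \<Rightarrow> nat \<Rightarrow> (nat \<Rightarrow> 'w \<Rightarrow> real) \<Rightarrow> ((nat \<Rightarrow> real) \<Rightarrow> real) \<Rightarrow> real" where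
  "pdd_mean M N X y = (LINT \<omega>|M. y (input_vec N X \<omega>))"

definition pdd_coeff ::
  "'w measure \<Rightarrow> nat \<Rightarrow> (nat \<Rightarrow> 'w \<Rightarrow> real) \<Rightarrow> (nat \<Rightarrow> nat \<Rightarrow> real poly) \<Rightarrow> ((nat \<Rightarrow> real) \<Rightarrow> real) \<Rightarrow>
     nat set \<Rightarrow> (nat \<Rightarrow> nat) \<Rightarrow> real" where
  "pdd_coeff M N X P y u j =
     (LINT \<omega>|M. y (input_vec N X \<omega>) * multi_Psi M X P u j (input_vec N X \<omega>))"

definition pdd_term ::
  "'w measure \<Rightarrow> nat \<Rightarrow> (nat \<Rightarrow> 'w \<Rightarrow> real) \<Rightarrow> (nat \<Rightarrow> nat \<Rightarrow> real poly) \<Rightarrow> ((nat \<Rightarrow> real) \<Rightarrow> real) \<Rightarrow>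
     nat set \<Rightarrow> (nat \<Rightarrow> nat) \<Rightarrow> 'w \<Rightarrow> real" where
  "pdd_term M N X P y u j \<omega> = pdd_coeff M N X P y u j * multi_Psi M X P u j (input_vec N X \<omega>)"

definition pdd_graded ::
  "'w measure \<Rightarrow> nat \<Rightarrow> (nat \<Rightarrow> 'w \<Rightarrow> real) \<Rightarrow> (nat \<Rightarrow> nat \<Rightarrow> real poly) \<Rightarrow> ((nat \<Rightarrow> real) \<Rightarrow> real) \<Rightarrow>
     nat \<Rightarrow> 'w \<Rightarrow> real" where
  "pdd_graded M N X P y m \<omega> = pdd_mean M N X y +
     (\<Sum>u\<in>nonempty_subsets N. \<Sum>l\<in>{card u..m}.
        \<Sum>j\<in>{j \<in> multi_indices u. multi_degree u j = l}. pdd_term M N X P y u j \<omega>)"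

definition pdd_partial ::
  "'w measure \<Rightarrow> nat \<Rightarrow> (nat \<Rightarrow> 'w \<Rightarrow> real) \<Rightarrow> (nat \<Rightarrow> nat \<Rightarrow> real poly) \<Rightarrow> ((nat \<Rightarrow> real) \<Rightarrow> real) \<Rightarrow>
     (nat set \<times> (nat \<Rightarrow> nat)) set \<Rightarrow> 'w \<Rightarrow> real" where
  "pdd_partial M N X P y J \<omega> = pdd_mean M N X y + (\<Sum>(u, j)\<in>J. pdd_term M N X P y u j \<omega>)"

definition finite_exhaustion :: "'b set \<Rightarrow> (nat \<Rightarrow> 'b set) \<Rightarrow> bool" where
  "finite_exhaustion I J \<longleftrightarrow> (\<forall>n. finite (J n)) \<and> incseq J \<and> (\<Union>n. J n) = I"

definition lebesgue_box :: "nat \<Rightarrow> (nat \<Rightarrow> real) measure" where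
  "lebesgue_box N = (\<Pi>\<^sub>M i\<in>{1..N}. lborel)"

definition joint_density :: "nat \<Rightarrow> (nat \<Rightarrow> real \<Rightarrow> real) \<Rightarrow> (nat \<Rightarrow> real) \<Rightarrow> real" where
  "joint_density N f x = (\<Prod>i\<in>{1..N}. f i (x i))"

definition converges_in_mean_square ::
  "'w measure \<Rightarrow> (nat \<Rightarrow> 'w \<Rightarrow> real) \<Rightarrow> ('w \<Rightarrow> real) \<Rightarrow> bool" where
  "converges_in_mean_square M S Z \<longleftrightarrow>
     (\<forall>n. S n \<in> borel_measurable M) \<and> Z \<in> borel_measurable M \<and>
     (\<forall>n. integrable M (\<lambda>\<omega>. (S n \<omega> - Z \<omega>)\<^sup>2)) \<and>
     (\<lambda>n. LINT \<omega>|M. (S n \<omega> - Z \<omega>)\<^sup>2) \<longlonglongrightarrow> 0"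

definition converges_in_probability ::
  "'w measure \<Rightarrow> (nat \<Rightarrow> 'w \<Rightarrow> real) \<Rightarrow> ('w \<Rightarrow> real) \<Rightarrow> bool" where
  "converges_in_probability M S Z \<longleftrightarrow>
     (\<forall>n. S n \<in> borel_measurable M) \<and> Z \<in> borel_measurable M \<and>
     (\<forall>\<epsilon>>0. (\<lambda>n. measure M {\<omega>\<in>space M. \<epsilon> < \<bar>S n \<omega> - Z \<omega>\<bar>}) \<longlonglongrightarrow> 0)"

definition converges_in_distribution ::
  "'w measure \<Rightarrow> (nat \<Rightarrow> 'w \<Rightarrow> real) \<Rightarrow> ('w \<Rightarrow> real) \<Rightarrow> bool" where
  "converges_in_distribution M S Z \<longleftrightarrow>
     (\<forall>n. S n \<in> borel_measurable M) \<and> Z \<in> borel_measurable M \<and>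
     weak_conv_m (\<lambda>n. distr M borel (S n)) (distr M borel Z)"

end

theory Submission
  imports Defs
begin

text \<open>The heart of the matter is that, for independent inputs with these marginals, products of
  polynomials in the single coordinates are dense in the square-integrable functions of the input
  vector (\<open>products_of_polynomials_dense\<close>). The functions \<open>\<Psi>\<^sub>u\<^sub>,\<^sub>j\<close> together with the constant \<open>1\<close> are
  orthonormal, because expectations of products over independent coordinates factorise, and they
  span the same space. A Fourier partial sum is the best approximation from the span of its terms,
  so it is at least as good as any given approximation once its index set is large enough. This
  gives convergence in mean square along every increasing sequence of finite index sets that
  exhausts all indices; grading by the degree is one of them. Convergence in mean, in probability
  and in distribution follow.

  Density in several variables reduces to one variable: norms of independent factors multiply, so
  products of approximations approximate products, and indicators of boxes generate everything by
  a Dynkin argument.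

  In one variable all five alternatives imply Carleman's condition that the sum of
  \<open>1 / \<mu>\<^sub>2\<^sub>n\<^bsup>1/2n\<^esup>\<close> diverges. It is used through Bang's proof of the Denjoy--Carleman theorem,
  applied not to derivatives of a function but to distances in \<open>L\<^sup>2\<close>. Write \<open>R n\<close> for the norm of
  \<open>x\<^sup>n\<close>, and say that level \<open>k\<close> holds at \<open>t\<close> if for all \<open>n\<close> and \<open>\<theta>\<close> the distance of
  \<open>x\<^sup>n cos (t x + \<theta>)\<close> from the polynomials is at most \<open>e\<^sup>n\<^sup>-\<^sup>k R n\<close>. At \<open>t = 0\<close> every level holds. By
  Taylor's formula, level \<open>k + 1\<close> at \<open>t\<close> implies level \<open>k\<close> at distance at most
  \<open>R k / (e R (k+1))\<close> from \<open>t\<close> (\<open>near_polys_step\<close>). By Carleman's inequality these step lengths have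
  an infinite sum, so starting from a high level one reaches any \<open>t\<close> with any level to spare: the
  functions \<open>cos (t x + \<theta>)\<close> lie in the closure of the polynomials. Bounded continuous functions,
  indicators and finally all square-integrable functions follow (\<open>polynomials_dense\<close>).

  For the Krein--Lin alternative put \<open>\<phi> = - ln f\<close>, let \<open>g(x) = x \<phi>'(x)\<close> be the increasing function
  in Lin's condition and \<open>x\<^sub>n\<close> the point where \<open>g\<close> crosses \<open>2n + 2\<close>. The \<open>2n\<close>-th root of the \<open>2n\<close>-th
  moment is at most a constant times \<open>x\<^sub>n\<close>, while integrating \<open>\<phi>\<close> against \<open>1 / (1 + x\<^sup>2)\<close> gives at
  most a constant plus a multiple of the sum of the \<open>1 / x\<^sub>n\<close>; so the latter sum diverges, and with
  it Carleman's sum.\<close>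

section \<open>Square-integrable functions and closures in mean square\<close>

definition square_integrable :: "'a measure \<Rightarrow> ('a \<Rightarrow> real) \<Rightarrow> bool" where
  "square_integrable M f \<longleftrightarrow> f \<in> borel_measurable M \<and> integrable M (\<lambda>x. (f x)\<^sup>2)"

definition l2norm :: "'a measure \<Rightarrow> ('a \<Rightarrow> real) \<Rightarrow> real" where
  "l2norm M f = sqrt (LINT x|M. (f x)\<^sup>2)"

lemma l2norm_nonneg [simp]: "0 \<le> l2norm M f"
  by (simp add: l2norm_def)

lemma l2norm_squared: "(l2norm M f)\<^sup>2 = (LINT x|M. (f x)\<^sup>2)"
  by (simp add: l2norm_def)

lemma square_integrable_dominated:
  assumes "square_integrable M w" "f \<in> borel_measurable M" "\<And>x. x \<in> space M \<Longrightarrow> \<bar>f x\<bar> \<le> \<bar>w x\<bar>"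
  shows "square_integrable M f"
  unfolding square_integrable_def
proof
  show "integrable M (\<lambda>x. (f x)\<^sup>2)"
  proof (rule Bochner_Integration.integrable_bound)
    show "integrable M (\<lambda>x. (w x)\<^sup>2)" using assms(1) by (simp add: square_integrable_def)
    show "AE x in M. norm ((f x)\<^sup>2) \<le> norm ((w x)\<^sup>2)"
      using assms(3) by (intro AE_I2) (simp add: abs_le_square_iff)
  qed (use assms(2) in measurable)
qed fact

lemma l2norm_mono:
  assumes "square_integrable M w" "f \<in> borel_measurable M" "\<And>x. x \<in> space M \<Longrightarrow> \<bar>f x\<bar> \<le> \<bar>w x\<bar>"
  shows "l2norm M f \<le> l2norm M w"
proof -
  have "square_integrable M f" by (rule square_integrable_dominated[OF assms])
  then show ?thesis unfolding l2norm_def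
    using assms by (intro real_sqrt_le_mono integral_mono) (auto simp: square_integrable_def abs_le_square_iff)
qed

lemma square_integrable_mult:
  assumes "square_integrable M f" "square_integrable M g"
  shows "integrable M (\<lambda>x. f x * g x)"
proof (rule Bochner_Integration.integrable_bound)
  show "integrable M (\<lambda>x. (f x)\<^sup>2 + (g x)\<^sup>2)"
    using assms by (simp add: square_integrable_def)
  show "AE x in M. norm (f x * g x) \<le> norm ((f x)\<^sup>2 + (g x)\<^sup>2)"
  proof (rule AE_I2)
    fix x
    have "2 * \<bar>f x\<bar> * \<bar>g x\<bar> \<le> \<bar>f x\<bar>\<^sup>2 + \<bar>g x\<bar>\<^sup>2" by (rule sum_squares_bound)
    moreover have "0 \<le> \<bar>f x\<bar> * \<bar>g x\<bar>" by simp
    ultimately have "\<bar>f x\<bar> * \<bar>g x\<bar> \<le> \<bar>f x\<bar>\<^sup>2 + \<bar>g x\<bar>\<^sup>2" by linarith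
    then show "norm (f x * g x) \<le> norm ((f x)\<^sup>2 + (g x)\<^sup>2)"
      by (simp add: abs_mult)
  qed
qed (use assms in \<open>auto simp: square_integrable_def\<close>)

lemma square_integrable_add [intro]:
  assumes "square_integrable M f" "square_integrable M g"
  shows "square_integrable M (\<lambda>x. f x + g x)"
proof -
  have "integrable M (\<lambda>x. (f x)\<^sup>2 + (g x)\<^sup>2 + 2 * (f x * g x))"
    using square_integrable_mult[OF assms] assms by (simp add: square_integrable_def)
  moreover have "f \<in> borel_measurable M" "g \<in> borel_measurable M"
    using assms by (auto simp: square_integrable_def)
  ultimately show ?thesis by (simp add: square_integrable_def power2_sum mult.assoc)
qed

lemma square_integrable_scale [intro]:
  "square_integrable M f \<Longrightarrow> square_integrable M (\<lambda>x. c * f x)"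
  by (auto simp: square_integrable_def power_mult_distrib)

lemma square_integrable_diff [intro]:
  assumes "square_integrable M f" "square_integrable M g"
  shows "square_integrable M (\<lambda>x. f x - g x)"
  using square_integrable_add[OF assms(1) square_integrable_scale[OF assms(2), of "-1"]] by simp

lemma square_integrable_zero [simp]: "square_integrable M (\<lambda>x. 0)"
  by (simp add: square_integrable_def)

lemma square_integrable_sum [intro]:
  "(\<And>i. i \<in> F \<Longrightarrow> square_integrable M (f i)) \<Longrightarrow> square_integrable M (\<lambda>x. \<Sum>i\<in>F. f i x)"
  by (induction F rule: infinite_finite_induct) auto

lemma (in finite_measure) square_integrable_bounded:
  assumes "f \<in> borel_measurable M" "\<And>x. x \<in> space M \<Longrightarrow> \<bar>f x\<bar> \<le> B"
  shows "square_integrable M f"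
proof (rule square_integrable_dominated[OF _ assms(1)])
  show "square_integrable M (\<lambda>_. B)" by (simp add: square_integrable_def)
  show "\<bar>f x\<bar> \<le> \<bar>B\<bar>" if "x \<in> space M" for x using assms(2)[OF that] by linarith
qed

lemma l2norm_scale: "l2norm M (\<lambda>x. c * f x) = \<bar>c\<bar> * l2norm M f"
  by (simp add: l2norm_def power_mult_distrib real_sqrt_mult)

text \<open>Integrating \<open>(f + g)\<^sup>2 \<le> (1 + b / a) f\<^sup>2 + (1 + a / b) g\<^sup>2\<close> with \<open>a\<close> and \<open>b\<close>
  slightly above the two norms gives the triangle inequality without the Cauchy--Schwarz inequality;
  the slack keeps the quotients meaningful when a norm vanishes.\<close>

lemma l2norm_triangle:
  assumes f: "square_integrable M f" and g: "square_integrable M g"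
  shows "l2norm M (\<lambda>x. f x + g x) \<le> l2norm M f + l2norm M g"
proof (rule field_le_epsilon)
  fix e :: real assume e: "0 < e"
  define a where "a = l2norm M f + e / 2"
  define b where "b = l2norm M g + e / 2"
  have pos: "0 < a" "0 < b" using e by (auto simp: a_def b_def add_nonneg_pos)
  have *: "(u + v)\<^sup>2 \<le> (1 + b / a) * u\<^sup>2 + (1 + a / b) * v\<^sup>2" for u v :: real
  proof -
    have "0 \<le> (b * u - a * v)\<^sup>2 / (a * b)" using pos by simp
    also have "\<dots> = (1 + b / a) * u\<^sup>2 + (1 + a / b) * v\<^sup>2 - (u + v)\<^sup>2"
      using pos by (simp add: field_simps power2_eq_square)
    finally show ?thesis by simp
  qed
  have "(LINT x|M. (f x + g x)\<^sup>2) \<le> (LINT x|M. (1 + b / a) * (f x)\<^sup>2 + (1 + a / b) * (g x)\<^sup>2)"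
    using f g square_integrable_add[OF f g] *
    by (intro integral_mono) (auto simp: square_integrable_def)
  also have "\<dots> = (1 + b / a) * (l2norm M f)\<^sup>2 + (1 + a / b) * (l2norm M g)\<^sup>2"
    using f g by (simp add: square_integrable_def l2norm_squared)
  also have "\<dots> \<le> (1 + b / a) * a\<^sup>2 + (1 + a / b) * b\<^sup>2"
    using pos e by (intro add_mono mult_left_mono power_mono) (auto simp: a_def b_def)
  also have "\<dots> = (a + b)\<^sup>2" using pos by (simp add: field_simps power2_eq_square)
  finally have "l2norm M (\<lambda>x. f x + g x) \<le> a + b"
    unfolding l2norm_def using pos by (intro real_le_lsqrt) auto
  then show "l2norm M (\<lambda>x. f x + g x) \<le> l2norm M f + l2norm M g + e"
    by (simp add: a_def b_def)
qed

lemma l2norm_triangle_sum: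
  assumes "finite F" "\<And>i. i \<in> F \<Longrightarrow> square_integrable M (f i)"
  shows "l2norm M (\<lambda>x. \<Sum>i\<in>F. f i x) \<le> (\<Sum>i\<in>F. l2norm M (f i))"
  using assms
proof (induction F rule: finite_induct)
  case empty
  then show ?case by (simp add: l2norm_def)
next
  case (insert i F)
  have "l2norm M (\<lambda>x. f i x + (\<Sum>i\<in>F. f i x)) \<le> l2norm M (f i) + l2norm M (\<lambda>x. \<Sum>i\<in>F. f i x)"
    using insert.prems by (intro l2norm_triangle square_integrable_sum) auto
  with insert show ?case by force
qed

definition linear_space :: "('a \<Rightarrow> real) set \<Rightarrow> bool" where
  "linear_space L \<longleftrightarrow> (\<lambda>_. 0) \<in> L \<and> (\<forall>f\<in>L. \<forall>g\<in>L. (\<lambda>x. f x + g x) \<in> L) \<and>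
     (\<forall>f\<in>L. \<forall>c. (\<lambda>x. c * f x) \<in> L)"

definition l2_closure :: "'a measure \<Rightarrow> ('a \<Rightarrow> real) set \<Rightarrow> ('a \<Rightarrow> real) set" where
  "l2_closure M L = {f. square_integrable M f \<and>
     (\<forall>e>0. \<exists>g\<in>L. square_integrable M g \<and> l2norm M (\<lambda>x. f x - g x) < e)}"

lemma l2_closure_square_integrable: "f \<in> l2_closure M L \<Longrightarrow> square_integrable M f"
  by (simp add: l2_closure_def)

lemma l2_closure_I:
  assumes "square_integrable M f"
    and "\<And>e. 0 < e \<Longrightarrow> \<exists>g. g \<in> L \<and> square_integrable M g \<and> l2norm M (\<lambda>x. f x - g x) < e"
  shows "f \<in> l2_closure M L"
  using assms by (auto simp: l2_closure_def)

lemma l2_closure_D: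
  assumes "f \<in> l2_closure M L" "0 < e"
  obtains g where "g \<in> L" "square_integrable M g" "l2norm M (\<lambda>x. f x - g x) < e"
  using assms by (auto simp: l2_closure_def)

lemma l2_closure_superset: "\<lbrakk>f \<in> L; square_integrable M f\<rbrakk> \<Longrightarrow> f \<in> l2_closure M L"
  by (rule l2_closure_I) (auto simp: l2norm_def intro!: exI[of _ f])

lemma l2_closure_scale:
  assumes "linear_space L" "f \<in> l2_closure M L"
  shows "(\<lambda>x. c * f x) \<in> l2_closure M L"
proof (rule l2_closure_I)
  show "square_integrable M (\<lambda>x. c * f x)" using assms(2) by (auto simp: l2_closure_def)
  fix e :: real assume e: "0 < e"
  obtain g where g: "g \<in> L" "square_integrable M g" "l2norm M (\<lambda>x. f x - g x) < e / (\<bar>c\<bar> + 1)"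
    by (rule l2_closure_D[OF assms(2), of "e / (\<bar>c\<bar> + 1)"]) (use e in auto)
  have "l2norm M (\<lambda>x. c * f x - c * g x) = \<bar>c\<bar> * l2norm M (\<lambda>x. f x - g x)"
    by (simp add: l2norm_scale flip: right_diff_distrib)
  also have "\<dots> \<le> \<bar>c\<bar> * (e / (\<bar>c\<bar> + 1))" using g by (intro mult_left_mono) auto
  also have "\<dots> < e" using e by (simp add: field_simps)
  finally show "\<exists>g. g \<in> L \<and> square_integrable M g \<and> l2norm M (\<lambda>x. c * f x - g x) < e"
    using g assms(1) by (intro exI[of _ "\<lambda>x. c * g x"]) (auto simp: linear_space_def)
qed

lemma l2_closure_add:
  assumes "linear_space L" "f \<in> l2_closure M L" "g \<in> l2_closure M L"
  shows "(\<lambda>x. f x + g x) \<in> l2_closure M L"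
proof (rule l2_closure_I)
  note sq = assms(2,3)[THEN l2_closure_square_integrable]
  show "square_integrable M (\<lambda>x. f x + g x)" using sq by auto
  fix e :: real assume e: "0 < e"
  obtain p where p: "p \<in> L" "square_integrable M p" "l2norm M (\<lambda>x. f x - p x) < e / 2"
    by (rule l2_closure_D[OF assms(2), of "e / 2"]) (use e in auto)
  obtain q where q: "q \<in> L" "square_integrable M q" "l2norm M (\<lambda>x. g x - q x) < e / 2"
    by (rule l2_closure_D[OF assms(3), of "e / 2"]) (use e in auto)
  have "l2norm M (\<lambda>x. (f x - p x) + (g x - q x)) < e"
    using l2norm_triangle[of M "\<lambda>x. f x - p x" "\<lambda>x. g x - q x",
        OF square_integrable_diff square_integrable_diff, OF sq(1) p(2) sq(2) q(2)] p(3) q(3) by linarith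
  then have "l2norm M (\<lambda>x. f x + g x - (p x + q x)) < e" by (simp add: algebra_simps)
  then show "\<exists>h. h \<in> L \<and> square_integrable M h \<and> l2norm M (\<lambda>x. f x + g x - h x) < e"
    using p q assms(1) by (intro exI[of _ "\<lambda>x. p x + q x"]) (auto simp: linear_space_def)
qed

lemma l2_closure_diff:
  assumes "linear_space L" "f \<in> l2_closure M L" "g \<in> l2_closure M L"
  shows "(\<lambda>x. f x - g x) \<in> l2_closure M L"
  using l2_closure_add[OF assms(1,2) l2_closure_scale[OF assms(1,3), of "-1"]] by simp

lemma l2_closure_sum:
  assumes "linear_space L" "\<And>i. i \<in> F \<Longrightarrow> f i \<in> l2_closure M L"
  shows "(\<lambda>x. \<Sum>i\<in>F. f i x) \<in> l2_closure M L"
proof -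
  have "(\<lambda>x. 0) \<in> l2_closure M L"
    using assms(1) by (intro l2_closure_superset) (auto simp: linear_space_def)
  then show ?thesis using assms(2)
    by (induction F rule: infinite_finite_induct) (simp_all add: l2_closure_add[OF assms(1)])
qed

lemma l2_closure_closed:
  assumes f: "square_integrable M f"
    and ap: "\<And>e. 0 < e \<Longrightarrow> \<exists>g. g \<in> l2_closure M L \<and> l2norm M (\<lambda>x. f x - g x) < e"
  shows "f \<in> l2_closure M L"
proof (rule l2_closure_I[OF f])
  fix e :: real assume e: "0 < e"
  obtain g where g: "g \<in> l2_closure M L" "l2norm M (\<lambda>x. f x - g x) < e / 2"
    using ap[of "e / 2"] e by auto
  obtain p where p: "p \<in> L" "square_integrable M p" "l2norm M (\<lambda>x. g x - p x) < e / 2"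
    by (rule l2_closure_D[OF g(1), of "e / 2"]) (use e in auto)
  have "l2norm M (\<lambda>x. (f x - g x) + (g x - p x)) < e"
    using l2norm_triangle[of M "\<lambda>x. f x - g x" "\<lambda>x. g x - p x",
        OF square_integrable_diff square_integrable_diff,
        OF f l2_closure_square_integrable[OF g(1)] l2_closure_square_integrable[OF g(1)] p(2)]
      g(2) p(3) by linarith
  then show "\<exists>h. h \<in> L \<and> square_integrable M h \<and> l2norm M (\<lambda>x. f x - h x) < e"
    using p by auto
qed

text \<open>Dominated convergence of the squared differences.\<close>

lemma l2_closure_dominated_limit:
  assumes cl: "\<And>n. \<phi> n \<in> l2_closure M L" and w: "square_integrable M w"
    and dom: "\<And>n x. x \<in> space M \<Longrightarrow> \<bar>\<phi> n x\<bar> \<le> w x"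
    and lim: "\<And>x. x \<in> space M \<Longrightarrow> (\<lambda>n. \<phi> n x) \<longlonglongrightarrow> f x"
  shows "f \<in> l2_closure M L"
proof (rule l2_closure_closed)
  have [measurable]: "\<phi> n \<in> borel_measurable M" for n
    using cl by (auto simp: l2_closure_def square_integrable_def)
  have fm [measurable]: "f \<in> borel_measurable M"
    by (rule borel_measurable_LIMSEQ_real[OF lim]) auto
  have fw: "\<bar>f x\<bar> \<le> w x" if "x \<in> space M" for x
    using dom[OF that] lim[OF that] by (intro LIMSEQ_le_const2[OF tendsto_rabs]) auto
  show f: "square_integrable M f"
    using fw by (intro square_integrable_dominated[OF w fm]) force
  have "(\<lambda>n. LINT x|M. (f x - \<phi> n x)\<^sup>2) \<longlonglongrightarrow> (LINT x|M. 0)"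
  proof (rule integral_dominated_convergence[where w = "\<lambda>x. 4 * (w x)\<^sup>2"])
    show "integrable M (\<lambda>x. 4 * (w x)\<^sup>2)" using w by (simp add: square_integrable_def)
    show "AE x in M. (\<lambda>n. (f x - \<phi> n x)\<^sup>2) \<longlonglongrightarrow> 0"
    proof (rule AE_I2)
      fix x assume "x \<in> space M"
      then have "(\<lambda>n. (f x - \<phi> n x)\<^sup>2) \<longlonglongrightarrow> (f x - f x)\<^sup>2" by (intro tendsto_intros lim)
      then show "(\<lambda>n. (f x - \<phi> n x)\<^sup>2) \<longlonglongrightarrow> 0" by simp
    qed
    show "AE x in M. norm ((f x - \<phi> n x)\<^sup>2) \<le> 4 * (w x)\<^sup>2" for n
    proof (rule AE_I2)
      fix x assume x: "x \<in> space M"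
      have "\<bar>f x - \<phi> n x\<bar> \<le> 2 * w x" using fw[OF x] dom[OF x, of n] by linarith
      then have "\<bar>f x - \<phi> n x\<bar>\<^sup>2 \<le> (2 * w x)\<^sup>2" by (intro power_mono) auto
      then show "norm ((f x - \<phi> n x)\<^sup>2) \<le> 4 * (w x)\<^sup>2" by (simp add: power_mult_distrib)
    qed
  qed auto
  then have lim0: "(\<lambda>n. l2norm M (\<lambda>x. f x - \<phi> n x)) \<longlonglongrightarrow> sqrt 0"
    unfolding l2norm_def by (intro tendsto_real_sqrt) simp
  fix e :: real assume "0 < e"
  then obtain n where "l2norm M (\<lambda>x. f x - \<phi> n x) < e"
    using order_tendstoD(2)[OF lim0, of e] by (auto simp: eventually_sequentially)
  then show "\<exists>g. g \<in> l2_closure M L \<and> l2norm M (\<lambda>x. f x - g x) < e" using cl by blast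
qed

text \<open>The sets whose indicators lie in the closure form a Dynkin system, so it suffices to
  approximate the indicators of an intersection-stable generator.\<close>

lemma (in finite_measure) l2_closure_generator:
  assumes L: "linear_space L" and h: "h \<in> M \<rightarrow>\<^sub>M S"
    and G: "Int_stable G" "G \<subseteq> Pow (space S)" "sets S = sigma_sets (space S) G"
    and one: "(\<lambda>_. 1) \<in> l2_closure M L"
    and gen: "\<And>B. B \<in> G \<Longrightarrow> (\<lambda>x. indicator B (h x)) \<in> l2_closure M L"
    and g: "g \<in> borel_measurable S" "square_integrable M (\<lambda>x. g (h x))"
  shows "(\<lambda>x. g (h x)) \<in> l2_closure M L"
proof -
  note [measurable] = h
  have hsp: "h x \<in> space S" if "x \<in> space M" for x using h that by (rule measurable_space)
  have scal: "(\<lambda>x. c * f x) \<in> l2_closure M L" if "f \<in> l2_closure M L" for c f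
    using l2_closure_scale[OF L that] .
  have ind: "(\<lambda>x. indicator B (h x)) \<in> l2_closure M L" if "B \<in> sets S" for B
    using G(1,2) that[unfolded G(3)]
  proof (induction rule: sigma_sets_induct_disjoint)
    case (basic B)
    then show ?case by (rule gen)
  next
    case empty
    then show ?case using scal[OF one, of 0] by simp
  next
    case (compl B)
    have "(\<lambda>x. 1 - indicator B (h x)) \<in> l2_closure M L"
      by (rule l2_closure_diff[OF L one compl.IH])
    then show ?case
    proof (rule l2_closure_dominated_limit[where w = "\<lambda>_. 1" and \<phi> = "\<lambda>_ x. 1 - indicator B (h x)"])
      show "(\<lambda>n. 1 - indicator B (h x)) \<longlonglongrightarrow> (indicator (space S - B) (h x) :: real)"
        if "x \<in> space M" for x
        using hsp[OF that] by (auto simp: indicator_def)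
    qed (auto simp: square_integrable_def)
  next
    case (union B)
    have [measurable]: "B i \<in> sets S" for i using union.hyps(2) by (auto simp: G(3))
    show ?case
    proof (rule l2_closure_dominated_limit[where w = "\<lambda>_. 1" and
          \<phi> = "\<lambda>n x. \<Sum>i<n. indicator (B i) (h x)"])
      show "(\<lambda>x. \<Sum>i<n. indicator (B i) (h x)) \<in> l2_closure M L" for n
        by (rule l2_closure_sum[OF L]) (use union in auto)
      have eq: "(\<Sum>i<n. indicator (B i) z) = (indicator (\<Union>i<n. B i) z :: real)" for n z
        by (subst indicator_UN_disjoint) (use union.hyps(1) in \<open>auto simp: disjoint_family_on_def\<close>)
      show "\<bar>\<Sum>i<n. indicator (B i) (h x)\<bar> \<le> (1::real)" for n x
        unfolding eq by (simp add: indicator_def)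
      show "(\<lambda>n. \<Sum>i<n. indicator (B i) (h x)) \<longlonglongrightarrow> (indicator (\<Union>i. B i) (h x) :: real)" for x
        unfolding eq by (rule LIMSEQ_indicator_UN)
    qed (auto simp: square_integrable_def)
  qed
  have simple: "(\<lambda>x. s (h x)) \<in> l2_closure M L" if s: "simple_function S s" for s :: "_ \<Rightarrow> real"
  proof -
    have fin: "finite (s ` space S)" using s by (simp add: simple_function_def)
    have "(\<lambda>x. \<Sum>v\<in>s ` space S. v * indicator (s -` {v} \<inter> space S) (h x)) \<in> l2_closure M L"
      using s by (intro l2_closure_sum[OF L] scal ind) (auto simp: simple_function_def)
    then show ?thesis
    proof (rule l2_closure_dominated_limit[where w = "\<lambda>x. \<bar>s (h x)\<bar>" and
          \<phi> = "\<lambda>_ x. \<Sum>v\<in>s ` space S. v * indicator (s -` {v} \<inter> space S) (h x)"])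
      have eq: "(\<Sum>v\<in>s ` space S. v * indicator (s -` {v} \<inter> space S) (h x)) = s (h x)"
        if "x \<in> space M" for x
        using simple_function_indicator_representation_banach[OF s hsp[OF that], symmetric]
        by (simp only: real_scaleR_def mult.commute)
      show "square_integrable M (\<lambda>x. \<bar>s (h x)\<bar>)"
      proof (rule square_integrable_bounded)
        show "(\<lambda>x. \<bar>s (h x)\<bar>) \<in> borel_measurable M"
          using borel_measurable_simple_function[OF s] by measurable
        show "\<bar>\<bar>s (h x)\<bar>\<bar> \<le> (\<Sum>v\<in>s ` space S. \<bar>v\<bar>)" if "x \<in> space M" for x
          using member_le_sum[of "s (h x)" "s ` space S" abs] fin hsp[OF that] by auto
      qed
      show "\<bar>\<Sum>v\<in>s ` space S. v * indicator (s -` {v} \<inter> space S) (h x)\<bar> \<le> \<bar>s (h x)\<bar>"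
        if "x \<in> space M" for x using eq[OF that] by simp
      show "(\<lambda>n. \<Sum>v\<in>s ` space S. v * indicator (s -` {v} \<inter> space S) (h x)) \<longlonglongrightarrow> s (h x)"
        if "x \<in> space M" for x using eq[OF that] by simp
    qed
  qed
  from borel_measurable_implies_sequence_metric[OF g(1), of 0]
  obtain s where s: "\<forall>n. simple_function S (s n)" "\<forall>z\<in>space S. (\<lambda>n. s n z) \<longlonglongrightarrow> g z"
    "\<forall>n. \<forall>z\<in>space S. dist (s n z) 0 \<le> 2 * dist (g z) 0" by blast
  show ?thesis
  proof (rule l2_closure_dominated_limit[where w = "\<lambda>x. 2 * \<bar>g (h x)\<bar>" and \<phi> = "\<lambda>n x. s n (h x)"])
    show "square_integrable M (\<lambda>x. 2 * \<bar>g (h x)\<bar>)"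
      using g(2) by (auto simp: square_integrable_def power_mult_distrib)
  qed (use s hsp in \<open>auto intro!: simple\<close>)
qed

section \<open>Carleman's inequality\<close>

lemma fact_ge_power: "((real n + 1) / exp 1) ^ n \<le> fact n"
proof (induction n)
  case (Suc n)
  have "((real (Suc n) + 1) / exp 1) ^ Suc n = ((real n + 1) / exp 1) ^ Suc n * (1 + 1 / real (Suc n)) ^ Suc n"
  proof -
    have "(real (Suc n) + 1) / exp 1 = (real n + 1) / exp 1 * (1 + 1 / real (Suc n))"
      by (simp add: divide_simps)
    then show ?thesis by (simp only: power_mult_distrib)
  qed
  also have "\<dots> \<le> ((real n + 1) / exp 1) ^ Suc n * exp 1"
    by (intro mult_left_mono exp_ge_one_plus_x_over_n_power_n) auto
  also have "\<dots> = ((real n + 1) / exp 1) ^ n * (real n + 1)" by (simp add: field_simps)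
  also have "\<dots> \<le> fact n * (real n + 1)" by (intro mult_right_mono Suc) auto
  finally show ?case by (simp add: algebra_simps)
qed simp

text \<open>Weighting the terms by \<open>1, 2, \<dots>, n\<close> before applying the inequality of the arithmetic and
  geometric means costs the factor \<open>(n!)\<^sup>1\<^sup>/\<^sup>n \<ge> (n + 1) / e\<close>, after which the right-hand sides
  telescope.\<close>

lemma Carleman_inequality:
  fixes a :: "nat \<Rightarrow> real"
  assumes a: "\<And>j. 0 < a j"
  shows "(\<Sum>n<K. (\<Prod>j<Suc n. a j) powr (1 / real (Suc n))) \<le> exp 1 * (\<Sum>j<K. a j)"
proof -
  define T where "T n = (\<Sum>j<n. (real j + 1) * a j)" for n
  have T: "0 \<le> T n" for n unfolding T_def using a by (intro sum_nonneg) (simp add: less_imp_le)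
  have bound: "(\<Prod>j<Suc n. a j) powr (1 / real (Suc n)) \<le> exp 1 / ((real n + 1) * (real n + 2)) * T (Suc n)"
    for n
  proof -
    let ?p = "1 / real (Suc n)"
    have fct: "(\<Prod>j<k. real j + 1) = fact k" for k
      by (induction k) (simp_all add: algebra_simps)
    have "(real n + 2) / exp 1 = (((real n + 2) / exp 1) ^ Suc n) powr ?p"
      by (subst powr_realpow[symmetric]) (simp_all add: powr_powr add_pos_pos del: of_nat_Suc power_Suc)
    also have "\<dots> \<le> fact (Suc n) powr ?p"
      using fact_ge_power[of "Suc n"] by (intro powr_mono2) (simp_all add: add.commute)
    finally have f: "(real n + 2) / exp 1 \<le> fact (Suc n) powr ?p" .
    have "(real n + 2) / exp 1 * (\<Prod>j<Suc n. a j) powr ?p \<le> fact (Suc n) powr ?p * (\<Prod>j<Suc n. a j) powr ?p"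
      by (intro mult_right_mono f) auto
    also have "\<dots> = (\<Prod>j<Suc n. (real j + 1) * a j) powr ?p"
      using a by (simp only: prod.distrib fct) (subst powr_mult, auto intro!: prod_nonneg simp: less_imp_le)
    also have "\<dots> \<le> (\<Sum>j<Suc n. ((real j + 1) * a j) / real (card {..<Suc n}))"
    proof -
      have nn: "0 \<le> (real j + 1) * a j" for j using a[of j] by (simp add: less_imp_le)
      show ?thesis
        using arith_geom_mean[of "{..<Suc n}" "\<lambda>j. (real j + 1) * a j", OF _ _ nn]
        by (simp only: card_lessThan finite_lessThan lessThan_empty_iff)
    qed
    also have "\<dots> = T (Suc n) / (real n + 1)"
      by (simp only: T_def sum_divide_distrib[symmetric] card_lessThan of_nat_Suc) (simp only: add.commute)
    finally have le: "(real n + 2) / exp 1 * (\<Prod>j<Suc n. a j) powr ?p \<le> T (Suc n) / (real n + 1)" .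
    have "(\<Prod>j<Suc n. a j) powr ?p = exp 1 / (real n + 2) * ((real n + 2) / exp 1 * (\<Prod>j<Suc n. a j) powr ?p)"
      by (simp del: prod.lessThan_Suc of_nat_Suc)
    also have "\<dots> \<le> exp 1 / (real n + 2) * (T (Suc n) / (real n + 1))"
      by (intro mult_left_mono le) simp
    also have "\<dots> = exp 1 / ((real n + 1) * (real n + 2)) * T (Suc n)" by (simp add: mult.commute)
    finally show ?thesis .
  qed
  have tele: "(\<Sum>n<K. exp 1 / ((real n + 1) * (real n + 2)) * T (Suc n)) =
      exp 1 * (\<Sum>j<K. a j) - exp 1 / (real K + 1) * T K" for K
  proof (induction K)
    case 0
    show ?case by (simp add: T_def)
  next
    case (Suc K)
    have TS: "T K = T (Suc K) - (real K + 1) * a K" by (simp add: T_def)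
    have nz: "real K + 1 \<noteq> 0" "real K + 2 \<noteq> 0" by linarith+
    have "exp 1 / ((real K + 1) * (real K + 2)) * T (Suc K) =
        exp 1 / (real K + 1) * T (Suc K) - exp 1 / (real K + 2) * T (Suc K)"
      using nz by (simp add: divide_simps) algebra
    moreover have "exp 1 / (real K + 1) * T K = exp 1 / (real K + 1) * T (Suc K) - exp 1 * a K"
      unfolding TS using nz by (simp add: divide_simps) algebra
    ultimately show ?case using Suc by (simp add: algebra_simps)
  qed
  have "(\<Sum>n<K. (\<Prod>j<Suc n. a j) powr (1 / real (Suc n))) \<le>
      (\<Sum>n<K. exp 1 / ((real n + 1) * (real n + 2)) * T (Suc n))"
    by (intro sum_mono bound)
  also have "\<dots> \<le> exp 1 * (\<Sum>j<K. a j)"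
    unfolding tele using T[of K] by (simp add: field_simps)
  finally show ?thesis .
qed

section \<open>Polynomials of a random variable under Carleman's condition\<close>

text \<open>The shift of the phase by \<open>\<pi> / 2\<close> encodes differentiation, which keeps the
  expansion real.\<close>

lemma cos_Taylor:
  fixes y s :: real
  assumes "0 < m"
  shows "\<bar>cos (y + s) - (\<Sum>i<m. s ^ i / fact i * cos (y + real i * (pi / 2)))\<bar> \<le> \<bar>s\<bar> ^ m / fact m"
proof -
  obtain k where m: "m = Suc k" using assms gr0_conv_Suc by auto
  have trm: "Re (cis y * ((\<i> * s) ^ i / fact i)) = s ^ i / fact i * cos (y + real i * (pi / 2))" for i
  proof -
    have "\<i> ^ i = cis (real i * (pi / 2))"
      using Complex.DeMoivre[of "pi / 2" i] by (simp only: cis_pi_half)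
    then have "cis y * ((\<i> * s) ^ i / fact i) = complex_of_real (s ^ i / fact i) * cis (y + real i * (pi / 2))"
      by (simp add: power_mult_distrib cis_mult[symmetric])
    then show ?thesis by (metis Re_complex_of_real Im_complex_of_real mult_zero_left diff_zero times_complex.simps(1) cis.simps(1))
  qed
  have "cos (y + s) - (\<Sum>i<m. s ^ i / fact i * cos (y + real i * (pi / 2))) =
      Re (cis y * (iexp s - (\<Sum>i\<le>k. (\<i> * s) ^ i / fact i)))"
  proof -
    have "Re (cis y * iexp s) = cos (y + s)"
      by (simp add: cis_conv_exp[symmetric] cis_mult)
    moreover have "Re (cis y * (\<Sum>i\<le>k. (\<i> * s) ^ i / fact i)) = (\<Sum>i<m. s ^ i / fact i * cos (y + real i * (pi / 2)))"
      unfolding sum_distrib_left Re_sum trm m lessThan_Suc_atMost ..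
    ultimately show ?thesis by (simp only: right_diff_distrib minus_complex.simps)
  qed
  also have "\<bar>\<dots>\<bar> \<le> cmod (cis y * (iexp s - (\<Sum>i\<le>k. (\<i> * s) ^ i / fact i)))"
    by (rule abs_Re_le_cmod)
  also have "\<dots> \<le> \<bar>s\<bar> ^ m / fact m"
    unfolding norm_mult m using iexp_approx1[of s k] by simp
  finally show ?thesis .
qed

lemma exp_partial_sum_le:
  fixes z :: real
  assumes "0 \<le> z"
  shows "(\<Sum>i\<le>m. z ^ i / fact i) \<le> exp z"
  unfolding exp_def using summable_exp[of z] assms
  by (intro sum_le_suminf[of _ "{..m}", THEN order_trans]) (auto simp: field_simps scaleR_conv_of_real)

definition polys_of :: "('a \<Rightarrow> real) \<Rightarrow> ('a \<Rightarrow> real) set" where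
  "polys_of X = {\<lambda>\<omega>. poly p (X \<omega>) | p. True}"

lemma linear_space_polys_of: "linear_space (polys_of X)"
  unfolding linear_space_def
proof (intro conjI ballI allI)
  show "(\<lambda>_. 0) \<in> polys_of X" unfolding polys_of_def by (auto intro!: exI[of _ 0])
next
  fix f g assume "f \<in> polys_of X" "g \<in> polys_of X"
  then obtain p q where "f = (\<lambda>\<omega>. poly p (X \<omega>))" "g = (\<lambda>\<omega>. poly q (X \<omega>))"
    by (auto simp: polys_of_def)
  then show "(\<lambda>x. f x + g x) \<in> polys_of X"
    unfolding polys_of_def by (auto intro!: exI[of _ "p + q"])
next
  fix f c assume "f \<in> polys_of X"
  then obtain p where "f = (\<lambda>\<omega>. poly p (X \<omega>))" by (auto simp: polys_of_def)
  then show "(\<lambda>x. c * f x) \<in> polys_of X"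
    unfolding polys_of_def by (auto intro!: exI[of _ "smult c p"])
qed

locale moments = prob_space +
  fixes X :: "'a \<Rightarrow> real"
  assumes X_measurable [measurable]: "X \<in> borel_measurable M"
    and moments_finite: "\<And>l. integrable M (\<lambda>\<omega>. X \<omega> ^ l)"
begin

lemma integrable_poly: "integrable M (\<lambda>\<omega>. poly p (X \<omega>))"
  unfolding poly_altdef by (intro Bochner_Integration.integrable_sum integrable_mult_right moments_finite)

lemma square_integrable_poly: "square_integrable M (\<lambda>\<omega>. poly p (X \<omega>))"
  using integrable_poly[of "p * p"] unfolding square_integrable_def
  by (simp add: power2_eq_square borel_measurable_integrable integrable_poly)

lemma polys_of_I: "(\<lambda>\<omega>. poly p (X \<omega>)) \<in> l2_closure M (polys_of X)"
  by (rule l2_closure_superset) (auto simp: polys_of_def square_integrable_poly)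

lemma square_integrable_power: "square_integrable M (\<lambda>\<omega>. X \<omega> ^ n)"
  using square_integrable_poly[of "monom 1 n"] by (simp add: poly_monom)

text \<open>Since \<open>(R n)\<^sup>2\<close> is the moment of order \<open>2n\<close>, Carleman's condition concerns the \<open>n\<close>-th roots
  of these norms.\<close>

definition R :: "nat \<Rightarrow> real" where "R n = l2norm M (\<lambda>\<omega>. X \<omega> ^ n)"

lemma R_squared: "(R n)\<^sup>2 = moment M X (2 * n)"
  by (simp add: R_def l2norm_squared moment_def power_mult[symmetric] mult.commute)

lemma R_0: "R 0 = 1"
  by (simp add: R_def l2norm_def prob_space)

text \<open>The induction hypothesis of Bang's argument. It controls the powers of all orders at once,
  because the Taylor expansion of one order involves the higher ones.\<close>

definition near_polys :: "nat \<Rightarrow> real \<Rightarrow> bool" where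
  "near_polys k t \<longleftrightarrow> (\<forall>n \<theta>. \<exists>p. l2norm M (\<lambda>\<omega>. X \<omega> ^ n * cos (t * X \<omega> + \<theta>) - poly p (X \<omega>))
     \<le> exp (real n - real k) * R n)"

lemma near_polys_0: "near_polys k 0"
  unfolding near_polys_def
proof (intro allI)
  fix n \<theta>
  have "l2norm M (\<lambda>\<omega>. X \<omega> ^ n * cos (0 * X \<omega> + \<theta>) - poly (monom (cos \<theta>) n) (X \<omega>)) = 0"
    by (simp add: poly_monom l2norm_def mult.commute)
  also have "0 \<le> exp (real n - real k) * R n" by (simp add: R_def)
  finally show "\<exists>p. l2norm M (\<lambda>\<omega>. X \<omega> ^ n * cos (0 * X \<omega> + \<theta>) - poly p (X \<omega>)) \<le> exp (real n - real k) * R n"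
    by blast
qed

end

text \<open>Positive even moments exclude the point mass at \<open>0\<close>, so that ratios and roots of the norms
  make sense.\<close>

locale nontrivial_moments = moments +
  assumes even_moments_pos: "\<And>n. 0 < moment M X (2 * n)"
begin

lemma R_pos: "0 < R n"
  using even_moments_pos[of n] R_squared[of n] by (metis R_def l2norm_nonneg less_eq_real_def less_numeral_extra(3) zero_power2)

text \<open>The inequality of arithmetic and geometric means, weighted by the ratio of the two outer
  norms, plays the part of the Cauchy--Schwarz inequality.\<close>

lemma R_log_convex: "(R (Suc n))\<^sup>2 \<le> R n * R (Suc (Suc n))"
proof -
  define s where "s = R (Suc (Suc n)) / R n"
  have s: "0 < s" using R_pos by (simp add: s_def)
  have pt: "(x ^ Suc n)\<^sup>2 \<le> s / 2 * (x ^ n)\<^sup>2 + 1 / (2 * s) * (x ^ Suc (Suc n))\<^sup>2" for x :: real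
  proof -
    have "0 \<le> (s * x ^ n - x ^ Suc (Suc n))\<^sup>2 / (2 * s)" using s by simp
    also have "\<dots> = s / 2 * (x ^ n)\<^sup>2 + 1 / (2 * s) * (x ^ Suc (Suc n))\<^sup>2 - (x ^ Suc n)\<^sup>2"
      using s by (simp add: field_simps power2_eq_square)
    finally show ?thesis by simp
  qed
  have int: "integrable M (\<lambda>\<omega>. (X \<omega> ^ k)\<^sup>2)" for k
    using square_integrable_power[of k] by (simp add: square_integrable_def)
  have "(R (Suc n))\<^sup>2 \<le> (LINT \<omega>|M. s / 2 * (X \<omega> ^ n)\<^sup>2 + 1 / (2 * s) * (X \<omega> ^ Suc (Suc n))\<^sup>2)"
    unfolding R_def l2norm_squared by (intro integral_mono pt int Bochner_Integration.integrable_add integrable_mult_right)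
  also have "\<dots> = s / 2 * (R n)\<^sup>2 + 1 / (2 * s) * (R (Suc (Suc n)))\<^sup>2"
    unfolding R_def l2norm_squared
    by (subst Bochner_Integration.integral_add) (simp_all only: int integrable_mult_right integral_mult_right_zero)
  also have "\<dots> = R n * R (Suc (Suc n))"
    using R_pos[of n] R_pos[of "Suc (Suc n)"] by (simp add: s_def field_simps power2_eq_square)
  finally show ?thesis .
qed

definition growth :: "nat \<Rightarrow> real" where "growth n = R (Suc n) / R n"

lemma growth_pos: "0 < growth n"
  by (simp add: growth_def R_pos)

lemma growth_mono: "m \<le> n \<Longrightarrow> growth m \<le> growth n"
proof (rule lift_Suc_mono_le[of growth])
  fix n
  show "growth n \<le> growth (Suc n)"
    using R_log_convex[of n] R_pos[of n] R_pos[of "Suc n"]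
    by (simp add: growth_def divide_simps power2_eq_square mult.commute)
qed

lemma R_le_growth_power:
  assumes "n + i \<le> Suc k"
  shows "R (n + i) \<le> R n * growth k ^ i"
  using assms
proof (induction i)
  case (Suc i)
  have "R (n + Suc i) = R (n + i) * growth (n + i)"
    using R_pos[of "n + i"] by (simp add: growth_def)
  also have "\<dots> \<le> (R n * growth k ^ i) * growth k"
    using Suc growth_pos[of "n + i"] growth_pos[of k] R_pos[of n] by (intro mult_mono growth_mono) (auto simp: less_imp_le)
  finally show ?case by (simp add: mult_ac)
qed simp

text \<open>Bang's argument: expand to order \<open>k + 1 - n\<close>. By the choice of the step each Taylor
  term, the remainder included, is at most \<open>e\<^sup>n\<^sup>-\<^sup>k\<^sup>-\<^sup>1 R n\<close> times the corresponding term of the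
  exponential series at \<open>1\<close>, so the loss is one factor \<open>e\<close>.\<close>

lemma near_polys_step:
  assumes near: "near_polys (Suc k) t" and h: "\<bar>h\<bar> \<le> 1 / (exp 1 * growth k)"
  shows "near_polys k (t + h)"
  unfolding near_polys_def
proof (intro allI)
  fix n \<theta>
  show "\<exists>p. l2norm M (\<lambda>\<omega>. X \<omega> ^ n * cos ((t + h) * X \<omega> + \<theta>) - poly p (X \<omega>)) \<le> exp (real n - real k) * R n"
  proof (cases "k < n")
    case True
    \<comment> \<open>Here the bound exceeds the norm of the function, and the zero polynomial will do.\<close>
    have "l2norm M (\<lambda>\<omega>. X \<omega> ^ n * cos ((t + h) * X \<omega> + \<theta>) - poly 0 (X \<omega>)) \<le> R n"
      unfolding R_def by (rule l2norm_mono[OF square_integrable_power])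
        (auto simp: abs_mult intro!: mult_left_le abs_cos_le_one)
    also have "\<dots> \<le> exp (real n - real k) * R n" using True R_pos[of n] by simp
    finally show ?thesis by blast
  next
    case False
    define m where "m = Suc k - n"
    have m: "0 < m" "n + m = Suc k" using False by (auto simp: m_def)
    have "\<forall>i. \<exists>p. l2norm M (\<lambda>\<omega>. X \<omega> ^ (n + i) * cos (t * X \<omega> + (\<theta> + real i * (pi / 2))) - poly p (X \<omega>))
        \<le> exp (real (n + i) - real (Suc k)) * R (n + i)"
      using near unfolding near_polys_def by blast
    then obtain p where p: "l2norm M (\<lambda>\<omega>. X \<omega> ^ (n + i) * cos (t * X \<omega> + (\<theta> + real i * (pi / 2))) - poly (p i) (X \<omega>))
        \<le> exp (real (n + i) - real (Suc k)) * R (n + i)" for i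
      unfolding choice_iff by blast
    define D where "D i \<omega> = X \<omega> ^ (n + i) * cos (t * X \<omega> + (\<theta> + real i * (pi / 2))) - poly (p i) (X \<omega>)" for i \<omega>
    define E where "E \<omega> = X \<omega> ^ n * (cos ((t + h) * X \<omega> + \<theta>) -
        (\<Sum>i<m. (h * X \<omega>) ^ i / fact i * cos (t * X \<omega> + \<theta> + real i * (pi / 2))))" for \<omega>
    define q where "q = (\<Sum>i<m. smult (h ^ i / fact i) (p i))"
    have sqD: "square_integrable M (D i)" for i
      unfolding D_def
      by (intro square_integrable_diff square_integrable_poly square_integrable_dominated[OF square_integrable_power[of "n + i"]])
        (auto simp: abs_mult intro!: mult_left_le abs_cos_le_one)
    have E_bound: "\<bar>E \<omega>\<bar> \<le> \<bar>\<bar>h\<bar> ^ m / fact m * X \<omega> ^ Suc k\<bar>" for \<omega>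
    proof -
      have "\<bar>E \<omega>\<bar> \<le> \<bar>X \<omega>\<bar> ^ n * (\<bar>h * X \<omega>\<bar> ^ m / fact m)"
        using cos_Taylor[OF m(1), of "t * X \<omega> + \<theta>" "h * X \<omega>"] unfolding E_def abs_mult power_abs
        by (intro mult_left_mono) (simp_all add: algebra_simps)
      also have "\<dots> = \<bar>\<bar>h\<bar> ^ m / fact m * X \<omega> ^ Suc k\<bar>"
        unfolding m(2)[symmetric] by (simp add: abs_mult power_mult_distrib power_add power_abs)
      finally show ?thesis .
    qed
    have Em: "E \<in> borel_measurable M" unfolding E_def by measurable
    have sqE: "square_integrable M E"
      by (rule square_integrable_dominated[OF square_integrable_scale[OF square_integrable_power] Em E_bound])
    have nE: "l2norm M E \<le> \<bar>h\<bar> ^ m / fact m * R (n + m)"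
    proof -
      have "l2norm M E \<le> l2norm M (\<lambda>\<omega>. \<bar>h\<bar> ^ m / fact m * X \<omega> ^ Suc k)"
        by (rule l2norm_mono[OF square_integrable_scale[OF square_integrable_power] Em E_bound])
      then show ?thesis unfolding l2norm_scale R_def m(2) by simp
    qed
    have split: "X \<omega> ^ n * cos ((t + h) * X \<omega> + \<theta>) - poly q (X \<omega>) = E \<omega> + (\<Sum>i<m. h ^ i / fact i * D i \<omega>)" for \<omega>
      unfolding E_def D_def q_def poly_sum poly_smult right_diff_distrib sum_subtractf sum_distrib_left
      by (simp add: power_add power_mult_distrib mult_ac add.assoc)
    have "l2norm M (\<lambda>\<omega>. X \<omega> ^ n * cos ((t + h) * X \<omega> + \<theta>) - poly q (X \<omega>)) \<le>
        l2norm M E + l2norm M (\<lambda>\<omega>. \<Sum>i<m. h ^ i / fact i * D i \<omega>)"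
      unfolding split by (intro l2norm_triangle sqE square_integrable_sum square_integrable_scale sqD)
    also have "\<dots> \<le> l2norm M E + (\<Sum>i<m. l2norm M (\<lambda>\<omega>. h ^ i / fact i * D i \<omega>))"
      by (intro add_left_mono l2norm_triangle_sum square_integrable_scale sqD) auto
    also have "\<dots> \<le> \<bar>h\<bar> ^ m / fact m * R (n + m) +
        (\<Sum>i<m. \<bar>h\<bar> ^ i / fact i * (exp (real (n + i) - real (Suc k)) * R (n + i)))"
      unfolding l2norm_scale abs_divide power_abs
      by (intro add_mono nE sum_mono mult_mono) (use p in \<open>auto simp: D_def\<close>)
    also have "\<dots> = (\<Sum>i\<le>m. \<bar>h\<bar> ^ i / fact i * (exp (real (n + i) - real (Suc k)) * R (n + i)))"
    proof -
      have "exp (real (n + m) - real (Suc k)) = 1" using m(2) by simp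
      then show ?thesis unfolding lessThan_Suc_atMost[symmetric] by simp
    qed
    also have "\<dots> \<le> (\<Sum>i\<le>m. \<bar>h\<bar> ^ i / fact i * (exp (real (n + i) - real (Suc k)) * (R n * growth k ^ i)))"
      using m by (intro sum_mono mult_left_mono R_le_growth_power) auto
    also have "\<dots> = exp (real n - real (Suc k)) * R n * (\<Sum>i\<le>m. (exp 1 * \<bar>h\<bar> * growth k) ^ i / fact i)"
      unfolding sum_distrib_left
    proof (intro sum.cong refl)
      fix i
      have "exp (real (n + i) - real (Suc k)) = exp (real n - real (Suc k)) * exp 1 ^ i"
        by (simp add: exp_of_nat_mult[symmetric] exp_add[symmetric] algebra_simps)
      then show "\<bar>h\<bar> ^ i / fact i * (exp (real (n + i) - real (Suc k)) * (R n * growth k ^ i)) =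
          exp (real n - real (Suc k)) * R n * ((exp 1 * \<bar>h\<bar> * growth k) ^ i / fact i)"
        by (simp add: power_mult_distrib)
    qed
    also have "\<dots> \<le> exp (real n - real (Suc k)) * R n * exp (exp 1 * \<bar>h\<bar> * growth k)"
      using R_pos[of n] growth_pos[of k] by (intro mult_left_mono exp_partial_sum_le) (auto intro: less_imp_le)
    also have "\<dots> \<le> exp (real n - real (Suc k)) * R n * exp 1"
      using R_pos[of n] h growth_pos[of k] by (intro mult_left_mono) (auto simp: field_simps)
    also have "\<dots> = exp (real n - real k) * R n"
      by (simp add: exp_diff exp_add field_simps)
    finally show ?thesis by blast
  qed
qed

text \<open>Going from level \<open>K\<close> down to level \<open>k\<close> uses one step for each level in between.\<close>

lemma near_polys_reach:
  assumes "k \<le> K" "\<bar>t\<bar> \<le> (\<Sum>j\<in>{k..<K}. 1 / (exp 1 * growth j))"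
  shows "near_polys k t"
  using assms
proof (induction k arbitrary: t rule: inc_induct)
  case base
  then show ?case by (simp add: near_polys_0)
next
  case (step k)
  define S where "S = (\<Sum>j\<in>{Suc k..<K}. 1 / (exp 1 * growth j))"
  have S0: "0 \<le> S" unfolding S_def using growth_pos by (intro sum_nonneg) (simp add: less_imp_le)
  have t: "\<bar>t\<bar> \<le> 1 / (exp 1 * growth k) + S"
    using step by (simp add: S_def sum.atLeast_Suc_lessThan)
  \<comment> \<open>the nearest point that is within reach at the next higher level\<close>
  define t' where "t' = max (-S) (min S t)"
  have "near_polys (Suc k) t'"
    using step.IH[of t'] S0 unfolding S_def[symmetric] t'_def by linarith
  moreover have "\<bar>t - t'\<bar> \<le> 1 / (exp 1 * growth k)"
    using t S0 growth_pos[of k] unfolding t'_def by (smt (verit) exp_gt_zero zero_less_divide_1_iff zero_less_mult_iff)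
  ultimately show ?case using near_polys_step[of k t' "t - t'"] by simp
qed

text \<open>The power \<open>n = 0\<close> of the bounds: its distance is at most \<open>e\<^sup>-\<^sup>k\<close> for every \<open>k\<close>.\<close>

lemma cos_in_closure:
  assumes div: "\<not> summable (\<lambda>j. 1 / growth j)"
  shows "(\<lambda>\<omega>. cos (t * X \<omega> + \<theta>)) \<in> l2_closure M (polys_of X)"
proof (rule l2_closure_I)
  show "square_integrable M (\<lambda>\<omega>. cos (t * X \<omega> + \<theta>))"
    by (rule square_integrable_bounded[where B = 1]) auto
  fix e :: real assume e: "0 < e"
  obtain k :: nat where k: "exp (- real k) < e"
  proof -
    obtain k :: nat where "- ln e < real k" using reals_Archimedean2 by blast
    then have "exp (- real k) < exp (ln e)" by (intro exp_less_mono) linarith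
    with e show thesis by (intro that[of k]) simp
  qed
  have "\<exists>K\<ge>k. \<bar>t\<bar> \<le> (\<Sum>j\<in>{k..<K}. 1 / (exp 1 * growth j))"
  proof (rule ccontr)
    assume neg: "\<not> ?thesis"
    have "summable (\<lambda>j. 1 / (exp 1 * growth (j + k)))"
    proof (rule summableI_nonneg_bounded[where x = "\<bar>t\<bar>"])
      show "0 \<le> 1 / (exp 1 * growth (n + k))" for n using growth_pos[of "n + k"] by simp
      have eq: "(\<Sum>j\<in>{k..<n + k}. 1 / (exp 1 * growth j)) = (\<Sum>j<n. 1 / (exp 1 * growth (j + k)))" for n
        using sum.shift_bounds_nat_ivl[of "\<lambda>j. 1 / (exp 1 * growth j)" 0 k n] by (simp add: atLeast0LessThan)
      show "(\<Sum>j<n. 1 / (exp 1 * growth (j + k))) \<le> \<bar>t\<bar>" for n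
        using neg eq[of n] by (metis le_add2 linear)
    qed
    then have "summable (\<lambda>j. 1 / (exp 1 * growth j))" using summable_iff_shift[of "\<lambda>j. 1 / (exp 1 * growth j)" k] by simp
    then have "summable (\<lambda>j. exp 1 * (1 / (exp 1 * growth j)))" by (rule summable_mult)
    with div show False by simp
  qed
  then obtain K where "k \<le> K" "\<bar>t\<bar> \<le> (\<Sum>j\<in>{k..<K}. 1 / (exp 1 * growth j))" by blast
  from near_polys_reach[OF this] obtain p where
    "l2norm M (\<lambda>\<omega>. X \<omega> ^ 0 * cos (t * X \<omega> + \<theta>) - poly p (X \<omega>)) \<le> exp (real 0 - real k) * R 0"
    unfolding near_polys_def by blast
  then have "l2norm M (\<lambda>\<omega>. cos (t * X \<omega> + \<theta>) - poly p (X \<omega>)) < e"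
    using k by (simp add: R_0)
  then show "\<exists>g. g \<in> polys_of X \<and> square_integrable M g \<and> l2norm M (\<lambda>x. cos (t * X x + \<theta>) - g x) < e"
    using square_integrable_poly by (auto simp: polys_of_def)
qed

definition root_moment :: "nat \<Rightarrow> real" where
  "root_moment n = moment M X (2 * n) powr (1 / real (2 * n))"

lemma root_moment_Suc: "root_moment (Suc n) = R (Suc n) powr (1 / real (Suc n))"
proof -
  have "moment M X (2 * Suc n) = R (Suc n) powr 2"
    using R_squared[of "Suc n"] R_pos[of "Suc n"] by (simp add: powr_numeral)
  moreover have "2 * (1 / real (2 * Suc n)) = 1 / real (Suc n)" by (simp add: field_simps)
  ultimately show ?thesis unfolding root_moment_def by (simp only: powr_powr)
qed

lemma root_moment_pos: "0 < root_moment (Suc n)"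
  using R_pos[of "Suc n"] by (simp add: root_moment_Suc)

text \<open>The growth factors increase, so the next one is at least the geometric mean of its
  predecessors.\<close>

lemma root_moment_mono:
  assumes "m \<le> n" shows "root_moment (Suc m) \<le> root_moment (Suc n)"
  using assms
proof (rule lift_Suc_mono_le[where f = "\<lambda>n. root_moment (Suc n)", rotated])
  fix n
  define u where "u = root_moment (Suc n)"
  have u: "0 < u" using root_moment_pos by (simp add: u_def)
  have Ru: "R (Suc n) = u ^ Suc n"
    using R_pos[of "Suc n"] unfolding u_def root_moment_Suc
    by (subst powr_realpow[symmetric]) (simp_all add: powr_powr del: of_nat_Suc)
  have "u ^ Suc n \<le> growth (Suc n) ^ Suc n"
    using R_le_growth_power[of 0 "Suc n" "Suc n"] by (simp add: R_0 Ru)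
  then have "u \<le> growth (Suc n)"
    using growth_pos[of "Suc n"] by (rule power_le_imp_le_base[OF _ less_imp_le])
  then have "u ^ Suc (Suc n) \<le> u ^ Suc n * growth (Suc n)"
    using u by (simp add: mult.commute mult_left_mono)
  also have "\<dots> = R (Suc (Suc n))"
    unfolding Ru[symmetric] using R_pos[of "Suc n"] by (simp add: growth_def)
  finally have "(u ^ Suc (Suc n)) powr (1 / real (Suc (Suc n))) \<le> root_moment (Suc (Suc n))"
    unfolding root_moment_Suc using u by (intro powr_mono2) simp_all
  moreover have "(u ^ Suc (Suc n)) powr (1 / real (Suc (Suc n))) = u"
    using u by (subst powr_realpow[symmetric]) (simp_all add: powr_powr del: of_nat_Suc power_Suc)
  ultimately show "root_moment (Suc n) \<le> root_moment (Suc (Suc n))" by (simp add: u_def)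
qed

text \<open>The \<open>n\<close>-th root moment is the geometric mean of the first \<open>n\<close> growth factors, so
  Carleman's inequality carries the divergence over to the growth factors.\<close>

lemma Carleman_growth:
  assumes div: "\<not> summable (\<lambda>n. 1 / root_moment (Suc n))"
  shows "\<not> summable (\<lambda>j. 1 / growth j)"
proof
  assume sm: "summable (\<lambda>j. 1 / growth j)"
  have prod: "(\<Prod>j<n. 1 / growth j) = 1 / R n" for n
    by (induction n) (use R_pos in \<open>auto simp: R_0 growth_def less_imp_neq[symmetric]\<close>)
  have c: "1 / root_moment (Suc n) = (\<Prod>j<Suc n. 1 / growth j) powr (1 / real (Suc n))" for n
    unfolding prod root_moment_Suc using R_pos[of "Suc n"] by (simp add: powr_divide less_imp_le)
  have "summable (\<lambda>n. 1 / root_moment (Suc n))"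
  proof (rule summableI_nonneg_bounded)
    show "0 \<le> 1 / root_moment (Suc n)" for n using root_moment_pos[of n] by simp
    fix K
    have "(\<Sum>n<K. 1 / root_moment (Suc n)) \<le> exp 1 * (\<Sum>j<K. 1 / growth j)"
      unfolding c by (rule Carleman_inequality) (simp add: growth_pos)
    also have "\<dots> \<le> exp 1 * (\<Sum>j. 1 / growth j)"
      using sm growth_pos by (intro mult_left_mono sum_le_suminf) (auto simp: less_imp_le)
    finally show "(\<Sum>n<K. 1 / root_moment (Suc n)) \<le> exp 1 * (\<Sum>j. 1 / growth j)" .
  qed
  with div show False by contradiction
qed

end

lemma (in prob_space) l2norm_bounded:
  assumes "f \<in> borel_measurable M" "\<And>x. x \<in> space M \<Longrightarrow> \<bar>f x\<bar> \<le> B"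
  shows "l2norm M f \<le> \<bar>B\<bar>"
proof -
  have "l2norm M f \<le> l2norm M (\<lambda>_. B)"
    using assms by (intro l2norm_mono) (force simp: square_integrable_def)+
  then show ?thesis by (simp add: l2norm_def prob_space)
qed

section \<open>Density of the polynomials of one variable\<close>

context nontrivial_moments
begin

text \<open>Products of trigonometric functions are sums of such functions, which allows powers of the
  sine.\<close>

lemma sin_power_cos_in_closure:
  assumes cos_cl: "\<And>t \<theta>. (\<lambda>\<omega>. cos (t * X \<omega> + \<theta>)) \<in> l2_closure M (polys_of X)"
  shows "(\<lambda>\<omega>. sin (t * X \<omega>) ^ k * cos (s * X \<omega> + \<theta>)) \<in> l2_closure M (polys_of X)"
proof (induction k arbitrary: s \<theta>)
  case 0
  then show ?case using cos_cl by simp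
next
  case (Suc k)
  have *: "sin a * cos b = 1 / 2 * (cos (b + a - pi / 2) - cos (b - a - pi / 2))" for a b :: real
    by (simp add: cos_diff sin_add sin_diff)
  have "sin (t * X \<omega>) ^ Suc k * cos (s * X \<omega> + \<theta>) =
      1 / 2 * (sin (t * X \<omega>) ^ k * cos ((s + t) * X \<omega> + (\<theta> - pi / 2)) -
        sin (t * X \<omega>) ^ k * cos ((s - t) * X \<omega> + (\<theta> - pi / 2)))" for \<omega>
  proof -
    have "(s + t) * X \<omega> + (\<theta> - pi / 2) = s * X \<omega> + \<theta> + t * X \<omega> - pi / 2"
      "(s - t) * X \<omega> + (\<theta> - pi / 2) = s * X \<omega> + \<theta> - t * X \<omega> - pi / 2"
      by (simp_all add: algebra_simps)
    moreover have "sin (t * X \<omega>) ^ Suc k * cos (s * X \<omega> + \<theta>) =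
        sin (t * X \<omega>) ^ k * (sin (t * X \<omega>) * cos (s * X \<omega> + \<theta>))" by simp
    ultimately show ?thesis unfolding * by (simp only: right_diff_distrib mult.left_commute)
  qed
  then show ?case
    by (simp only:) (intro l2_closure_scale l2_closure_diff linear_space_polys_of Suc)
qed

text \<open>The function \<open>n sin (x / n)\<close> converges to \<open>x\<close> and takes values in a compact interval,
  where Weierstrass' theorem replaces \<open>h\<close> by a polynomial.\<close>

lemma bounded_continuous_in_closure:
  fixes h :: "real \<Rightarrow> real"
  assumes cos_cl: "\<And>t \<theta>. (\<lambda>\<omega>. cos (t * X \<omega> + \<theta>)) \<in> l2_closure M (polys_of X)"
    and h: "continuous_on UNIV h" "\<And>x. \<bar>h x\<bar> \<le> B"
  shows "(\<lambda>\<omega>. h (X \<omega>)) \<in> l2_closure M (polys_of X)"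
proof -
  note L = linear_space_polys_of[of X]
  have hm [measurable]: "h \<in> borel_measurable borel"
    using h(1) by (rule borel_measurable_continuous_onI)
  have approx: "(\<lambda>\<omega>. h (c * sin (t * X \<omega>))) \<in> l2_closure M (polys_of X)" for c t
  proof (rule l2_closure_closed)
    show "square_integrable M (\<lambda>\<omega>. h (c * sin (t * X \<omega>)))"
      using h(2) by (intro square_integrable_bounded[where B = B]) auto
    fix e :: real assume e: "0 < e"
    have "continuous_on {-1..1} (\<lambda>u. h (c * u))"
      by (intro continuous_on_compose2[OF h(1)] continuous_intros) auto
    then obtain q where q: "polynomial_function q" "\<forall>u\<in>{-1..1}. norm (h (c * u) - q u) < e / 2"
      using Stone_Weierstrass_polynomial_function[of "{-1..1::real}" "\<lambda>u. h (c * u)" "e / 2"] e by auto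
    then obtain a n where qa: "q = (\<lambda>u. \<Sum>i\<le>(n::nat). a i * u ^ i)"
      unfolding real_polynomial_function_eq[symmetric] real_polynomial_function_iff_sum by blast
    have "(\<lambda>\<omega>. \<Sum>i\<le>n. a i * (sin (t * X \<omega>) ^ i * cos (0 * X \<omega> + 0))) \<in> l2_closure M (polys_of X)"
      by (intro l2_closure_sum l2_closure_scale L sin_power_cos_in_closure cos_cl)
    then have "(\<lambda>\<omega>. q (sin (t * X \<omega>))) \<in> l2_closure M (polys_of X)" by (simp add: qa)
    moreover have "l2norm M (\<lambda>\<omega>. h (c * sin (t * X \<omega>)) - q (sin (t * X \<omega>))) \<le> \<bar>e / 2\<bar>"
    proof (rule l2norm_bounded)
      show "(\<lambda>\<omega>. h (c * sin (t * X \<omega>)) - q (sin (t * X \<omega>))) \<in> borel_measurable M"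
        unfolding qa by measurable
      show "\<bar>h (c * sin (t * X \<omega>)) - q (sin (t * X \<omega>))\<bar> \<le> e / 2" for \<omega>
        using q(2)[rule_format, of "sin (t * X \<omega>)"] by simp
    qed
    ultimately show "\<exists>g. g \<in> l2_closure M (polys_of X) \<and> l2norm M (\<lambda>\<omega>. h (c * sin (t * X \<omega>)) - g \<omega>) < e"
      using e by (intro exI[of _ "\<lambda>\<omega>. q (sin (t * X \<omega>))"]) auto
  qed
  show ?thesis
  proof (rule l2_closure_dominated_limit[where w = "\<lambda>_. B" and
        \<phi> = "\<lambda>n \<omega>. h (real (Suc n) * sin (inverse (real (Suc n)) * X \<omega>))"])
    show "(\<lambda>n. h (real (Suc n) * sin (inverse (real (Suc n)) * X \<omega>))) \<longlonglongrightarrow> h (X \<omega>)" for \<omega>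
    proof (rule continuous_on_tendsto_compose[OF h(1)])
      have "DERIV (\<lambda>u. sin (u * X \<omega>)) 0 :> X \<omega>" by (auto intro!: derivative_eq_intros)
      then have "((\<lambda>u. sin (u * X \<omega>) / u) \<longlongrightarrow> X \<omega>) (at 0)" by (simp add: DERIV_def)
      moreover have "filterlim (\<lambda>n. inverse (real (Suc n))) (at 0) sequentially"
        using LIMSEQ_inverse_real_of_nat by (simp add: filterlim_at)
      ultimately have "(\<lambda>n. sin (inverse (real (Suc n)) * X \<omega>) / inverse (real (Suc n))) \<longlonglongrightarrow> X \<omega>"
        by (rule filterlim_compose)
      then show "(\<lambda>n. real (Suc n) * sin (inverse (real (Suc n)) * X \<omega>)) \<longlonglongrightarrow> X \<omega>"
        by (simp add: divide_inverse mult.commute)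
    qed auto
  qed (use h approx in \<open>auto simp: square_integrable_def\<close>)
qed

text \<open>Indicators of half-lines are bounded limits of continuous ramps, and half-lines generate
  the Borel sets.\<close>

theorem polynomials_dense:
  assumes carleman: "\<not> summable (\<lambda>n. 1 / root_moment (Suc n))"
    and g: "g \<in> borel_measurable borel" "square_integrable M (\<lambda>\<omega>. g (X \<omega>))"
  shows "(\<lambda>\<omega>. g (X \<omega>)) \<in> l2_closure M (polys_of X)"
proof (rule l2_closure_generator[OF linear_space_polys_of X_measurable, where G = "range (\<lambda>a. {..a})"])
  note cos_cl = cos_in_closure[OF Carleman_growth[OF carleman]]
  show "Int_stable (range (\<lambda>a::real. {..a}))" by (auto simp: Int_stable_def)
  show "sets borel = sigma_sets (space borel) (range (\<lambda>a::real. {..a}))"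
    by (subst borel_eq_atMost) auto
  show "(\<lambda>_. 1) \<in> l2_closure M (polys_of X)" using polys_of_I[of 1] by simp
  fix B :: "real set" assume "B \<in> range (\<lambda>a. {..a})"
  then obtain a where B: "B = {..a}" by auto
  show "(\<lambda>\<omega>. indicator B (X \<omega>)) \<in> l2_closure M (polys_of X)"
  proof (rule l2_closure_dominated_limit[where w = "\<lambda>_. 1" and
        \<phi> = "\<lambda>n \<omega>. max 0 (min 1 (1 - real n * (X \<omega> - a)))"])
    show "(\<lambda>\<omega>. max 0 (min 1 (1 - real n * (X \<omega> - a)))) \<in> l2_closure M (polys_of X)" for n
      by (rule bounded_continuous_in_closure[OF cos_cl, where B = 1 and h = "\<lambda>x. max 0 (min 1 (1 - real n * (x - a)))"])
        (auto intro!: continuous_intros)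
    show "(\<lambda>n. max 0 (min 1 (1 - real n * (X \<omega> - a)))) \<longlonglongrightarrow> indicator B (X \<omega>)" for \<omega>
    proof (cases "X \<omega> \<le> a")
      case True
      then have "max 0 (min 1 (1 - real n * (X \<omega> - a))) = 1" for n
        by (simp add: mult_nonneg_nonpos min_def)
      with True show ?thesis by (simp add: B)
    next
      case False
      obtain N where N: "1 / (X \<omega> - a) < real N" using reals_Archimedean2 by blast
      have "max 0 (min 1 (1 - real n * (X \<omega> - a))) = 0" if "N \<le> n" for n
      proof -
        have "1 = 1 / (X \<omega> - a) * (X \<omega> - a)" using False by simp
        also have "\<dots> \<le> real n * (X \<omega> - a)" using False N that by (intro mult_right_mono) auto
        finally show ?thesis by simp
      qed
      then have "eventually (\<lambda>n. max 0 (min 1 (1 - real n * (X \<omega> - a))) = 0) sequentially"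
        by (auto simp: eventually_sequentially)
      with False show ?thesis by (simp add: B tendsto_eventually)
    qed
  qed (auto simp: square_integrable_def)
qed (use g in auto)

section \<open>Sufficient conditions for Carleman's condition\<close>

lemma Carleman_of_infinite_sum:
  assumes "(\<Sum>l. ennreal (1 / moment M X (2 * Suc l) powr (1 / real (2 * Suc l)))) = \<infinity>"
  shows "\<not> summable (\<lambda>n. 1 / root_moment (Suc n))"
proof
  assume "summable (\<lambda>n. 1 / root_moment (Suc n))"
  then have "(\<Sum>n. ennreal (1 / root_moment (Suc n))) = ennreal (\<Sum>n. 1 / root_moment (Suc n))"
    using root_moment_pos by (intro suminf_ennreal2) (auto simp: less_imp_le)
  with assms show False unfolding root_moment_def by (metis infinity_ennreal_def ennreal_neq_top)
qed

text \<open>Since the root moments increase, one index \<open>l\<close> with a linear bound bounds all of its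
  predecessors, so that the block of terms up to \<open>l\<close> contributes a fixed amount.\<close>

lemma Carleman_of_frequently_linear:
  assumes C: "0 < C" and fr: "\<And>m. \<exists>l\<ge>m. root_moment l \<le> C * real l"
  shows "\<not> summable (\<lambda>n. 1 / root_moment (Suc n))"
proof
  assume "summable (\<lambda>n. 1 / root_moment (Suc n))"
  then obtain N where N: "\<And>m n. N \<le> m \<Longrightarrow> norm (\<Sum>n=m..<n. 1 / root_moment (Suc n)) < 1 / (2 * C)"
    using C unfolding summable_Cauchy by (metis zero_less_divide_iff zero_less_one zero_less_mult_iff zero_less_numeral)
  obtain l where l: "2 * N + 1 \<le> l" "root_moment l \<le> C * real l" using fr by blast
  have "1 / (2 * C) \<le> real (l - N) * (1 / (C * real l))"
  proof -
    have "real l \<le> 2 * real (l - N)" using l(1) by (simp add: of_nat_diff)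
    then show ?thesis using C l(1) by (simp add: field_simps)
  qed
  also have "\<dots> = (\<Sum>n=N..<l. 1 / (C * real l))" by simp
  also have "\<dots> \<le> (\<Sum>n=N..<l. 1 / root_moment (Suc n))"
  proof (rule sum_mono)
    fix n assume n: "n \<in> {N..<l}"
    have "root_moment (Suc n) \<le> root_moment (Suc (l - 1))" using n by (intro root_moment_mono) auto
    then have "root_moment (Suc n) \<le> C * real l" using l by simp
    then show "1 / (C * real l) \<le> 1 / root_moment (Suc n)"
      using root_moment_pos[of n] by (intro divide_left_mono) (auto intro: mult_pos_pos order.strict_trans2)
  qed
  also have "\<dots> < 1 / (2 * C)" using N[of N l] by simp
  finally show False by simp
qed

lemma Carleman_of_liminf:
  assumes "liminf (\<lambda>l. ereal (moment M X (2 * l) powr (1 / real (2 * l)) / real (2 * l))) < \<infinity>"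
  shows "\<not> summable (\<lambda>n. 1 / root_moment (Suc n))"
proof -
  let ?x = "\<lambda>l. ereal (root_moment l / real (2 * l))"
  have "liminf ?x \<noteq> \<infinity>" using assms unfolding root_moment_def by simp
  then obtain C :: nat where C: "liminf ?x < ereal (real C)"
    using less_PInf_Ex_of_nat[of "liminf ?x"] by (auto simp: less_top)
  have freq: "\<exists>l\<ge>m. root_moment l / real (2 * l) < real C" for m
  proof (rule ccontr)
    assume "\<not> ?thesis"
    then have "\<forall>l\<ge>m. ereal (real C) \<le> ?x l" by force
    then have "ereal (real C) \<le> liminf ?x"
      by (intro Liminf_bounded) (auto simp: eventually_sequentially)
    with C show False by simp
  qed
  show ?thesis
  proof (rule Carleman_of_frequently_linear[of "2 * real C + 1"])
    fix m
    obtain l where l: "Suc m \<le> l" "root_moment l / real (2 * l) < real C" using freq by blast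
    then have "root_moment l < 2 * real C * real l" by (simp add: field_simps)
    also have "\<dots> \<le> (2 * real C + 1) * real l" by (intro mult_right_mono) auto
    finally show "\<exists>l\<ge>m. root_moment l \<le> (2 * real C + 1) * real l" using l by (intro exI[of _ l]) auto
  qed simp
qed

text \<open>From \<open>x\<^sup>l \<le> l! a\<^sup>-\<^sup>l exp (a \<bar>x\<bar>)\<close> for even \<open>l\<close> the root moments grow at most linearly.\<close>

lemma Carleman_of_exponential_moment:
  assumes a: "0 < a" and int: "integrable M (\<lambda>\<omega>. exp (a * \<bar>X \<omega>\<bar>))"
  shows "\<not> summable (\<lambda>n. 1 / root_moment (Suc n))"
proof -
  define E where "E = (LINT \<omega>|M. exp (a * \<bar>X \<omega>\<bar>))"
  have E1: "1 \<le> E"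
  proof -
    have "(LINT \<omega>|M. 1) \<le> E" unfolding E_def using a by (intro integral_mono int) auto
    then show ?thesis by (simp add: prob_space)
  qed
  have bound: "root_moment (Suc n) \<le> 2 * E / a * real (Suc n)" for n
  proof -
    define l where "l = 2 * Suc n"
    have l: "0 < l" "even l" by (auto simp: l_def)
    have pt: "x ^ l \<le> real l ^ l / a ^ l * exp (a * \<bar>x\<bar>)" for x :: real
    proof -
      have "(a * \<bar>x\<bar>) ^ l / fact l \<le> (\<Sum>i\<le>l. (a * \<bar>x\<bar>) ^ i / fact i)"
        using a by (intro member_le_sum) auto
      also have "\<dots> \<le> exp (a * \<bar>x\<bar>)" using a by (intro exp_partial_sum_le) auto
      finally have "(a * \<bar>x\<bar>) ^ l \<le> exp (a * \<bar>x\<bar>) * fact l" by (simp add: field_simps)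
      also have "\<dots> \<le> exp (a * \<bar>x\<bar>) * real l ^ l"
        using fact_le_power[of l, where 'a = real] by (intro mult_left_mono) auto
      finally have "a ^ l * x ^ l \<le> exp (a * \<bar>x\<bar>) * real l ^ l"
        using l by (simp add: power_mult_distrib power_even_abs)
      then show ?thesis using a by (simp add: field_simps)
    qed
    have "moment M X l \<le> (LINT \<omega>|M. real l ^ l / a ^ l * exp (a * \<bar>X \<omega>\<bar>))"
      unfolding moment_def by (intro integral_mono moments_finite integrable_mult_right int pt)
    also have "\<dots> = real l ^ l / a ^ l * E" unfolding E_def by simp
    also have "\<dots> \<le> real l ^ l / a ^ l * E ^ l"
      using a E1 l by (intro mult_left_mono self_le_power) auto
    also have "\<dots> = (real l * E / a) ^ l" by (simp add: power_mult_distrib power_divide)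
    finally have "moment M X l powr (1 / real l) \<le> ((real l * E / a) ^ l) powr (1 / real l)"
      using even_moments_pos[of "Suc n"] by (intro powr_mono2) (auto simp: l_def)
    also have "\<dots> = real l * E / a"
      using a E1 l by (subst powr_realpow[symmetric]) (auto simp: powr_powr)
    finally show ?thesis unfolding root_moment_def l_def[symmetric] by (simp add: l_def field_simps)
  qed
  show ?thesis
  proof (rule Carleman_of_frequently_linear[of "2 * E / a"])
    show "0 < 2 * E / a" using a E1 by simp
    show "\<exists>l\<ge>m. root_moment l \<le> 2 * E / a * real l" for m
      using bound[of m] by (intro exI[of _ "Suc m"]) auto
  qed
qed

end

section \<open>The Krein--Lin condition implies Carleman's condition\<close>

lemma nn_integral_log_over_square:
  assumes c: "0 < c" and b: "0 \<le> b"
  shows "(\<integral>\<^sup>+x. ennreal ((b + 2 * ln (x / c)) / x\<^sup>2) * indicator {c..} x \<partial>lborel) = ennreal ((b + 2) / c)"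
proof -
  have "(\<integral>\<^sup>+x. ennreal ((b + 2 * ln (x / c)) / x\<^sup>2) * indicator {c..} x \<partial>lborel) =
      ennreal (0 - (- (b + 2 + 2 * ln (c / c)) / c))"
  \<comment> \<open>the antiderivative comes from integrating by parts\<close>
  proof (rule nn_integral_FTC_atLeast[where F = "\<lambda>x. - (b + 2 + 2 * ln (x / c)) / x"])
    fix x assume x: "c \<le> x"
    then show "0 \<le> (b + 2 * ln (x / c)) / x\<^sup>2" using b c by simp
    show "DERIV (\<lambda>x. - (b + 2 + 2 * ln (x / c)) / x) x :> (b + 2 * ln (x / c)) / x\<^sup>2"
      using x c by (auto intro!: derivative_eq_intros simp: field_simps power2_eq_square)
  next
    have "((\<lambda>x. - ((b + 2 - 2 * ln c) * inverse x + 2 * (ln x / x))) \<longlongrightarrow>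
        - ((b + 2 - 2 * ln c) * 0 + 2 * 0)) at_top"
      by (intro tendsto_intros tendsto_inverse_0_at_top filterlim_ident ln_x_over_x_tendsto_0)
    moreover have "eventually (\<lambda>x. - ((b + 2 - 2 * ln c) * inverse x + 2 * (ln x / x)) =
        - (b + 2 + 2 * ln (x / c)) / x) at_top"
      using eventually_gt_at_top[of 0]
      by eventually_elim (use c in \<open>simp add: ln_div field_simps\<close>)
    ultimately show "((\<lambda>x. - (b + 2 + 2 * ln (x / c)) / x) \<longlongrightarrow> 0) at_top"
      by (simp add: filterlim_cong)
  qed measurable
  moreover have "0 - (- (b + 2 + 2 * ln (c / c)) / c) = (b + 2) / c"
    using c by (simp add: field_simps)
  ultimately show ?thesis by simp
qed

lemma nn_integral_reflect:
  fixes h :: "real \<Rightarrow> ennreal"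
  assumes [measurable]: "h \<in> borel_measurable borel"
  shows "(\<integral>\<^sup>+x. h (- x) \<partial>lborel) = (\<integral>\<^sup>+x. h x \<partial>lborel)"
  using nn_integral_real_affine[OF assms, of "-1" 0] by simp

locale Lin_density =
  fixes f :: "real \<Rightarrow> real" and a :: real
  assumes even: "f (- x) = f x"
    and differentiable: "f differentiable (at x)"
    and positive: "0 < f x"
    and a_pos: "0 < a"
    and mono: "mono_on {a..} (\<lambda>x. - x * deriv f x / f x)"
    and unbounded: "filterlim (\<lambda>x. - x * deriv f x / f x) at_top at_top"
begin

text \<open>With \<open>\<phi> = - ln f\<close> this is \<open>x \<phi>'(x)\<close>, the slope of \<open>\<phi>\<close> in the variable \<open>ln x\<close>.\<close>

definition g :: "real \<Rightarrow> real" where "g x = - x * deriv f x / f x"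

definition \<phi> :: "real \<Rightarrow> real" where "\<phi> x = - ln (f x)"

text \<open>The point where \<open>g\<close> crosses the level \<open>2n + 2\<close>; on \<open>[a, \<infinity>)\<close> the
  function \<open>x\<^sup>2\<^sup>n\<^sup>+\<^sup>2 f(x)\<close> is largest there.\<close>

definition crossing :: "nat \<Rightarrow> real" where
  "crossing n = Inf {x. a \<le> x \<and> 2 * real n + 2 \<le> g x}"

lemma g_mono: "\<lbrakk>a \<le> x; x \<le> y\<rbrakk> \<Longrightarrow> g x \<le> g y"
  using mono by (auto simp: mono_on_def g_def)

lemma f_deriv: "DERIV f x :> deriv f x"
  using differentiable by (simp add: DERIV_deriv_iff_real_differentiable)

lemma deriv_f: "0 < x \<Longrightarrow> deriv f x = - g x * f x / x"
  using positive[of x] by (simp add: g_def)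

lemma \<phi>_deriv: "0 < x \<Longrightarrow> DERIV \<phi> x :> g x / x"
  unfolding \<phi>_def g_def using positive[of x]
  by (auto intro!: derivative_eq_intros f_deriv simp: field_simps)

lemma f_continuous: "continuous_on A f"
  using f_deriv by (intro continuous_at_imp_continuous_on ballI DERIV_isCont)

lemma \<phi>_continuous: "continuous_on A \<phi>"
  unfolding \<phi>_def using positive by (intro continuous_intros f_continuous) (metis less_irrefl)

lemma \<phi>_measurable [measurable]: "\<phi> \<in> borel_measurable borel"
  by (intro borel_measurable_continuous_onI \<phi>_continuous)

lemma f_measurable [measurable]: "f \<in> borel_measurable borel"
  by (intro borel_measurable_continuous_onI f_continuous)

lemma level_nonempty: "{x. a \<le> x \<and> 2 * real n + 2 \<le> g x} \<noteq> {}"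
proof -
  have "eventually (\<lambda>x. 2 * real n + 2 \<le> g x) at_top"
    using unbounded unfolding g_def filterlim_at_top by blast
  then have "eventually (\<lambda>x. a \<le> x \<and> 2 * real n + 2 \<le> g x) at_top"
    using eventually_ge_at_top[of a] by eventually_elim auto
  then show ?thesis by (auto simp: eventually_at_top_linorder)
qed

lemma level_bdd_below: "bdd_below {x. a \<le> x \<and> 2 * real n + 2 \<le> g x}"
  by (rule bdd_belowI[of _ a]) auto

lemma crossing_ge: "a \<le> crossing n"
  unfolding crossing_def by (rule cInf_greatest[OF level_nonempty]) auto

lemma crossing_pos: "0 < crossing n"
  using crossing_ge[of n] a_pos by linarith

lemma crossing_mono: "m \<le> n \<Longrightarrow> crossing m \<le> crossing n"
  unfolding crossing_def by (rule cInf_superset_mono[OF level_nonempty level_bdd_below]) auto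

lemma g_above_crossing:
  assumes "crossing n < x" shows "2 * real n + 2 \<le> g x"
proof -
  obtain y where "y < x" "a \<le> y" "2 * real n + 2 \<le> g y"
    using assms unfolding crossing_def cInf_less_iff[OF level_nonempty level_bdd_below] by auto
  with g_mono[of y x] show ?thesis by simp
qed

lemma g_below_crossing:
  assumes "a \<le> x" "x < crossing n" shows "g x < 2 * real n + 2"
proof (rule ccontr)
  assume "\<not> ?thesis"
  with assms(1) have "crossing n \<le> x"
    unfolding crossing_def by (intro cInf_lower level_bdd_below) auto
  with assms(2) show False by simp
qed

lemma \<phi>_increment:
  assumes "a \<le> p" "p \<le> q" "\<And>x. \<lbrakk>p < x; x < q\<rbrakk> \<Longrightarrow> g x \<le> c"
  shows "\<phi> q \<le> \<phi> p + c * (ln q - ln p)"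
proof -
  have "\<phi> q - c * ln q \<le> \<phi> p - c * ln p"
  proof (rule DERIV_nonpos_imp_decreasing_open[OF assms(2)])
    fix x assume x: "p < x" "x < q"
    then have x0: "0 < x" using assms(1) a_pos by linarith
    have "DERIV (\<lambda>x. \<phi> x - c * ln x) x :> g x / x - c * (1 / x)"
      using x0 by (auto intro!: derivative_eq_intros \<phi>_deriv)
    moreover have "g x / x - c * (1 / x) \<le> 0"
      using assms(3)[OF x] x0 by (simp add: divide_simps)
    ultimately show "\<exists>y. DERIV (\<lambda>x. \<phi> x - c * ln x) x :> y \<and> y \<le> 0" by blast
    next
    show "continuous_on {p..q} (\<lambda>x. \<phi> x - c * ln x)"
      using assms(1) a_pos by (intro continuous_intros \<phi>_continuous) auto
  qed
  then show ?thesis by (simp add: algebra_simps)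
qed

text \<open>The slope of \<open>\<phi>\<close> in the variable \<open>ln x\<close> is at most \<open>2\<close> plus twice the number of
  crossings passed; this is integrated interval by interval.\<close>

lemma \<phi>_bound_upto_crossing:
  assumes "a \<le> x" "x \<le> crossing n"
  shows "\<phi> x \<le> \<phi> a + 2 * ln (x / a) + (\<Sum>k<n. 2 * max 0 (ln (x / crossing k)))"
  using assms
proof (induction n arbitrary: x)
  case 0
  have "\<phi> x \<le> \<phi> a + 2 * (ln x - ln a)"
  proof (rule \<phi>_increment)
    show "g z \<le> 2" if "a < z" "z < x" for z
      using g_below_crossing[of z 0] that 0 by simp
  qed (use 0 in auto)
  then show ?case using 0 a_pos by (simp add: ln_div)
next
  case (Suc n)
  show ?case
  proof (cases "x \<le> crossing n")
    case True
    have "0 \<le> 2 * max 0 (ln (x / crossing n))" by simp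
    with Suc.IH[OF Suc.prems(1) True] show ?thesis by simp
  next
    case False
    define c where "c = crossing n"
    have x: "c < x" "0 < c" "a \<le> c" using False crossing_pos crossing_ge by (auto simp: c_def)
    have "\<phi> x \<le> \<phi> c + (2 * real (Suc n) + 2) * (ln x - ln c)"
    proof (rule \<phi>_increment)
      show "g z \<le> 2 * real (Suc n) + 2" if "c < z" "z < x" for z
        using g_below_crossing[of z "Suc n"] that x Suc.prems by force
    qed (use x in auto)
    also have "\<phi> c \<le> \<phi> a + 2 * ln (c / a) + (\<Sum>k<n. 2 * max 0 (ln (c / crossing k)))"
      using Suc.IH[of c] x by (simp add: c_def)
    also have "(\<Sum>k<n. 2 * max 0 (ln (c / crossing k))) =
        (\<Sum>k<n. 2 * max 0 (ln (x / crossing k)) - 2 * (ln x - ln c))"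
    proof (intro sum.cong refl)
      fix k assume "k \<in> {..<n}"
      then have k: "crossing k \<le> c" "0 < crossing k"
        using crossing_mono[of k n] crossing_pos by (auto simp: c_def)
      then have "0 \<le> ln (c / crossing k)" "0 \<le> ln (x / crossing k)" using x by auto
      with k x show "2 * max 0 (ln (c / crossing k)) = 2 * max 0 (ln (x / crossing k)) - 2 * (ln x - ln c)"
        by (simp add: ln_div)
    qed
    finally have "\<phi> x \<le> \<phi> a + 2 * ln (c / a) + (\<Sum>k<n. 2 * max 0 (ln (x / crossing k))) + 4 * (ln x - ln c)"
      by (simp only: sum_subtractf) (simp add: algebra_simps)
    also have "4 * (ln x - ln c) = 2 * (ln x - ln c) + 2 * max 0 (ln (x / c))"
      using x by (simp add: ln_div)
    finally show ?thesis using x a_pos by (simp add: c_def[symmetric] ln_div)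
  qed
qed

text \<open>The bound in a form that no longer mentions \<open>n\<close>: crossings beyond \<open>x\<close> contribute nothing to
  the series.\<close>

lemma \<phi>_bound:
  assumes "a \<le> x"
  shows "ennreal (\<phi> x / (1 + x\<^sup>2)) \<le> ennreal ((\<bar>\<phi> a\<bar> + 2 * ln (x / a)) / x\<^sup>2) * indicator {a..} x +
    (\<Sum>k. ennreal ((0 + 2 * ln (x / crossing k)) / x\<^sup>2) * indicator {crossing k..} x)"
proof -
  have x: "0 < x" using assms a_pos by linarith
  obtain n :: nat where n: "g x < real n" using reals_Archimedean2 by blast
  have "x \<le> crossing n" using g_above_crossing[of n x] n by force
  from \<phi>_bound_upto_crossing[OF assms this]
  have "\<phi> x \<le> (\<bar>\<phi> a\<bar> + 2 * ln (x / a)) + (\<Sum>k<n. 2 * max 0 (ln (x / crossing k)))" (is "_ \<le> ?u + ?v") by simp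
  moreover have u: "0 \<le> ?u" using assms a_pos by (intro add_nonneg_nonneg) auto
  moreover have v: "0 \<le> ?v" by (intro sum_nonneg) auto
  ultimately have "\<phi> x / (1 + x\<^sup>2) \<le> (?u + ?v) / x\<^sup>2"
    using x by (intro frac_le) auto
  then have "ennreal (\<phi> x / (1 + x\<^sup>2)) \<le> ennreal (?u / x\<^sup>2) + ennreal (?v / x\<^sup>2)"
    using u v by (subst ennreal_plus[symmetric])
      (simp_all only: divide_nonneg_nonneg zero_le_power2 add_divide_distrib[symmetric] ennreal_leI)
  also have "ennreal (?v / x\<^sup>2) = (\<Sum>k<n. ennreal ((0 + 2 * ln (x / crossing k)) / x\<^sup>2) * indicator {crossing k..} x)"
  proof -
    have "ennreal (2 * max 0 (ln (x / crossing k)) / x\<^sup>2) =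
        ennreal ((0 + 2 * ln (x / crossing k)) / x\<^sup>2) * indicator {crossing k..} x" for k
      using x crossing_pos[of k] by (auto simp: indicator_def max_def ln_ge_zero_iff)
    then show ?thesis by (simp add: sum_divide_distrib flip: sum_ennreal)
  qed
  also have "\<dots> \<le> (\<Sum>k. ennreal ((0 + 2 * ln (x / crossing k)) / x\<^sup>2) * indicator {crossing k..} x)"
    by (rule sum_le_suminf) auto
  finally show ?thesis using assms by (simp add: add_left_mono)
qed

text \<open>On \<open>[a, \<infinity>)\<close> the bound is integrated term by term, each crossing contributing
  \<open>2 / x\<^sub>k\<close>; symmetry takes care of the negative half-line and continuity of the middle.\<close>

lemma crossing_sum_diverges:
  assumes "(\<integral>\<^sup>+x. ennreal (\<phi> x / (1 + x\<^sup>2)) \<partial>lborel) = \<infinity>"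
  shows "\<not> summable (\<lambda>n. 1 / crossing n)"
proof
  assume sm: "summable (\<lambda>n. 1 / crossing n)"
  define h where "h x = ennreal (\<phi> x / (1 + x\<^sup>2))" for x
  have h_even: "h (- x) = h x" for x by (simp add: h_def \<phi>_def even)
  have [measurable]: "h \<in> borel_measurable borel" unfolding h_def by measurable
  have tail: "(\<integral>\<^sup>+x. h x * indicator {a..} x \<partial>lborel) < \<infinity>"
  proof -
    have "(\<integral>\<^sup>+x. h x * indicator {a..} x \<partial>lborel) \<le>
      (\<integral>\<^sup>+x. ennreal ((\<bar>\<phi> a\<bar> + 2 * ln (x / a)) / x\<^sup>2) * indicator {a..} x +
        (\<Sum>k. ennreal ((0 + 2 * ln (x / crossing k)) / x\<^sup>2) * indicator {crossing k..} x) \<partial>lborel)"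
      using \<phi>_bound by (intro nn_integral_mono) (auto simp: h_def split: split_indicator)
    also have "\<dots> = (\<integral>\<^sup>+x. ennreal ((\<bar>\<phi> a\<bar> + 2 * ln (x / a)) / x\<^sup>2) * indicator {a..} x \<partial>lborel) +
        (\<Sum>k. \<integral>\<^sup>+x. ennreal ((0 + 2 * ln (x / crossing k)) / x\<^sup>2) * indicator {crossing k..} x \<partial>lborel)"
      by (subst nn_integral_add) (auto simp: nn_integral_suminf)
    also have "\<dots> = ennreal ((\<bar>\<phi> a\<bar> + 2) / a) + (\<Sum>k. ennreal ((0 + 2) / crossing k))"
      by (simp only: nn_integral_log_over_square[OF a_pos abs_ge_zero]
            nn_integral_log_over_square[OF crossing_pos order_refl])
    also have "(\<Sum>k. ennreal ((0 + 2) / crossing k)) = ennreal (\<Sum>k. 2 * (1 / crossing k))"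
    proof -
      have "(0 + 2) / crossing k = 2 * (1 / crossing k)" for k by simp
      then show ?thesis
        using crossing_pos by (simp only:) (intro suminf_ennreal2 summable_mult sm; simp add: less_imp_le)
    qed
    finally have "(\<integral>\<^sup>+x. h x * indicator {a..} x \<partial>lborel) \<le>
        ennreal ((\<bar>\<phi> a\<bar> + 2) / a) + ennreal (\<Sum>k. 2 * (1 / crossing k))" .
    also have "\<dots> < \<infinity>" by (simp add: ennreal_add_eq_top less_top[symmetric])
    finally show ?thesis .
  qed
  have left: "(\<integral>\<^sup>+x. h x * indicator {..-a} x \<partial>lborel) = (\<integral>\<^sup>+x. h x * indicator {a..} x \<partial>lborel)"
  proof -
    have "(\<integral>\<^sup>+x. h (- x) * indicator {..-a} (- x) \<partial>lborel) = (\<integral>\<^sup>+x. h x * indicator {..-a} x \<partial>lborel)"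
      by (rule nn_integral_reflect) measurable
    moreover have "indicator {..-a} (- x) = (indicator {a..} x :: ennreal)" for x
      by (auto simp: indicator_def)
    ultimately show ?thesis by (simp add: h_even)
  qed
  have mid: "(\<integral>\<^sup>+x. h x * indicator {-a..a} x \<partial>lborel) < \<infinity>"
  proof -
    obtain B where B: "\<And>x. x \<in> {-a..a} \<Longrightarrow> \<bar>\<phi> x\<bar> \<le> B"
      using compact_imp_bounded[OF compact_continuous_image[OF \<phi>_continuous compact_Icc], of "-a" a]
      unfolding bounded_iff real_norm_def by blast
    have "(\<integral>\<^sup>+x. h x * indicator {-a..a} x \<partial>lborel) \<le> (\<integral>\<^sup>+x. ennreal B * indicator {-a..a} x \<partial>lborel)"
    proof (intro nn_integral_mono)
      fix x
      show "h x * indicator {-a..a} x \<le> ennreal B * indicator {-a..a} x"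
      proof (cases "x \<in> {-a..a}")
        case True
        have "\<phi> x / (1 + x\<^sup>2) \<le> \<bar>\<phi> x\<bar> / 1" by (intro frac_le) auto
        with B[OF True] True show ?thesis by (simp add: h_def ennreal_leI)
      qed simp
    qed
    also have "\<dots> < \<infinity>" using a_pos by (simp add: nn_integral_cmult_indicator ennreal_mult_less_top emeasure_lborel_Icc_eq)
    finally show ?thesis .
  qed
  have "(\<integral>\<^sup>+x. h x \<partial>lborel) \<le> (\<integral>\<^sup>+x. h x * indicator {..-a} x + (h x * indicator {-a..a} x + h x * indicator {a..} x) \<partial>lborel)"
    by (intro nn_integral_mono) (auto simp: indicator_def)
  also have "\<dots> = (\<integral>\<^sup>+x. h x * indicator {..-a} x \<partial>lborel) +
      ((\<integral>\<^sup>+x. h x * indicator {-a..a} x \<partial>lborel) + (\<integral>\<^sup>+x. h x * indicator {a..} x \<partial>lborel))"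
    by (simp add: nn_integral_add)
  also have "\<dots> < \<infinity>" using tail left mid by simp
  finally show False using assms by (simp add: h_def)
qed

text \<open>The logarithmic derivative of \<open>x\<^sup>p f(x)\<close> is \<open>(p - g(x)) / x\<close>.\<close>

lemma power_times_f_decreasing:
  assumes "crossing n \<le> x" "1 \<le> p" "real p \<le> 2 * real n + 2"
  shows "x ^ p * f x \<le> crossing n ^ p * f (crossing n)"
proof (rule DERIV_nonpos_imp_decreasing_open[OF assms(1)])
  fix z assume z: "crossing n < z" "z < x"
  then have z0: "0 < z" using crossing_pos[of n] by linarith
  obtain q where p: "p = Suc q" using assms(2) by (cases p) auto
  have "DERIV (\<lambda>x. x ^ p * f x) z :> real p * z ^ q * f z + z ^ p * deriv f z"
    using DERIV_mult[OF DERIV_pow[of p z] f_deriv[of z]] by (simp add: p mult_ac add.commute)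
  moreover have "real p * z ^ q * f z + z ^ p * deriv f z = z ^ q * f z * (real p - g z)"
    unfolding deriv_f[OF z0] p using z0 by (simp add: field_simps)
  moreover have "\<dots> \<le> 0"
    using z0 positive[of z] assms(3) g_above_crossing[OF z(1)] by (intro mult_nonneg_nonpos) auto
  ultimately show "\<exists>y. DERIV (\<lambda>x. x ^ p * f x) z :> y \<and> y \<le> 0" by metis
next
  show "continuous_on {crossing n..x} (\<lambda>x. x ^ p * f x)"
    by (intro continuous_intros f_continuous)
qed

lemma nn_integral_inverse_square:
  assumes c: "0 < c"
  shows "(\<integral>\<^sup>+x. ennreal (1 / x\<^sup>2) * indicator {x. c \<le> \<bar>x\<bar>} x \<partial>lborel) = ennreal (2 / c)"
proof -
  define h where "h x = ennreal (1 / x\<^sup>2) * indicator {c..} x" for x :: real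
  have [measurable]: "h \<in> borel_measurable borel" unfolding h_def by measurable
  have "(\<integral>\<^sup>+x. h x \<partial>lborel) = ennreal (0 - (- 1 / c))"
    unfolding h_def
  proof (rule nn_integral_FTC_atLeast[where F = "\<lambda>x. - 1 / x"])
    show "DERIV (\<lambda>x. - 1 / x) x :> 1 / x\<^sup>2" if "c \<le> x" for x
      using that c by (auto intro!: derivative_eq_intros simp: power2_eq_square)
    have eq: "(\<lambda>x::real. - 1 / x) = (\<lambda>x. - inverse x)" by (simp add: fun_eq_iff divide_inverse)
    show "((\<lambda>x::real. - 1 / x) \<longlongrightarrow> 0) at_top"
      unfolding eq using tendsto_minus[OF tendsto_inverse_0_at_top[OF filterlim_ident]] by simp
  qed auto
  then have h: "(\<integral>\<^sup>+x. h x \<partial>lborel) = ennreal (1 / c)" by simp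
  have "ennreal (1 / x\<^sup>2) * indicator {x. c \<le> \<bar>x\<bar>} x = h x + h (- x)" for x
    using c by (auto simp: h_def indicator_def)
  then have "(\<integral>\<^sup>+x. ennreal (1 / x\<^sup>2) * indicator {x. c \<le> \<bar>x\<bar>} x \<partial>lborel) =
      (\<integral>\<^sup>+x. h x \<partial>lborel) + (\<integral>\<^sup>+x. h (- x) \<partial>lborel)"
    by (simp add: nn_integral_add)
  also have "\<dots> = ennreal (2 / c)"
    using c by (simp add: nn_integral_reflect h flip: ennreal_plus)
  finally show ?thesis .
qed

text \<open>Below the crossing \<open>x\<^sup>2\<^sup>n\<close> is at most its value there; beyond it \<open>x\<^sup>2\<^sup>n\<^sup>+\<^sup>2 f(x)\<close>
  decreases, which leaves the integrable factor \<open>x\<^sup>-\<^sup>2\<close>.\<close>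

lemma even_moment_bound:
  assumes one: "(\<integral>\<^sup>+x. ennreal (f x) \<partial>lborel) = 1"
  shows "(\<integral>\<^sup>+x. ennreal (x ^ (2 * n) * f x) \<partial>lborel) \<le>
    ennreal (crossing n ^ (2 * n) * (1 + 2 * (crossing 0 * f (crossing 0))))"
proof -
  define c where "c = crossing n"
  have c: "0 < c" using crossing_pos by (simp add: c_def)
  have tail: "x ^ (2 * n) * f x \<le> c ^ (2 * n + 2) * f c * (1 / x\<^sup>2)" if "c \<le> \<bar>x\<bar>" for x
  proof -
    have "\<bar>x\<bar> ^ (2 * n + 2) * f \<bar>x\<bar> \<le> c ^ (2 * n + 2) * f c"
      using that unfolding c_def by (intro power_times_f_decreasing) auto
    moreover have "f \<bar>x\<bar> = f x" by (cases "0 \<le> x") (auto simp: even)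
    moreover have "\<bar>x\<bar> ^ (2 * n + 2) = x ^ (2 * n) * x\<^sup>2"
      by (simp only: power_add power_even_abs even_mult_iff even_numeral simp_thms)
    moreover have "x \<noteq> 0" using that c by auto
    ultimately have "x ^ (2 * n) * x\<^sup>2 * f x \<le> c ^ (2 * n + 2) * f c" "0 < x\<^sup>2" by simp_all
    then show ?thesis by (simp add: pos_le_divide_eq mult_ac)
  qed
  have "(\<integral>\<^sup>+x. ennreal (x ^ (2 * n) * f x) \<partial>lborel) \<le>
      (\<integral>\<^sup>+x. ennreal (c ^ (2 * n)) * ennreal (f x) +
        ennreal (c ^ (2 * n + 2) * f c) * (ennreal (1 / x\<^sup>2) * indicator {x. c \<le> \<bar>x\<bar>} x) \<partial>lborel)"
  proof (intro nn_integral_mono)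
    fix x
    show "ennreal (x ^ (2 * n) * f x) \<le> ennreal (c ^ (2 * n)) * ennreal (f x) +
        ennreal (c ^ (2 * n + 2) * f c) * (ennreal (1 / x\<^sup>2) * indicator {x. c \<le> \<bar>x\<bar>} x)"
    proof (cases "c \<le> \<bar>x\<bar>")
      case True
      have "ennreal (x ^ (2 * n) * f x) \<le> ennreal (c ^ (2 * n + 2) * f c * (1 / x\<^sup>2))"
        by (intro ennreal_leI tail True)
      also have "\<dots> = ennreal (c ^ (2 * n + 2) * f c) * ennreal (1 / x\<^sup>2)"
        using c positive[of c] by (intro ennreal_mult) (auto simp: less_imp_le)
      finally show ?thesis using True by (simp add: add_increasing)
    next
      case False
      then have "\<bar>x\<bar> ^ (2 * n) \<le> c ^ (2 * n)" by (intro power_mono) auto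
      then have "x ^ (2 * n) * f x \<le> c ^ (2 * n) * f x"
        using positive[of x] by (simp add: power_even_abs)
      then show ?thesis
        using c positive[of x] False by (simp add: ennreal_leI less_imp_le flip: ennreal_mult)
    qed
  qed
  also have "\<dots> = ennreal (c ^ (2 * n)) + ennreal (c ^ (2 * n + 2) * f c) * ennreal (2 / c)"
    by (subst nn_integral_add) (auto simp: nn_integral_cmult one nn_integral_inverse_square[OF c])
  also have "\<dots> = ennreal (c ^ (2 * n) * (1 + 2 * (c * f c)))"
    using c positive[of c] by (simp add: less_imp_le field_simps flip: ennreal_mult ennreal_plus)
  also have "\<dots> \<le> ennreal (crossing n ^ (2 * n) * (1 + 2 * (crossing 0 * f (crossing 0))))"
    using power_times_f_decreasing[of 0 c 1] crossing_mono[of 0 n] c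
    unfolding c_def by (intro ennreal_leI mult_left_mono) auto
  finally show ?thesis .
qed

end

text \<open>The factor \<open>x\<^sub>n f(x\<^sub>n)\<close> in the moment bound stays below its value at \<open>x\<^sub>0\<close>, so the \<open>n\<close>-th root
  moment is at most a constant multiple of the \<open>n\<close>-th crossing.\<close>

lemma (in nontrivial_moments) Carleman_of_krein_lin:
  assumes d: "distributed M lborel X (\<lambda>x. ennreal (f x))" and kl: "krein_lin UNIV f"
  shows "\<not> summable (\<lambda>n. 1 / root_moment (Suc n))"
proof
  assume sm: "summable (\<lambda>n. 1 / root_moment (Suc n))"
  from kl obtain a where "0 < a" "mono_on {a..} (\<lambda>x. - x * deriv f x / f x)"
    "filterlim (\<lambda>x. - x * deriv f x / f x) at_top at_top"
    and int: "set_integral_is_top UNIV (\<lambda>x. - ln (f x) / (1 + x\<^sup>2))"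
    by (auto simp: krein_lin_def)
  then interpret Lin_density f a using kl by unfold_locales (auto simp: krein_lin_def)
  define K where "K = 1 + 2 * (crossing 0 * f (crossing 0))"
  have K: "1 \<le> K" using crossing_pos[of 0] positive[of "crossing 0"] by (simp add: K_def)
  have one: "(\<integral>\<^sup>+x. ennreal (f x) \<partial>lborel) = 1"
    using distributed_nn_integral[OF d, of "\<lambda>_. 1"] emeasure_space_1 by simp
  have bound: "root_moment (Suc n) \<le> K * crossing (Suc n)" for n
  proof -
    let ?m = "2 * Suc n"
    have nonneg: "0 \<le> x ^ ?m" for x :: real by (simp only: power_mult zero_le_power zero_le_power2)
    have "ennreal (moment M X ?m) = (\<integral>\<^sup>+\<omega>. ennreal (X \<omega> ^ ?m) \<partial>M)"
      unfolding moment_def using nonneg by (intro nn_integral_eq_integral[symmetric] moments_finite) auto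
    also have "\<dots> = (\<integral>\<^sup>+x. ennreal (f x) * ennreal (x ^ ?m) \<partial>lborel)"
      by (rule distributed_nn_integral[OF d, symmetric]) measurable
    also have "\<dots> = (\<integral>\<^sup>+x. ennreal (x ^ ?m * f x) \<partial>lborel)"
      using positive nonneg by (intro nn_integral_cong) (simp add: ennreal_mult[symmetric] less_imp_le mult.commute del: power_Suc mult_Suc_right)
    also have "\<dots> \<le> ennreal (crossing (Suc n) ^ ?m * K)"
      unfolding K_def by (rule even_moment_bound[OF one])
    finally have "moment M X ?m \<le> crossing (Suc n) ^ ?m * K"
      using K crossing_pos[of "Suc n"] by (subst (asm) ennreal_le_iff) (auto simp del: power_Suc mult_Suc_right)
    also have "\<dots> \<le> crossing (Suc n) ^ ?m * K ^ ?m"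
      using K crossing_pos[of "Suc n"] by (intro mult_left_mono self_le_power) (auto simp del: power_Suc mult_Suc_right)
    also have "\<dots> = (K * crossing (Suc n)) ^ ?m" by (simp only: power_mult_distrib mult.commute)
    finally have "root_moment (Suc n) \<le> ((K * crossing (Suc n)) ^ ?m) powr (1 / real ?m)"
      unfolding root_moment_def using even_moments_pos[of "Suc n"] by (intro powr_mono2) auto
    also have "\<dots> = K * crossing (Suc n)"
      using K crossing_pos[of "Suc n"]
      by (subst powr_realpow[symmetric]) (simp_all add: powr_powr del: of_nat_Suc mult_Suc_right)
    finally show ?thesis .
  qed
  have "summable (\<lambda>n. 1 / crossing (Suc n))"
  proof (rule summable_comparison_test)
    show "summable (\<lambda>n. K * (1 / root_moment (Suc n)))" by (rule summable_mult[OF sm])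
    show "\<exists>N. \<forall>n\<ge>N. norm (1 / crossing (Suc n)) \<le> K * (1 / root_moment (Suc n))"
    proof (intro exI[of _ 0] allI impI)
      fix n
      have "1 / crossing (Suc n) \<le> K * (1 / root_moment (Suc n))"
        using bound[of n] crossing_pos[of "Suc n"] root_moment_pos[of n] by (simp add: field_simps)
      then show "norm (1 / crossing (Suc n)) \<le> K * (1 / root_moment (Suc n))"
        using crossing_pos[of "Suc n"] by simp
    qed
  qed
  then have "summable (\<lambda>n. 1 / crossing n)" using summable_Suc_iff[of "\<lambda>n. 1 / crossing n"] by simp
  moreover have "(\<integral>\<^sup>+x. ennreal (\<phi> x / (1 + x\<^sup>2)) \<partial>lborel) = \<infinity>"
    using int by (simp add: set_integral_is_top_def \<phi>_def)
  ultimately show False using crossing_sum_diverges by blast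
qed

section \<open>Products of functions of independent variables\<close>

lemma (in prob_space) indep_var_square_integrable_mult:
  assumes ind: "indep_var borel U borel V" and sq: "square_integrable M U" "square_integrable M V"
  shows "square_integrable M (\<lambda>\<omega>. U \<omega> * V \<omega>)"
    and "l2norm M (\<lambda>\<omega>. U \<omega> * V \<omega>) = l2norm M U * l2norm M V"
proof -
  have "indep_var borel ((\<lambda>z. z\<^sup>2) \<circ> U) borel ((\<lambda>z. z\<^sup>2) \<circ> V)"
    by (rule indep_var_compose[OF ind]) measurable
  then have ind2: "indep_var borel (\<lambda>\<omega>. (U \<omega>)\<^sup>2) borel (\<lambda>\<omega>. (V \<omega>)\<^sup>2)" by (simp add: comp_def)
  have int: "integrable M (\<lambda>\<omega>. (U \<omega>)\<^sup>2)" "integrable M (\<lambda>\<omega>. (V \<omega>)\<^sup>2)"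
    using sq by (auto simp: square_integrable_def)
  have "integrable M (\<lambda>\<omega>. (U \<omega>)\<^sup>2 * (V \<omega>)\<^sup>2)" by (rule indep_var_integrable[OF ind2 int])
  then show "square_integrable M (\<lambda>\<omega>. U \<omega> * V \<omega>)"
    using sq by (auto simp: square_integrable_def power_mult_distrib)
  show "l2norm M (\<lambda>\<omega>. U \<omega> * V \<omega>) = l2norm M U * l2norm M V"
    unfolding l2norm_def power_mult_distrib indep_var_lebesgue_integral[OF ind2 int] real_sqrt_mult ..
qed

lemma (in prob_space) indep_var_coordinate_tuple:
  fixes X :: "'i \<Rightarrow> 'a \<Rightarrow> real"
  assumes ind: "indep_vars (\<lambda>_. borel) X I" and J: "insert k J \<subseteq> I" "k \<notin> J"
    and \<psi>: "\<psi> \<in> borel_measurable borel" and F: "F \<in> borel_measurable (\<Pi>\<^sub>M i\<in>J. borel)"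
  shows "indep_var borel (\<lambda>\<omega>. \<psi> (X k \<omega>)) borel (\<lambda>\<omega>. F (\<lambda>i\<in>J. X i \<omega>))"
proof -
  have "indep_var borel ((\<lambda>x. \<psi> (x k)) \<circ> (\<lambda>\<omega>. \<lambda>i\<in>{k}. X i \<omega>)) borel (F \<circ> (\<lambda>\<omega>. \<lambda>i\<in>J. X i \<omega>))"
  proof (rule indep_var_compose[OF indep_var_restrict[OF ind]])
    have "(\<lambda>x. x k) \<in> (\<Pi>\<^sub>M i\<in>{k}. borel) \<rightarrow>\<^sub>M (borel :: real measure)" by measurable
    then show "(\<lambda>x. \<psi> (x k)) \<in> borel_measurable (\<Pi>\<^sub>M i\<in>{k}. borel)"
      using \<psi> by (rule measurable_compose)
  qed (use J F in auto)
  then show ?thesis by (simp add: comp_def)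
qed

text \<open>One factor at a time: exchanging one factor changes the product by the change of that
  factor times the norm of the others, since norms of independent factors multiply.\<close>

lemma (in prob_space) product_approximation:
  fixes X :: "'i \<Rightarrow> 'a \<Rightarrow> real"
  assumes ind: "indep_vars (\<lambda>_. borel) X I"
    and mom: "\<And>i. i \<in> I \<Longrightarrow> moments M (X i)"
    and \<phi>m: "\<And>i. i \<in> I \<Longrightarrow> \<phi> i \<in> borel_measurable borel"
    and cl: "\<And>i. i \<in> I \<Longrightarrow> (\<lambda>\<omega>. \<phi> i (X i \<omega>)) \<in> l2_closure M (polys_of (X i))"
    and J: "finite J" "J \<subseteq> I" and e: "0 < e"
  shows "square_integrable M (\<lambda>\<omega>. \<Prod>i\<in>J. \<phi> i (X i \<omega>)) \<and>
    (\<exists>p. square_integrable M (\<lambda>\<omega>. \<Prod>i\<in>J. poly (p i) (X i \<omega>)) \<and>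
      l2norm M (\<lambda>\<omega>. (\<Prod>i\<in>J. \<phi> i (X i \<omega>)) - (\<Prod>i\<in>J. poly (p i) (X i \<omega>))) < e)"
  using J e
proof (induction J arbitrary: e rule: finite_induct)
  case empty
  then show ?case by (simp add: square_integrable_def l2norm_def)
next
  case (insert k J)
  have Xm: "X i \<in> borel_measurable M" if "i \<in> I" for i
    using ind that by (auto simp: indep_vars_def)
  have J: "J \<subseteq> I" "k \<in> I" using insert.prems by auto
  have indJ: "indep_var borel (\<lambda>\<omega>. \<psi> (X k \<omega>)) borel (\<lambda>\<omega>. F (\<lambda>i\<in>J. X i \<omega>))"
    if "\<psi> \<in> borel_measurable borel" "F \<in> borel_measurable (\<Pi>\<^sub>M i\<in>J. borel)" for \<psi> F
    using indep_var_coordinate_tuple[OF ind _ insert.hyps(2) that] insert.prems by simp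
  have prod_m: "(\<lambda>x. \<Prod>i\<in>J. \<psi> i (x i)) \<in> borel_measurable (\<Pi>\<^sub>M i\<in>J. borel)"
    if "\<And>i. i \<in> J \<Longrightarrow> \<psi> i \<in> borel_measurable borel" for \<psi> :: "'i \<Rightarrow> real \<Rightarrow> real"
    using that by (intro borel_measurable_prod measurable_compose[OF measurable_component_singleton]) auto
  have poly_m: "poly q \<in> borel_measurable borel" for q :: "real poly"
    by (intro borel_measurable_continuous_onI continuous_intros)
  define \<Phi> where "\<Phi> \<omega> = (\<Prod>i\<in>J. \<phi> i (X i \<omega>))" for \<omega>
  have sq\<Phi>: "square_integrable M \<Phi>"
    using insert.IH[OF J(1), of 1] unfolding \<Phi>_def by simp
  have sq\<phi>: "square_integrable M (\<lambda>\<omega>. \<phi> k (X k \<omega>))" using cl[OF J(2)] by (rule l2_closure_square_integrable)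
  have ind\<Phi>: "indep_var borel (\<lambda>\<omega>. \<psi> (X k \<omega>)) borel \<Phi>" if "\<psi> \<in> borel_measurable borel" for \<psi>
    using indJ[OF that prod_m[of \<phi>]] \<phi>m J unfolding \<Phi>_def by (simp add: subset_eq cong: prod.cong)
  have sq: "square_integrable M (\<lambda>\<omega>. \<phi> k (X k \<omega>) * \<Phi> \<omega>)"
    by (rule indep_var_square_integrable_mult(1)[OF ind\<Phi>[OF \<phi>m[OF J(2)]] sq\<phi> sq\<Phi>])
  define e1 where "e1 = e / (2 * (l2norm M \<Phi> + 1))"
  have e1: "0 < e1" using insert.prems by (simp add: e1_def add_nonneg_pos)
  obtain q where q: "l2norm M (\<lambda>\<omega>. \<phi> k (X k \<omega>) - poly q (X k \<omega>)) < e1"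
    by (rule l2_closure_D[OF cl[OF J(2)] e1]) (auto simp: polys_of_def)
  have sqq: "square_integrable M (\<lambda>\<omega>. poly q (X k \<omega>))"
    using moments.square_integrable_poly[OF mom[OF J(2)]] .
  define e2 where "e2 = e / (2 * (l2norm M (\<lambda>\<omega>. poly q (X k \<omega>)) + 1))"
  have e2: "0 < e2" using insert.prems by (simp add: e2_def add_nonneg_pos)
  obtain p where p: "square_integrable M (\<lambda>\<omega>. \<Prod>i\<in>J. poly (p i) (X i \<omega>))"
    "l2norm M (\<lambda>\<omega>. \<Phi> \<omega> - (\<Prod>i\<in>J. poly (p i) (X i \<omega>))) < e2"
    using insert.IH[OF J(1) e2] unfolding \<Phi>_def by blast
  define Q where "Q \<omega> = (\<Prod>i\<in>J. poly (p i) (X i \<omega>))" for \<omega>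
  define p' where "p' = p(k := q)"
  have split1: "(\<Prod>i\<in>insert k J. \<phi> i (X i \<omega>)) = \<phi> k (X k \<omega>) * \<Phi> \<omega>" for \<omega>
    unfolding \<Phi>_def using insert.hyps by simp
  have split2: "(\<Prod>i\<in>insert k J. poly (p' i) (X i \<omega>)) = poly q (X k \<omega>) * Q \<omega>" for \<omega>
    unfolding Q_def p'_def using insert.hyps by (auto intro!: prod.cong)
  have ind1: "indep_var borel (\<lambda>\<omega>. \<phi> k (X k \<omega>) - poly q (X k \<omega>)) borel \<Phi>"
    by (rule ind\<Phi>[of "\<lambda>x. \<phi> k x - poly q x"]) (intro borel_measurable_diff \<phi>m J poly_m)
  have ind2: "indep_var borel (\<lambda>\<omega>. poly q (X k \<omega>)) borel Q"
    using indJ[OF poly_m[of q] prod_m[of "\<lambda>i. poly (p i)"]] poly_m unfolding Q_def by (simp cong: prod.cong)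
  have ind3: "indep_var borel (\<lambda>\<omega>. poly q (X k \<omega>)) borel (\<lambda>\<omega>. \<Phi> \<omega> - Q \<omega>)"
  proof -
    have "(\<lambda>x. (\<Prod>i\<in>J. \<phi> i (x i)) - (\<Prod>i\<in>J. poly (p i) (x i))) \<in> borel_measurable (\<Pi>\<^sub>M i\<in>J. borel)"
      using \<phi>m J poly_m by (intro borel_measurable_diff prod_m) auto
    from indJ[OF poly_m[of q] this] show ?thesis unfolding \<Phi>_def Q_def by (simp cong: prod.cong)
  qed
  note n1 = indep_var_square_integrable_mult[OF ind1 square_integrable_diff[OF sq\<phi> sqq] sq\<Phi>]
  have sqQ: "square_integrable M Q" using p(1) unfolding Q_def .
  note n3 = indep_var_square_integrable_mult[OF ind3 sqq square_integrable_diff[OF sq\<Phi> sqQ]]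
  have "l2norm M (\<lambda>\<omega>. \<phi> k (X k \<omega>) * \<Phi> \<omega> - poly q (X k \<omega>) * Q \<omega>) =
      l2norm M (\<lambda>\<omega>. (\<phi> k (X k \<omega>) - poly q (X k \<omega>)) * \<Phi> \<omega> + poly q (X k \<omega>) * (\<Phi> \<omega> - Q \<omega>))"
    by (simp add: algebra_simps)
  also have "\<dots> \<le> l2norm M (\<lambda>\<omega>. \<phi> k (X k \<omega>) - poly q (X k \<omega>)) * l2norm M \<Phi> +
      l2norm M (\<lambda>\<omega>. poly q (X k \<omega>)) * l2norm M (\<lambda>\<omega>. \<Phi> \<omega> - Q \<omega>)"
    using l2norm_triangle[OF n1(1) n3(1)] unfolding n1(2) n3(2) .
  also have "\<dots> \<le> e1 * l2norm M \<Phi> + l2norm M (\<lambda>\<omega>. poly q (X k \<omega>)) * e2"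
    using q p(2) unfolding Q_def by (intro add_mono mult_right_mono mult_left_mono) auto
  also have "\<dots> < e"
  proof -
    have half: "e / (2 * (r + 1)) * r < e / 2" if "0 \<le> r" for r
      using that insert.prems by (simp add: field_simps)
    from half[of "l2norm M \<Phi>"] half[of "l2norm M (\<lambda>\<omega>. poly q (X k \<omega>))"] show ?thesis
      unfolding e1_def e2_def by (simp add: mult.commute)
  qed
  finally have fin: "l2norm M (\<lambda>\<omega>. \<phi> k (X k \<omega>) * \<Phi> \<omega> - poly q (X k \<omega>) * Q \<omega>) < e" .
  show ?case
    unfolding split1 
    using sq fin split2 indep_var_square_integrable_mult(1)[OF ind2 sqq sqQ]
    by (intro conjI exI[of _ p']) simp_all
qed

text \<open>Boxes generate the product \<open>\<sigma>\<close>-algebra and their indicators are products.\<close>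

theorem (in prob_space) products_of_polynomials_dense:
  fixes X :: "'i \<Rightarrow> 'a \<Rightarrow> real"
  assumes fin: "finite I" and ind: "indep_vars (\<lambda>_. borel) X I"
    and A: "\<And>i. i \<in> I \<Longrightarrow> A i \<in> sets borel"
    and mom: "\<And>i. i \<in> I \<Longrightarrow> nontrivial_moments M (X i)"
    and carleman: "\<And>i. i \<in> I \<Longrightarrow> \<not> summable (\<lambda>n. 1 / nontrivial_moments.root_moment M (X i) (Suc n))"
    and h: "(\<lambda>\<omega>. \<lambda>i\<in>I. X i \<omega>) \<in> M \<rightarrow>\<^sub>M (\<Pi>\<^sub>M i\<in>I. restrict_space borel (A i))"
    and L: "linear_space L" "\<And>p. (\<lambda>\<omega>. \<Prod>i\<in>I. poly (p i) (X i \<omega>)) \<in> L"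
    and y: "y \<in> borel_measurable (\<Pi>\<^sub>M i\<in>I. restrict_space borel (A i))"
      "square_integrable M (\<lambda>\<omega>. y (\<lambda>i\<in>I. X i \<omega>))"
  shows "(\<lambda>\<omega>. y (\<lambda>i\<in>I. X i \<omega>)) \<in> l2_closure M L"
proof -
  let ?S = "\<lambda>i. restrict_space borel (A i)"
  have Xm: "X i \<in> borel_measurable M" if "i \<in> I" for i
    using ind that by (auto simp: indep_vars_def)
  have prod_cl: "(\<lambda>\<omega>. \<Prod>i\<in>I. indicator (B i) (X i \<omega>)) \<in> l2_closure M L"
    if B: "\<And>i. i \<in> I \<Longrightarrow> B i \<in> sets borel" for B
  proof -
    have cl: "(\<lambda>\<omega>. indicator (B i) (X i \<omega>)) \<in> l2_closure M (polys_of (X i))" if i: "i \<in> I" for i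
    proof (rule nontrivial_moments.polynomials_dense[OF mom[OF i] carleman[OF i], where g = "indicator (B i)"])
      show "indicator (B i) \<in> borel_measurable (borel :: real measure)" using B[OF i] by measurable
      then have "(\<lambda>\<omega>. indicator (B i) (X i \<omega>) :: real) \<in> borel_measurable M"
        by (rule measurable_compose[OF Xm[OF i]])
      then show "square_integrable M (\<lambda>\<omega>. indicator (B i) (X i \<omega>))"
        by (rule square_integrable_bounded[where B = 1]) (simp add: indicator_def)
    qed
    have mom': "moments M (X i)" if "i \<in> I" for i
      using mom[OF that] by (simp add: nontrivial_moments_def)
    have Bm: "indicator (B i) \<in> borel_measurable (borel :: real measure)" if "i \<in> I" for i
      using B[OF that] by measurable
    have approx: "square_integrable M (\<lambda>\<omega>. \<Prod>i\<in>I. indicator (B i) (X i \<omega>)) \<and>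
      (\<exists>p. square_integrable M (\<lambda>\<omega>. \<Prod>i\<in>I. poly (p i) (X i \<omega>)) \<and>
        l2norm M (\<lambda>\<omega>. (\<Prod>i\<in>I. indicator (B i) (X i \<omega>)) - (\<Prod>i\<in>I. poly (p i) (X i \<omega>))) < e)"
      if "0 < e" for e
      by (rule product_approximation[OF ind _ _ _ fin order_refl that]) (rule mom' Bm cl, assumption)+
    show ?thesis
    proof (rule l2_closure_I)
      show "square_integrable M (\<lambda>\<omega>. \<Prod>i\<in>I. indicator (B i) (X i \<omega>))" using approx[of 1] by simp
      fix e :: real assume "0 < e"
      from approx[OF this] obtain p where
        "square_integrable M (\<lambda>\<omega>. \<Prod>i\<in>I. poly (p i) (X i \<omega>))"
        "l2norm M (\<lambda>\<omega>. (\<Prod>i\<in>I. indicator (B i) (X i \<omega>)) - (\<Prod>i\<in>I. poly (p i) (X i \<omega>))) < e"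
        by blast
      then show "\<exists>g. g \<in> L \<and> square_integrable M g \<and>
          l2norm M (\<lambda>\<omega>. (\<Prod>i\<in>I. indicator (B i) (X i \<omega>)) - g \<omega>) < e"
        using L(2)[of p] by blast
    qed
  qed
  define G where "G = {(\<Pi>\<^sub>E i\<in>I. B i) | B. (\<forall>i. B i \<in> sets (?S i)) \<and> finite {i. B i \<noteq> space (?S i)}}"
  show ?thesis
  proof (rule l2_closure_generator[OF L(1) h, where G = G])
    show "Int_stable G"
    proof (rule Int_stableI)
      fix U V assume "U \<in> G" "V \<in> G"
      then obtain B C where BC: "U = Pi\<^sub>E I B" "V = Pi\<^sub>E I C"
        "\<forall>i. B i \<in> sets (?S i)" "\<forall>i. C i \<in> sets (?S i)"
        "finite {i. B i \<noteq> space (?S i)}" "finite {i. C i \<noteq> space (?S i)}"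
        unfolding G_def by blast
      have "finite {i. B i \<inter> C i \<noteq> space (?S i)}"
        by (rule finite_subset[OF _ finite_UnI[OF BC(5,6)]]) auto
      then show "U \<inter> V \<in> G"
        unfolding G_def using BC by (intro CollectI exI[of _ "\<lambda>i. B i \<inter> C i"]) (auto simp: PiE_Int)
    qed
    show "G \<subseteq> Pow (space (Pi\<^sub>M I ?S))"
    proof
      fix U assume "U \<in> G"
      then obtain B where B: "U = Pi\<^sub>E I B" "\<forall>i. B i \<in> sets (?S i)" unfolding G_def by blast
      show "U \<in> Pow (space (Pi\<^sub>M I ?S))"
        unfolding B(1) space_PiM using sets.sets_into_space B(2) by (intro PowI PiE_mono) blast
    qed
    show "sets (Pi\<^sub>M I ?S) = sigma_sets (space (Pi\<^sub>M I ?S)) G"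
      unfolding G_def space_PiM by (rule sets_PiM_finite)
    show "(\<lambda>_. 1) \<in> l2_closure M L" using prod_cl[of "\<lambda>_. UNIV"] by simp
    fix U assume "U \<in> G"
    then obtain B where B: "U = Pi\<^sub>E I B" "\<forall>i. B i \<in> sets (?S i)" unfolding G_def by blast
    have "indicator U (\<lambda>i\<in>I. X i \<omega>) = (\<Prod>i\<in>I. indicator (B i) (X i \<omega>) :: real)" for \<omega>
    proof (cases "\<forall>i\<in>I. X i \<omega> \<in> B i")
      case True
      then have "(\<Prod>i\<in>I. indicator (B i) (X i \<omega>) :: real) = 1" by (intro prod.neutral) auto
      with True show ?thesis by (simp add: B(1) PiE_iff)
    next
      case False
      then obtain i where "i \<in> I" "X i \<omega> \<notin> B i" by blast
      then have "(\<Prod>i\<in>I. indicator (B i) (X i \<omega>) :: real) = 0"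
        using fin by (intro prod_zero bexI[of _ i]) auto
      with False show ?thesis by (auto simp: B(1) PiE_iff)
    qed
    moreover have "B i \<in> sets borel" if "i \<in> I" for i
      using B(2)[rule_format, of i] A[OF that] by (subst (asm) sets_restrict_space_iff) auto
    ultimately show "(\<lambda>\<omega>. indicator U (\<lambda>i\<in>I. X i \<omega>)) \<in> l2_closure M L"
      using prod_cl[of B] by simp
  qed (rule y)+
qed

section \<open>Fourier series of orthonormal families\<close>

definition span_of :: "('k \<Rightarrow> 'a \<Rightarrow> real) \<Rightarrow> 'k set \<Rightarrow> ('a \<Rightarrow> real) set" where
  "span_of b K = {\<lambda>x. \<Sum>k\<in>F. c k * b k x | F c. finite F \<and> F \<subseteq> K}"

lemma linear_space_span_of: "linear_space (span_of b K)"
  unfolding linear_space_def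
proof (intro conjI ballI allI)
  show "(\<lambda>_. 0) \<in> span_of b K"
    unfolding span_of_def by (rule CollectI, rule exI[of _ "{}"]) simp
next
  fix f g assume "f \<in> span_of b K" "g \<in> span_of b K"
  then obtain F c G d where F: "finite F" "F \<subseteq> K" "f = (\<lambda>x. \<Sum>k\<in>F. c k * b k x)"
    and G: "finite G" "G \<subseteq> K" "g = (\<lambda>x. \<Sum>k\<in>G. d k * b k x)"
    unfolding span_of_def by blast
  define e where "e k = (if k \<in> F then c k else 0) + (if k \<in> G then d k else 0)" for k
  have "f x + g x = (\<Sum>k\<in>F \<union> G. e k * b k x)" for x
  proof -
    have "f x = (\<Sum>k\<in>F \<union> G. (if k \<in> F then c k else 0) * b k x)"
      unfolding F(3) using F(1) G(1) by (intro sum.mono_neutral_cong_left) auto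
    moreover have "g x = (\<Sum>k\<in>F \<union> G. (if k \<in> G then d k else 0) * b k x)"
      unfolding G(3) using F(1) G(1) by (intro sum.mono_neutral_cong_left) auto
    ultimately show ?thesis by (simp add: e_def distrib_right sum.distrib)
  qed
  then show "(\<lambda>x. f x + g x) \<in> span_of b K"
    unfolding span_of_def using F G by (intro CollectI exI[of _ "F \<union> G"] exI[of _ e]) auto
next
  fix f c assume "f \<in> span_of b K"
  then obtain F d where F: "finite F" "F \<subseteq> K" "f = (\<lambda>x. \<Sum>k\<in>F. d k * b k x)"
    unfolding span_of_def by blast
  then show "(\<lambda>x. c * f x) \<in> span_of b K"
    unfolding span_of_def
    by (intro CollectI exI[of _ F] exI[of _ "\<lambda>k. c * d k"]) (simp add: sum_distrib_left mult.assoc)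
qed

locale orthonormal_family =
  fixes M :: "'a measure" and b :: "'k \<Rightarrow> 'a \<Rightarrow> real" and K :: "'k set"
  assumes b_square_integrable: "k \<in> K \<Longrightarrow> square_integrable M (b k)"
    and orthonormal: "\<lbrakk>k \<in> K; l \<in> K\<rbrakk> \<Longrightarrow> (LINT x|M. b k x * b l x) = (if k = l then 1 else 0)"
begin

definition fourier_sum :: "('a \<Rightarrow> real) \<Rightarrow> 'k set \<Rightarrow> 'a \<Rightarrow> real" where
  "fourier_sum y F x = (\<Sum>k\<in>F. (LINT z|M. y z * b k z) * b k x)"

lemma fourier_sum_square_integrable:
  "F \<subseteq> K \<Longrightarrow> square_integrable M (fourier_sum y F)"
  unfolding fourier_sum_def by (intro square_integrable_sum square_integrable_scale b_square_integrable) auto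

text \<open>The error of the Fourier sum is orthogonal to the span of the terms.\<close>

lemma fourier_sum_best_approximation:
  assumes y: "square_integrable M y" and F: "finite F" "F \<subseteq> K"
  shows "l2norm M (\<lambda>x. y x - fourier_sum y F x) \<le> l2norm M (\<lambda>x. y x - (\<Sum>k\<in>F. c k * b k x))"
proof -
  define a where "a k = (LINT z|M. y z * b k z)" for k
  define r where "r x = y x - fourier_sum y F x" for x
  define d where "d x = (\<Sum>k\<in>F. (a k - c k) * b k x)" for x
  have sqS: "square_integrable M (fourier_sum y F)" by (rule fourier_sum_square_integrable[OF F(2)])
  have sqr: "square_integrable M r" unfolding r_def by (intro square_integrable_diff y sqS)
  have sqd: "square_integrable M d"
    unfolding d_def using F by (intro square_integrable_sum square_integrable_scale b_square_integrable) auto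
  have rb: "(LINT x|M. r x * b k x) = 0" if k: "k \<in> F" for k
  proof -
    have kK: "k \<in> K" using k F by auto
    have int: "integrable M (\<lambda>x. b l x * b k x)" if "l \<in> F" for l
      using that kK F by (intro square_integrable_mult b_square_integrable) auto
    have "(LINT x|M. r x * b k x) = (LINT x|M. y x * b k x - (\<Sum>l\<in>F. a l * (b l x * b k x)))"
      unfolding r_def fourier_sum_def a_def[symmetric] by (simp add: left_diff_distrib sum_distrib_right mult.assoc)
    also have "\<dots> = a k - (\<Sum>l\<in>F. a l * (LINT x|M. b l x * b k x))"
      unfolding a_def[of k] using int square_integrable_mult[OF y b_square_integrable[OF kK]]
      by (subst Bochner_Integration.integral_diff) auto
    also have "(\<Sum>l\<in>F. a l * (LINT x|M. b l x * b k x)) = (\<Sum>l\<in>F. if l = k then a l else 0)"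
      using F kK by (intro sum.cong refl) (auto simp: orthonormal)
    also have "\<dots> = a k" using F k by simp
    finally show ?thesis by simp
  qed
  have rd: "(LINT x|M. r x * d x) = 0"
  proof -
    have "(LINT x|M. r x * d x) = (LINT x|M. (\<Sum>k\<in>F. (a k - c k) * (r x * b k x)))"
      unfolding d_def by (simp add: sum_distrib_left mult_ac)
    also have "\<dots> = (\<Sum>k\<in>F. (a k - c k) * (LINT x|M. r x * b k x))"
      using F by (subst Bochner_Integration.integral_sum)
        (auto intro!: square_integrable_mult sqr b_square_integrable)
    finally show ?thesis using rb by simp
  qed
  have "(LINT x|M. (r x)\<^sup>2) \<le> (LINT x|M. (r x)\<^sup>2) + (LINT x|M. (d x)\<^sup>2)" by simp
  also have "\<dots> = (LINT x|M. (r x)\<^sup>2 + 2 * (r x * d x) + (d x)\<^sup>2)"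
    using square_integrable_mult[OF sqr sqd] sqr sqd rd by (simp add: square_integrable_def)
  also have "\<dots> = (LINT x|M. (y x - (\<Sum>k\<in>F. c k * b k x))\<^sup>2)"
  proof (intro Bochner_Integration.integral_cong refl)
    fix x
    have "y x - (\<Sum>k\<in>F. c k * b k x) = r x + d x"
      unfolding r_def d_def fourier_sum_def a_def[symmetric] by (simp add: left_diff_distrib sum_subtractf)
    then show "(r x)\<^sup>2 + 2 * (r x * d x) + (d x)\<^sup>2 = (y x - (\<Sum>k\<in>F. c k * b k x))\<^sup>2"
      by (simp add: power2_sum mult.assoc)
  qed
  finally show ?thesis unfolding l2norm_def r_def by (rule real_sqrt_le_mono)
qed

text \<open>An approximation from the span uses finitely many terms, and the exhausting sets contain all
  of them from some point on; from then on the Fourier sums do at least as well.\<close>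

theorem fourier_series_converges:
  assumes y: "y \<in> l2_closure M (span_of b K)" and J: "finite_exhaustion K J"
  shows "(\<lambda>n. l2norm M (\<lambda>x. y x - fourier_sum y (J n) x)) \<longlonglongrightarrow> 0"
proof (rule LIMSEQ_I)
  fix e :: real assume "0 < e"
  then obtain g where g: "g \<in> span_of b K" "l2norm M (\<lambda>x. y x - g x) < e"
    using y by (auto elim: l2_closure_D)
  then obtain F c where F: "finite F" "F \<subseteq> K" "g = (\<lambda>x. \<Sum>k\<in>F. c k * b k x)"
    unfolding span_of_def by blast
  have fin: "finite (J n)" and JK: "J n \<subseteq> K" for n using J by (auto simp: finite_exhaustion_def)
  have inc: "J m \<subseteq> J n" if "m \<le> n" for m n
    using J that by (simp add: finite_exhaustion_def incseqD)
  have "\<exists>n. F \<subseteq> J n"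
    using F(1,2)
  proof (induction F rule: finite_induct)
    case (insert k F)
    then obtain n m where "F \<subseteq> J n" "k \<in> J m" using J by (auto simp: finite_exhaustion_def)
    moreover have "J n \<subseteq> J (max m n)" "J m \<subseteq> J (max m n)"
      by (simp_all add: inc)
    ultimately show ?case by blast
  qed auto
  then obtain n where n: "F \<subseteq> J n" by blast
  have "norm (l2norm M (\<lambda>x. y x - fourier_sum y (J m) x) - 0) < e" if "n \<le> m" for m
  proof -
    have Fm: "F \<subseteq> J m" using n inc[OF that] by simp
    have "l2norm M (\<lambda>x. y x - fourier_sum y (J m) x) \<le>
        l2norm M (\<lambda>x. y x - (\<Sum>k\<in>J m. (if k \<in> F then c k else 0) * b k x))"
      by (rule fourier_sum_best_approximation[OF l2_closure_square_integrable[OF y] fin JK])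
    also have "(\<lambda>x. \<Sum>k\<in>J m. (if k \<in> F then c k else 0) * b k x) = g"
    proof
      fix x
      show "(\<Sum>k\<in>J m. (if k \<in> F then c k else 0) * b k x) = g x"
        unfolding F(3) using fin Fm by (intro sum.mono_neutral_cong_right) auto
    qed
    then have "l2norm M (\<lambda>x. y x - (\<Sum>k\<in>J m. (if k \<in> F then c k else 0) * b k x)) = l2norm M (\<lambda>x. y x - g x)"
      by (simp add: fun_eq_iff)
    finally show ?thesis using g(2) by simp
  qed
  then show "\<exists>n. \<forall>m\<ge>n. norm (l2norm M (\<lambda>x. y x - fourier_sum y (J m) x) - 0) < e" by blast
qed

end

section \<open>Modes of convergence\<close>

text \<open>Both claims come from \<open>\<bar>u\<bar> \<le> d + u\<^sup>2 / d\<close>, the second one with \<open>d\<close> as small as desired.\<close>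

lemma (in prob_space) mean_square_imp_in_mean:
  assumes "converges_in_mean_square M S Z"
  shows "integrable M (\<lambda>\<omega>. \<bar>S n \<omega> - Z \<omega>\<bar>)"
    and "(\<lambda>n. LINT \<omega>|M. \<bar>S n \<omega> - Z \<omega>\<bar>) \<longlonglongrightarrow> 0"
proof -
  have m [measurable]: "\<And>n. S n \<in> borel_measurable M" "Z \<in> borel_measurable M"
    and int2: "\<And>n. integrable M (\<lambda>\<omega>. (S n \<omega> - Z \<omega>)\<^sup>2)"
    and lim: "(\<lambda>n. LINT \<omega>|M. (S n \<omega> - Z \<omega>)\<^sup>2) \<longlonglongrightarrow> 0"
    using assms by (auto simp: converges_in_mean_square_def)
  have pt: "\<bar>u\<bar> \<le> d + u\<^sup>2 / d" if "0 < d" for u d :: real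
  proof (cases "\<bar>u\<bar> \<le> d")
    case False
    then have "\<bar>u\<bar> * d \<le> \<bar>u\<bar> * \<bar>u\<bar>" by (intro mult_left_mono) auto
    then have "\<bar>u\<bar> \<le> u\<^sup>2 / d" using that by (simp add: field_simps power2_eq_square abs_mult_self_eq)
    with that show ?thesis by linarith
  qed (use that in \<open>simp add: add_increasing2\<close>)
  show int1: "integrable M (\<lambda>\<omega>. \<bar>S n \<omega> - Z \<omega>\<bar>)" for n
  proof (rule Bochner_Integration.integrable_bound)
    show "integrable M (\<lambda>\<omega>. 1 + (S n \<omega> - Z \<omega>)\<^sup>2 / 1)" using int2 by simp
    show "AE \<omega> in M. norm \<bar>S n \<omega> - Z \<omega>\<bar> \<le> norm (1 + (S n \<omega> - Z \<omega>)\<^sup>2 / 1)"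
      using pt[of 1] by (intro AE_I2) (simp add: abs_of_nonneg)
  qed measurable
  show "(\<lambda>n. LINT \<omega>|M. \<bar>S n \<omega> - Z \<omega>\<bar>) \<longlonglongrightarrow> 0"
  proof (rule LIMSEQ_I)
    fix e :: real assume e: "0 < e"
    define d where "d = e / 2"
    have d: "0 < d" using e by (simp add: d_def)
    have "eventually (\<lambda>n. (LINT \<omega>|M. (S n \<omega> - Z \<omega>)\<^sup>2) < d * d) sequentially"
      using order_tendstoD(2)[OF lim, of "d * d"] d by simp
    then obtain N where N: "\<And>n. N \<le> n \<Longrightarrow> (LINT \<omega>|M. (S n \<omega> - Z \<omega>)\<^sup>2) < d * d"
      by (auto simp: eventually_sequentially)
    have "norm ((LINT \<omega>|M. \<bar>S n \<omega> - Z \<omega>\<bar>) - 0) < e" if "N \<le> n" for n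
    proof -
      have "(LINT \<omega>|M. \<bar>S n \<omega> - Z \<omega>\<bar>) \<le> (LINT \<omega>|M. d + (S n \<omega> - Z \<omega>)\<^sup>2 / d)"
        using int1 int2 pt[OF d] by (intro integral_mono) auto
      also have "\<dots> = d + (LINT \<omega>|M. (S n \<omega> - Z \<omega>)\<^sup>2) / d"
        using int2 by (simp add: prob_space)
      also have "\<dots> < d + d" using N[OF that] d by (simp add: field_simps)
      finally have "(LINT \<omega>|M. \<bar>S n \<omega> - Z \<omega>\<bar>) < e" by (simp add: d_def)
      moreover have "0 \<le> (LINT \<omega>|M. \<bar>S n \<omega> - Z \<omega>\<bar>)" by simp
      ultimately show ?thesis by simp
    qed
    then show "\<exists>N. \<forall>n\<ge>N. norm ((LINT \<omega>|M. \<bar>S n \<omega> - Z \<omega>\<bar>) - 0) < e" by blast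
  qed
qed

lemma (in prob_space) mean_square_imp_in_probability:
  assumes ms: "converges_in_mean_square M S Z"
  shows "converges_in_probability M S Z"
  unfolding converges_in_probability_def
proof (intro conjI allI impI)
  show m: "S n \<in> borel_measurable M" "Z \<in> borel_measurable M" for n
    using ms by (auto simp: converges_in_mean_square_def)
  fix e :: real assume e: "0 < e"
  note int = mean_square_imp_in_mean(1)[OF ms] and lim = mean_square_imp_in_mean(2)[OF ms]
  show "(\<lambda>n. measure M {\<omega> \<in> space M. e < \<bar>S n \<omega> - Z \<omega>\<bar>}) \<longlonglongrightarrow> 0"
  proof (rule tendsto_sandwich[where f = "\<lambda>_. 0"])
    show "(\<lambda>n. (LINT \<omega>|M. \<bar>S n \<omega> - Z \<omega>\<bar>) / e) \<longlonglongrightarrow> 0"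
      using tendsto_divide[OF lim tendsto_const[of e]] e by simp
    have "measure M {\<omega> \<in> space M. e < \<bar>S n \<omega> - Z \<omega>\<bar>} \<le> (LINT \<omega>|M. \<bar>S n \<omega> - Z \<omega>\<bar>) / e" for n
    proof -
      note [measurable] = m(1)[of n] m(2)
      have "measure M {\<omega> \<in> space M. e < \<bar>S n \<omega> - Z \<omega>\<bar>} \<le> measure M {\<omega> \<in> space M. e \<le> \<bar>S n \<omega> - Z \<omega>\<bar>}"
        by (intro finite_measure_mono) auto
      also have "\<dots> \<le> (LINT \<omega>|M. \<bar>S n \<omega> - Z \<omega>\<bar>) / e"
        using integral_Markov_inequality_measure[OF int, of "{}" n e] e by simp
      finally show ?thesis .
    qed
    then show "\<forall>\<^sub>F n in sequentially. measure M {\<omega> \<in> space M. e < \<bar>S n \<omega> - Z \<omega>\<bar>} \<le> (LINT \<omega>|M. \<bar>S n \<omega> - Z \<omega>\<bar>) / e"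
      by simp
  qed auto
qed

text \<open>The trapezoidal test functions that characterise weak convergence are Lipschitz
  continuous, so convergence in mean suffices.\<close>

lemma (in prob_space) mean_square_imp_in_distribution:
  assumes ms: "converges_in_mean_square M S Z"
  shows "converges_in_distribution M S Z"
  unfolding converges_in_distribution_def
proof (intro conjI allI)
  show m: "S n \<in> borel_measurable M" "Z \<in> borel_measurable M" for n
    using ms by (auto simp: converges_in_mean_square_def)
  note int = mean_square_imp_in_mean(1)[OF ms] and lim = mean_square_imp_in_mean(2)[OF ms]
  show "weak_conv_m (\<lambda>n. distr M borel (S n)) (distr M borel Z)"
  proof (rule integral_cts_step_conv_imp_weak_conv)
    show "real_distribution (distr M borel (S n))" "real_distribution (distr M borel Z)" for n
      using m by (auto intro: real_distribution_distr)
    fix u v :: real assume uv: "u < v"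
    have cm: "cts_step u v \<in> borel_measurable borel"
      by (intro borel_measurable_continuous_onI uniformly_continuous_imp_continuous cts_step_uniformly_continuous uv)
    have lip: "\<bar>cts_step u v x - cts_step u v z\<bar> \<le> \<bar>x - z\<bar> / (v - u)" for x z
    proof -
      have clamp: "cts_step u v t = max 0 (min 1 ((v - t) / (v - u)))" for t
        using uv by (auto simp: cts_step_def field_simps)
      have "\<bar>max 0 (min 1 r) - max 0 (min 1 s)\<bar> \<le> \<bar>r - s\<bar>" for r s :: real by linarith
      also have "\<bar>(v - x) / (v - u) - (v - z) / (v - u)\<bar> = \<bar>x - z\<bar> / (v - u)"
        using uv by (simp add: diff_divide_distrib[symmetric] abs_minus_commute)
      finally show ?thesis by (simp only: clamp)
    qed
    have ci: "integrable M (\<lambda>\<omega>. cts_step u v (T \<omega>))" if "T \<in> borel_measurable M" for T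
      using uv by (intro integrable_const_bound[where B = 1] measurable_compose[OF that cm]) (auto simp: cts_step_def)
    have "(\<lambda>n. (LINT \<omega>|M. cts_step u v (S n \<omega>)) - (LINT \<omega>|M. cts_step u v (Z \<omega>))) \<longlonglongrightarrow> 0"
    proof (rule tendsto_rabs_zero_cancel, rule tendsto_sandwich[where f = "\<lambda>_. 0"])
      show "(\<lambda>n. (LINT \<omega>|M. \<bar>S n \<omega> - Z \<omega>\<bar>) / (v - u)) \<longlonglongrightarrow> 0"
        using tendsto_divide[OF lim tendsto_const[of "v - u"]] uv by simp
      have "\<bar>(LINT \<omega>|M. cts_step u v (S n \<omega>)) - (LINT \<omega>|M. cts_step u v (Z \<omega>))\<bar> \<le> (LINT \<omega>|M. \<bar>S n \<omega> - Z \<omega>\<bar>) / (v - u)" for n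
      proof -
        have "(LINT \<omega>|M. cts_step u v (S n \<omega>)) - (LINT \<omega>|M. cts_step u v (Z \<omega>)) =
            (LINT \<omega>|M. cts_step u v (S n \<omega>) - cts_step u v (Z \<omega>))"
          by (intro Bochner_Integration.integral_diff[symmetric] ci m)
        also have "\<bar>\<dots>\<bar> \<le> (LINT \<omega>|M. \<bar>cts_step u v (S n \<omega>) - cts_step u v (Z \<omega>)\<bar>)"
          by (rule integral_abs_bound)
        also have "\<dots> \<le> (LINT \<omega>|M. \<bar>S n \<omega> - Z \<omega>\<bar> / (v - u))"
          by (intro integral_mono integrable_abs Bochner_Integration.integrable_diff integrable_divide ci m int lip)
        finally show ?thesis by simp
      qed
      then show "\<forall>\<^sub>F n in sequentially. \<bar>(LINT \<omega>|M. cts_step u v (S n \<omega>)) - (LINT \<omega>|M. cts_step u v (Z \<omega>))\<bar>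
          \<le> (LINT \<omega>|M. \<bar>S n \<omega> - Z \<omega>\<bar>) / (v - u)" by simp
    qed auto
    then show "(\<lambda>n. integral\<^sup>L (distr M borel (S n)) (cts_step u v)) \<longlonglongrightarrow> integral\<^sup>L (distr M borel Z) (cts_step u v)"
      using m cm by (simp add: integral_distr LIM_zero_iff)
  qed
qed

section \<open>Integrals with respect to the joint density\<close>

text \<open>Both measures are determined by their values on boxes, where the integral of the product
  factorises.\<close>

lemma (in prob_space) joint_distribution_density:
  fixes X :: "'i \<Rightarrow> 'a \<Rightarrow> real"
  assumes I: "finite I" "I \<noteq> {}" and ind: "indep_vars (\<lambda>_. borel) X I"
    and d: "\<And>i. i \<in> I \<Longrightarrow> distributed M lborel (X i) (\<lambda>x. ennreal (f i x))"
    and f0: "\<And>i x. i \<in> I \<Longrightarrow> 0 \<le> f i x"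
  shows "distr M (\<Pi>\<^sub>M i\<in>I. borel) (\<lambda>\<omega>. \<lambda>i\<in>I. X i \<omega>) =
    density (\<Pi>\<^sub>M i\<in>I. lborel) (\<lambda>x. ennreal (\<Prod>i\<in>I. f i (x i)))"
proof -
  define D where "D i = (if i \<in> I then distr M borel (X i) else lborel)" for i
  have Xm [measurable]: "X i \<in> borel_measurable M" if "i \<in> I" for i
    using ind that by (auto simp: indep_vars_def)
  have fm: "(\<lambda>x. ennreal (f i x)) \<in> borel_measurable lborel" if "i \<in> I" for i
    using d[OF that] by (rule distributed_borel_measurable)
  have Ddens: "D i = density lborel (\<lambda>x. ennreal (f i x))" if "i \<in> I" for i
  proof -
    have "distr M borel (X i) = distr M lborel (X i)" by (rule distr_cong) auto
    then show ?thesis using that distributed_distr_eq_density[OF d[OF that]] by (simp add: D_def)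
  qed
  interpret L: product_sigma_finite "\<lambda>_::'i. lborel :: real measure"
    by (simp add: product_sigma_finite_def lborel.sigma_finite_measure_axioms)
  interpret D: product_sigma_finite D
    unfolding product_sigma_finite_def
  proof
    fix i
    show "sigma_finite_measure (D i)"
    proof (cases "i \<in> I")
      case True
      then interpret i: prob_space "distr M borel (X i)" by (intro prob_space_distr Xm)
      show ?thesis using True i.sigma_finite_measure_axioms by (simp add: D_def)
    qed (simp add: D_def lborel.sigma_finite_measure_axioms)
  qed
  have sets_D: "sets (D i) = sets borel" for i by (simp add: D_def)
  have fm': "(\<lambda>x. ennreal (\<Prod>i\<in>I. f i (x i))) \<in> borel_measurable (\<Pi>\<^sub>M i\<in>I. lborel)"
  proof -
    have "(\<lambda>x. \<Prod>i\<in>I. ennreal (f i (x i))) \<in> borel_measurable (\<Pi>\<^sub>M i\<in>I. lborel)"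
    proof (rule borel_measurable_prod_ennreal)
      fix i assume i: "i \<in> I"
      show "(\<lambda>x. ennreal (f i (x i))) \<in> borel_measurable (\<Pi>\<^sub>M i\<in>I. lborel)"
        by (rule measurable_compose[OF measurable_component_singleton[OF i] fm[OF i]])
    qed
    then show ?thesis using f0 by (simp add: prod_ennreal cong: measurable_cong)
  qed
  have "density (\<Pi>\<^sub>M i\<in>I. lborel) (\<lambda>x. ennreal (\<Prod>i\<in>I. f i (x i))) = PiM I D"
  proof (rule D.PiM_eqI[OF I(1)])
    show "sets (density (\<Pi>\<^sub>M i\<in>I. lborel) (\<lambda>x. ennreal (\<Prod>i\<in>I. f i (x i)))) = sets (PiM I D)"
      by (simp add: sets_D cong: sets_PiM_cong)
    fix B assume "\<And>i. i \<in> I \<Longrightarrow> B i \<in> sets (D i)"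
    then have B: "B i \<in> sets borel" if "i \<in> I" for i using that by (simp add: sets_D)
    have box: "Pi\<^sub>E I B \<in> sets (\<Pi>\<^sub>M i\<in>I. lborel)" using B I by (intro sets_PiM_I_finite) auto
    have "emeasure (density (\<Pi>\<^sub>M i\<in>I. lborel) (\<lambda>x. ennreal (\<Prod>i\<in>I. f i (x i)))) (Pi\<^sub>E I B) =
        (\<integral>\<^sup>+x. ennreal (\<Prod>i\<in>I. f i (x i)) * indicator (Pi\<^sub>E I B) x \<partial>(\<Pi>\<^sub>M i\<in>I. lborel))"
      using fm' box by (rule emeasure_density)
    also have "\<dots> = (\<integral>\<^sup>+x. (\<Prod>i\<in>I. ennreal (f i (x i)) * indicator (B i) (x i)) \<partial>(\<Pi>\<^sub>M i\<in>I. lborel))"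
    proof (rule nn_integral_cong)
      fix x assume "x \<in> space (\<Pi>\<^sub>M i\<in>I. lborel :: real measure)"
      then have ext: "x \<in> extensional I" by (simp add: space_PiM PiE_def)
      have "indicator (Pi\<^sub>E I B) x = (\<Prod>i\<in>I. indicator (B i) (x i) :: ennreal)"
      proof (cases "\<forall>i\<in>I. x i \<in> B i")
        case True
        with ext show ?thesis by (simp add: PiE_iff)
      next
        case False
        then obtain i where "i \<in> I" "x i \<notin> B i" by blast
        then have "x \<notin> Pi\<^sub>E I B" "\<exists>i\<in>I. indicator (B i) (x i) = (0 :: ennreal)"
          by (auto intro!: bexI[of _ i])
        then show ?thesis using I(1) by (simp add: prod_zero)
      qed
      then show "ennreal (\<Prod>i\<in>I. f i (x i)) * indicator (Pi\<^sub>E I B) x =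
          (\<Prod>i\<in>I. ennreal (f i (x i)) * indicator (B i) (x i))"
        using f0 by (simp add: prod.distrib prod_ennreal)
    qed
    also have "\<dots> = (\<Prod>i\<in>I. \<integral>\<^sup>+x. ennreal (f i x) * indicator (B i) x \<partial>lborel)"
      using B fm I by (intro L.product_nn_integral_prod) auto
    also have "\<dots> = (\<Prod>i\<in>I. emeasure (D i) (B i))"
      using B fm by (intro prod.cong refl) (simp add: Ddens emeasure_density)
    finally show "emeasure (density (\<Pi>\<^sub>M i\<in>I. lborel) (\<lambda>x. ennreal (\<Prod>i\<in>I. f i (x i)))) (Pi\<^sub>E I B) =
        (\<Prod>i\<in>I. emeasure (D i) (B i))" .
  qed
  also have "PiM I D = (\<Pi>\<^sub>M i\<in>I. distr M borel (X i))" by (intro PiM_cong) (simp_all add: D_def)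
  also have "\<dots> = distr M (\<Pi>\<^sub>M i\<in>I. borel) (\<lambda>\<omega>. \<lambda>i\<in>I. X i \<omega>)"
    using indep_vars_iff_distr_eq_PiM'[where I = I and M' = "\<lambda>_. borel" and X = X] I ind Xm by simp
  finally show ?thesis by simp
qed

text \<open>A vanishing even moment would concentrate the variable at \<open>0\<close>, a null set for a density.\<close>

lemma (in prob_space) even_moment_pos_of_density:
  fixes Z :: "'a \<Rightarrow> real"
  assumes d: "distributed M lborel Z (\<lambda>x. ennreal (f x))" and int: "integrable M (\<lambda>\<omega>. Z \<omega> ^ (2 * n))"
  shows "0 < moment M Z (2 * n)"
proof (rule ccontr)
  have nonneg: "0 \<le> Z \<omega> ^ (2 * n)" for \<omega> by simp
  assume "\<not> 0 < moment M Z (2 * n)"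
  moreover have "0 \<le> moment M Z (2 * n)"
    unfolding moment_def using nonneg by (intro integral_nonneg_AE AE_I2)
  ultimately have "(LINT \<omega>|M. Z \<omega> ^ (2 * n)) = 0" unfolding moment_def by linarith
  then have "AE \<omega> in M. Z \<omega> ^ (2 * n) = 0"
    using integral_nonneg_eq_0_iff_AE[OF int] nonneg by simp
  then have "AE \<omega> in M. Z \<omega> = 0" by eventually_elim simp
  moreover have "AE \<omega> in M. Z \<omega> \<noteq> 0"
    using AE_lborel_singleton[of 0] by (subst distributed_AE2[OF d]) auto
  ultimately have "AE \<omega> in M. False" by eventually_elim simp
  then show False by simp
qed

section \<open>The polynomial dimensional decomposition\<close>

text \<open>Subtracting a multiple of the basis polynomial of the same degree lowers the degree.\<close>

lemma polynomial_in_graded_basis: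
  fixes q :: "nat \<Rightarrow> 'a :: field poly"
  assumes q: "\<And>k. q k \<noteq> 0" "\<And>k. degree (q k) = k"
  shows "\<exists>c n. p = (\<Sum>k\<le>n. smult (c k) (q k))"
proof -
  have "\<exists>c. p = (\<Sum>k\<le>n. smult (c k) (q k))" if "degree p \<le> n" for n
    using that
  proof (induction n arbitrary: p)
    case 0
    then obtain a where a: "p = [:a:]" by (auto elim: degree_eq_zeroE)
    obtain d where d: "q 0 = [:d:]" using q(2)[of 0] by (auto elim: degree_eq_zeroE)
    then have "d \<noteq> 0" using q(1)[of 0] by auto
    then show ?case by (intro exI[of _ "\<lambda>_. a / d"]) (simp add: a d)
  next
    case (Suc n)
    define s where "s = coeff p (Suc n) / coeff (q (Suc n)) (Suc n)"
    have nz: "coeff (q (Suc n)) (Suc n) \<noteq> 0"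
      using q[of "Suc n"] leading_coeff_0_iff[of "q (Suc n)"] by simp
    have "degree (p - smult s (q (Suc n))) \<le> n"
    proof (rule degree_le, intro allI impI)
      fix i assume "n < i"
      then consider "i = Suc n" | "Suc n < i" by linarith
      then show "coeff (p - smult s (q (Suc n))) i = 0"
      proof cases
        case 2
        then show ?thesis using Suc.prems q(2)[of "Suc n"] by (simp add: coeff_eq_0)
      qed (use nz in \<open>simp add: s_def\<close>)
    qed
    then obtain c where "p - smult s (q (Suc n)) = (\<Sum>k\<le>n. smult (c k) (q k))" using Suc.IH by blast
    then have "p = (\<Sum>k\<le>Suc n. smult ((c(Suc n := s)) k) (q k))" by (simp add: algebra_simps)
    then show ?case by blast
  qed
  then show ?thesis by blast
qed

locale pdd_setting = prob_space M for M :: "'w measure" +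
  fixes N :: nat
    and A :: "nat \<Rightarrow> real set"
    and X :: "nat \<Rightarrow> 'w \<Rightarrow> real"
    and f :: "nat \<Rightarrow> real \<Rightarrow> real"
    and P :: "nat \<Rightarrow> nat \<Rightarrow> real poly"
  assumes N: "1 \<le> N"
    and input_measurable: "input_vec N X \<in> M \<rightarrow>\<^sub>M borel_box N A"
    and A: "assumption_A M N A X f"
    and B: "assumption_B M N A X f"
    and orth: "\<forall>i\<in>{1..N}. orthogonal_polynomials M (X i) (P i)"
begin

lemma independent: "indep_vars (\<lambda>_. borel) X {1..N}"
  using A by (simp add: assumption_A_def)

lemma input_density:
  assumes "i \<in> {1..N}"
  shows "distributed M lborel (X i) (\<lambda>x. ennreal (f i x))" "0 \<le> f i x" "A i \<in> sets borel"
    "{x. f i x \<noteq> 0} \<subseteq> A i"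
  using A assms by (auto simp: assumption_A_def continuous_density_on_def)

lemma X_measurable: "i \<in> {1..N} \<Longrightarrow> X i \<in> borel_measurable M"
  using independent by (auto simp: indep_vars_def)

lemma nontrivial: "i \<in> {1..N} \<Longrightarrow> nontrivial_moments M (X i)"
  using A X_measurable[of i] even_moment_pos_of_density[OF input_density(1)]
  by unfold_locales (auto simp: assumption_A_def)

text \<open>Bounded support is a special case of an exponential moment, and the Krein--Lin condition
  makes the density positive everywhere, so that its support is the whole line.\<close>

lemma Carleman_condition:
  assumes i: "i \<in> {1..N}"
  shows "\<not> summable (\<lambda>n. 1 / nontrivial_moments.root_moment M (X i) (Suc n))"
proof -
  interpret i: nontrivial_moments M "X i" by (rule nontrivial[OF i])
  have "(\<exists>a b. measure M {\<omega>\<in>space M. a \<le> X i \<omega> \<and> X i \<omega> \<le> b} = 1) \<or>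
     liminf (\<lambda>l. ereal (moment M (X i) (2 * l) powr (1 / real (2 * l)) / real (2 * l))) < \<infinity> \<or>
     (\<Sum>l. ennreal (1 / moment M (X i) (2 * Suc l) powr (1 / real (2 * Suc l)))) = \<infinity> \<or>
     (\<exists>a>0. set_integrable lborel (A i) (\<lambda>x. exp (a * \<bar>x\<bar>) * f i x)) \<or>
     krein_lin (A i) (f i)"
    using B i unfolding assumption_B_def by blast
  then show ?thesis
  proof (elim disjE exE conjE)
    fix a b assume ab: "measure M {\<omega>\<in>space M. a \<le> X i \<omega> \<and> X i \<omega> \<le> b} = 1"
    note [measurable] = X_measurable[OF i]
    have "AE \<omega> in M. a \<le> X i \<omega> \<and> X i \<omega> \<le> b"
      using AE_prob_1[OF ab] by simp
    then have "AE \<omega> in M. norm (exp (1 * \<bar>X i \<omega>\<bar>)) \<le> exp (\<bar>a\<bar> + \<bar>b\<bar>)"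
      by eventually_elim auto
    then have "integrable M (\<lambda>\<omega>. exp (1 * \<bar>X i \<omega>\<bar>))" by (rule integrable_const_bound) measurable
    then show ?thesis by (rule i.Carleman_of_exponential_moment[rotated]) simp
  next
    fix a :: real assume a: "0 < a" "set_integrable lborel (A i) (\<lambda>x. exp (a * \<bar>x\<bar>) * f i x)"
    have eq: "indicator (A i) x *\<^sub>R (exp (a * \<bar>x\<bar>) * f i x) = f i x * exp (a * \<bar>x\<bar>)" for x
      using input_density(4)[OF i] by (cases "f i x = 0") auto
    have "integrable lborel (\<lambda>x. f i x * exp (a * \<bar>x\<bar>))"
      using a(2) unfolding set_integrable_def eq .
    then have "integrable M (\<lambda>\<omega>. exp (a * \<bar>X i \<omega>\<bar>))"
      using distributed_integrable[OF input_density(1)[OF i], of "\<lambda>x. exp (a * \<bar>x\<bar>)"] input_density(2)[OF i] by simp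
    then show ?thesis by (rule i.Carleman_of_exponential_moment[OF a(1)])
  next
    assume kl: "krein_lin (A i) (f i)"
    have "A i = UNIV" using input_density(4)[OF i] kl by (auto simp: krein_lin_def less_imp_neq[symmetric])
    with kl show ?thesis by (intro i.Carleman_of_krein_lin[OF input_density(1)[OF i]]) simp
  qed (rule i.Carleman_of_liminf i.Carleman_of_infinite_sum, assumption)+
qed

lemma measurable_on_box:
  fixes g :: "(nat \<Rightarrow> real) \<Rightarrow> real"
  assumes g: "g \<in> borel_measurable (borel_box N A)"
  shows "(\<lambda>x. indicator (PiE {1..N} A) x *\<^sub>R g x) \<in> borel_measurable (\<Pi>\<^sub>M i\<in>{1..N}. borel)"
proof -
  have box: "PiE {1..N} A \<in> sets (\<Pi>\<^sub>M i\<in>{1..N}. borel)"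
    using input_density(3) by (intro sets_PiM_I_finite) auto
  have "(\<lambda>x i. x i) \<in> restrict_space (\<Pi>\<^sub>M i\<in>{1..N}. borel) (PiE {1..N} A) \<rightarrow>\<^sub>M borel_box N A"
  proof (rule measurable_PiM_single')
    fix i assume i: "i \<in> {1..N}"
    show "(\<lambda>x. x i) \<in> restrict_space (\<Pi>\<^sub>M i\<in>{1..N}. borel) (PiE {1..N} A) \<rightarrow>\<^sub>M restrict_space borel (A i)"
      using i by (intro measurable_restrict_space2 measurable_restrict_space1) (auto simp: space_restrict_space)
  next
    show "(\<lambda>x i. x i) \<in> space (restrict_space (\<Pi>\<^sub>M i\<in>{1..N}. borel) (PiE {1..N} A)) \<rightarrow>
        (\<Pi>\<^sub>E i\<in>{1..N}. space (restrict_space borel (A i)))"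
      by (auto simp: space_restrict_space)
  qed
  then have gm: "g \<in> borel_measurable (restrict_space (\<Pi>\<^sub>M i\<in>{1..N}. borel) (PiE {1..N} A))"
    using g by (simp add: measurable_compose)
  have box': "PiE {1..N} A \<inter> space (\<Pi>\<^sub>M i\<in>{1..N}. borel) \<in> sets (\<Pi>\<^sub>M i\<in>{1..N}. borel)"
    using box by auto
  show ?thesis
    using gm unfolding borel_measurable_restrict_space_iff[OF box', of g] .
qed

lemma input_in_box: "\<omega> \<in> space M \<Longrightarrow> input_vec N X \<omega> \<in> PiE {1..N} A"
  using measurable_space[OF input_measurable] by (auto simp: space_PiM space_restrict_space)

text \<open>The input vector has the joint density and takes its values in the box; outside the box
  the function is cut off, since its measurability is only known there.\<close>

lemma expectation_eq_density_integral:
  assumes g: "g \<in> borel_measurable (borel_box N A)"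
  shows "set_integrable (lebesgue_box N) (PiE {1..N} A) (\<lambda>x. g x * joint_density N f x) \<longleftrightarrow>
      integrable M (\<lambda>\<omega>. g (input_vec N X \<omega>))"
    and "(LINT x:PiE {1..N} A|lebesgue_box N. g x * joint_density N f x) = (LINT \<omega>|M. g (input_vec N X \<omega>))"
proof -
  define G where "G x = indicator (PiE {1..N} A) x *\<^sub>R g x" for x
  let ?B = "\<Pi>\<^sub>M i\<in>{1..N}. (borel :: real measure)"
  have distr: "distr M ?B (input_vec N X) = density (lebesgue_box N) (\<lambda>x. ennreal (joint_density N f x))"
    using joint_distribution_density[of "{1..N}" X f] N independent input_density
    unfolding lebesgue_box_def joint_density_def input_vec_def by simp
  have sets: "sets (lebesgue_box N) = sets ?B"
    unfolding lebesgue_box_def by (intro sets_PiM_cong) auto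
  have Gm: "G \<in> borel_measurable ?B" unfolding G_def by (rule measurable_on_box[OF g])
  then have Gm': "G \<in> borel_measurable (lebesgue_box N)" using sets by (simp cong: measurable_cong_sets)
  have hm: "input_vec N X \<in> M \<rightarrow>\<^sub>M ?B"
    unfolding input_vec_def[abs_def] using X_measurable by (intro measurable_restrict) auto
  have fm: "f i \<in> borel_measurable borel" if "i \<in> {1..N}" for i
    using distributed_real_measurable[OF _ input_density(1)[OF that]] input_density(2)[OF that] by simp
  have jm: "joint_density N f \<in> borel_measurable (lebesgue_box N)"
    unfolding joint_density_def[abs_def] lebesgue_box_def
    by (intro borel_measurable_prod measurable_compose[OF measurable_component_singleton]) (auto intro: fm)
  have j0: "0 \<le> joint_density N f x" for x
    unfolding joint_density_def using input_density(2) by (intro prod_nonneg) auto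
  have eq: "indicator (PiE {1..N} A) x *\<^sub>R (g x * joint_density N f x) = joint_density N f x *\<^sub>R G x" for x
    by (simp add: G_def)
  have Gh: "G (input_vec N X \<omega>) = g (input_vec N X \<omega>)" if "\<omega> \<in> space M" for \<omega>
    using input_in_box[OF that] by (simp add: G_def)
  have "integrable (lebesgue_box N) (\<lambda>x. joint_density N f x *\<^sub>R G x) \<longleftrightarrow>
      integrable (density (lebesgue_box N) (\<lambda>x. ennreal (joint_density N f x))) G"
    using Gm' jm j0 by (intro integrable_density[symmetric]) auto
  also have "\<dots> \<longleftrightarrow> integrable M (\<lambda>\<omega>. G (input_vec N X \<omega>))"
    unfolding distr[symmetric] by (rule integrable_distr_eq[OF hm Gm])
  also have "\<dots> \<longleftrightarrow> integrable M (\<lambda>\<omega>. g (input_vec N X \<omega>))"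
    by (intro Bochner_Integration.integrable_cong refl Gh)
  finally show "set_integrable (lebesgue_box N) (PiE {1..N} A) (\<lambda>x. g x * joint_density N f x) \<longleftrightarrow>
      integrable M (\<lambda>\<omega>. g (input_vec N X \<omega>))"
    unfolding set_integrable_def eq .
  have "(LINT x|lebesgue_box N. joint_density N f x *\<^sub>R G x) =
      integral\<^sup>L (density (lebesgue_box N) (\<lambda>x. ennreal (joint_density N f x))) G"
    using Gm' jm j0 by (intro integral_density[symmetric]) auto
  also have "\<dots> = (LINT \<omega>|M. G (input_vec N X \<omega>))"
    unfolding distr[symmetric] by (rule integral_distr[OF hm Gm])
  also have "\<dots> = (LINT \<omega>|M. g (input_vec N X \<omega>))"
    by (intro Bochner_Integration.integral_cong refl Gh)
  finally show "(LINT x:PiE {1..N} A|lebesgue_box N. g x * joint_density N f x) = (LINT \<omega>|M. g (input_vec N X \<omega>))"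
    unfolding set_lebesgue_integral_def eq .
qed

text \<open>The normalised polynomials, with the one of degree \<open>0\<close> replaced by the constant \<open>1\<close>; it
  is \<open>\<plusminus>1\<close> before, and its sign must not enter products over all coordinates.\<close>

definition unit_poly :: "nat \<Rightarrow> nat \<Rightarrow> real poly" where
  "unit_poly i k = (if k = 0 then 1 else
     smult (1 / sqrt (LINT \<omega>|M. (poly (P i k) (X i \<omega>))\<^sup>2)) (P i k))"

lemma orthogonal_P:
  assumes "i \<in> {1..N}"
  shows "P i k \<noteq> 0" "degree (P i k) = k" "0 < (LINT \<omega>|M. (poly (P i k) (X i \<omega>))\<^sup>2)"
    "k \<noteq> l \<Longrightarrow> (LINT \<omega>|M. poly (P i k) (X i \<omega>) * poly (P i l) (X i \<omega>)) = 0"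
  using orth[rule_format, OF assms] unfolding orthogonal_polynomials_def by blast+

lemma unit_poly_degree:
  assumes "i \<in> {1..N}" shows "unit_poly i k \<noteq> 0" "degree (unit_poly i k) = k"
proof -
  note P = orthogonal_P[OF assms, of k]
  then have "(LINT \<omega>|M. (poly (P i k) (X i \<omega>))\<^sup>2) \<noteq> 0" by linarith
  with P show "unit_poly i k \<noteq> 0" "degree (unit_poly i k) = k" by (simp_all add: unit_poly_def)
qed

lemma uni_Psi_eq: "k \<noteq> 0 \<Longrightarrow> uni_Psi M X P i k x = poly (unit_poly i k) x"
  by (simp add: uni_Psi_def unit_poly_def)

lemma unit_poly_orthonormal:
  assumes i: "i \<in> {1..N}"
  shows "(LINT \<omega>|M. poly (unit_poly i k) (X i \<omega>) * poly (unit_poly i l) (X i \<omega>)) = (if k = l then 1 else 0)"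
proof -
  let ?n = "\<lambda>k. LINT \<omega>|M. (poly (P i k) (X i \<omega>))\<^sup>2"
  have oP: "(LINT \<omega>|M. poly (P i k) (X i \<omega>) * poly (P i l) (X i \<omega>)) = (if k = l then ?n k else 0)" for k l
    using orthogonal_P(4)[OF i] by (simp add: power2_eq_square)
  obtain d where d: "P i 0 = [:d:]"
    using orthogonal_P(2)[OF i, of 0] by (auto elim: degree_eq_zeroE)
  have d0: "d \<noteq> 0" using orthogonal_P(1)[OF i, of 0] d by simp
  have mean0: "(LINT \<omega>|M. poly (P i l) (X i \<omega>)) = 0" if "l \<noteq> 0" for l
    using oP[of 0 l] d d0 that by simp
  have norm: "?n k / (sqrt (?n k) * sqrt (?n k)) = 1" for k
    using orthogonal_P(3)[OF i, of k] by simp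
  show ?thesis
    using mean0 norm by (cases "k = 0"; cases "l = 0") (auto simp: unit_poly_def oP prob_space)
qed

definition basis :: "nat set \<times> (nat \<Rightarrow> nat) \<Rightarrow> 'w \<Rightarrow> real" where
  "basis k \<omega> = multi_Psi M X P (fst k) (snd k) (input_vec N X \<omega>)"

text \<open>Adding the empty index set turns the mean into one more Fourier coefficient: the product
  over the empty set is the constant \<open>1\<close>.\<close>

definition full_index :: "(nat set \<times> (nat \<Rightarrow> nat)) set" where
  "full_index = (SIGMA u:Pow {1..N}. multi_indices u)"

text \<open>Padding a multi-index by \<open>0\<close> lets all basis functions be products over the same
  coordinates, so that they can be compared coordinate by coordinate.\<close>

definition exponents :: "nat set \<times> (nat \<Rightarrow> nat) \<Rightarrow> nat \<Rightarrow> nat" where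
  "exponents k i = (if i \<in> fst k then snd k i else 0)"

text \<open>The only multi-index over the empty set is the function that is undefined everywhere.\<close>

lemma full_index_eq: "full_index = insert ({}, \<lambda>_. undefined) (pdd_index N)"
  by (auto simp: full_index_def pdd_index_def nonempty_subsets_def multi_indices_def)

lemma basis_eq_product:
  assumes "k \<in> full_index"
  shows "basis k \<omega> = (\<Prod>i\<in>{1..N}. poly (unit_poly i (exponents k i)) (X i \<omega>))"
proof -
  obtain u j where k: "k = (u, j)" "u \<subseteq> {1..N}" "j \<in> multi_indices u"
    using assms by (auto simp: full_index_def)
  have "basis k \<omega> = (\<Prod>i\<in>u. poly (unit_poly i (exponents k i)) (X i \<omega>))"
    unfolding basis_def multi_Psi_def k(1) fst_conv snd_conv
  proof (intro prod.cong refl)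
    fix i assume i: "i \<in> u"
    have "j i \<noteq> 0" using k(3) i by (force simp: multi_indices_def PiE_iff)
    then show "uni_Psi M X P i (j i) (input_vec N X \<omega> i) = poly (unit_poly i (exponents (u, j) i)) (X i \<omega>)"
      using i k(2) by (auto simp: uni_Psi_eq exponents_def input_vec_def)
  qed
  also have "\<dots> = (\<Prod>i\<in>{1..N}. poly (unit_poly i (exponents k i)) (X i \<omega>))"
    using k by (intro prod.mono_neutral_left) (auto simp: exponents_def unit_poly_def)
  finally show ?thesis .
qed

lemma exponents_inj:
  assumes "k \<in> full_index" "l \<in> full_index" "\<And>i. i \<in> {1..N} \<Longrightarrow> exponents k i = exponents l i"
  shows "k = l"
proof -
  obtain u j v m where kl: "k = (u, j)" "l = (v, m)" and uv: "u \<subseteq> {1..N}" "v \<subseteq> {1..N}"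
    and jm: "j \<in> u \<rightarrow>\<^sub>E {1..}" "m \<in> v \<rightarrow>\<^sub>E {1..}"
    using assms(1,2) by (auto simp: full_index_def multi_indices_def)
  have pos: "i \<in> u \<Longrightarrow> 1 \<le> j i" "i \<in> v \<Longrightarrow> 1 \<le> m i" for i using jm by (auto simp: PiE_iff)
  have eq: "(if i \<in> u then j i else 0) = (if i \<in> v then m i else 0)" for i
    using assms(3)[of i] uv by (cases "i \<in> {1..N}") (auto simp: exponents_def kl)
  have "u = v"
  proof (rule set_eqI)
    show "i \<in> u \<longleftrightarrow> i \<in> v" for i using eq[of i] pos[of i] by (auto split: if_splits)
  qed
  moreover have "j = m"
  proof (rule PiE_ext[OF jm(1)])
    show "m \<in> u \<rightarrow>\<^sub>E {1..}" using jm(2) \<open>u = v\<close> by simp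
    show "j i = m i" if "i \<in> u" for i using eq[of i] that \<open>u = v\<close> by simp
  qed
  ultimately show ?thesis by (simp add: kl)
qed

lemma independent_polynomials:
  assumes "\<And>i. q i \<in> borel_measurable borel"
  shows "indep_vars (\<lambda>_. borel) (\<lambda>i \<omega>. q i (X i \<omega>)) {1..N}"
  by (rule indep_vars_compose2[where Y = q and N = "\<lambda>_. borel", OF independent]) (rule assms)

lemma poly_measurable: "poly q \<in> borel_measurable (borel :: real measure)"
  by (intro borel_measurable_continuous_onI continuous_intros)

lemma product_of_polynomials_integral:
  "integrable M (\<lambda>\<omega>. \<Prod>i\<in>{1..N}. poly (q i) (X i \<omega>))"
  "(LINT \<omega>|M. (\<Prod>i\<in>{1..N}. poly (q i) (X i \<omega>))) = (\<Prod>i\<in>{1..N}. (LINT \<omega>|M. poly (q i) (X i \<omega>)))"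
proof -
  have "integrable M (\<lambda>\<omega>. poly (q i) (X i \<omega>))" if "i \<in> {1..N}" for i
    by (rule moments.integrable_poly) (use nontrivial[OF that] in \<open>simp add: nontrivial_moments_def\<close>)
  note * = independent_polynomials[of "\<lambda>i. poly (q i)", OF poly_measurable] this
  show "integrable M (\<lambda>\<omega>. \<Prod>i\<in>{1..N}. poly (q i) (X i \<omega>))"
    by (rule indep_vars_integrable) (use * in auto)
  show "(LINT \<omega>|M. (\<Prod>i\<in>{1..N}. poly (q i) (X i \<omega>))) = (\<Prod>i\<in>{1..N}. (LINT \<omega>|M. poly (q i) (X i \<omega>)))"
    by (rule indep_vars_lebesgue_integral) (use * in auto)
qed

lemma product_of_polynomials_square_integrable:
  "square_integrable M (\<lambda>\<omega>. \<Prod>i\<in>{1..N}. poly (q i) (X i \<omega>))"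
  using product_of_polynomials_integral(1)[of q] product_of_polynomials_integral(1)[of "\<lambda>i. q i * q i"]
  by (simp add: square_integrable_def power2_eq_square prod.distrib borel_measurable_integrable)

sublocale orthonormal_family M basis full_index
proof
  fix k assume k: "k \<in> full_index"
  show "square_integrable M (basis k)"
    using product_of_polynomials_square_integrable[of "\<lambda>i. unit_poly i (exponents k i)"]
    by (simp add: basis_eq_product[OF k, abs_def])
  fix l assume l: "l \<in> full_index"
  have "(LINT \<omega>|M. basis k \<omega> * basis l \<omega>) =
      (LINT \<omega>|M. (\<Prod>i\<in>{1..N}. poly (unit_poly i (exponents k i) * unit_poly i (exponents l i)) (X i \<omega>)))"
    by (simp add: basis_eq_product k l prod.distrib)
  also have "\<dots> = (\<Prod>i\<in>{1..N}. if exponents k i = exponents l i then 1 else 0)"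
    unfolding product_of_polynomials_integral(2) by (intro prod.cong refl) (simp add: unit_poly_orthonormal)
  also have "\<dots> = (if k = l then 1 else 0)"
  proof (cases "k = l")
    case False
    then obtain i where "i \<in> {1..N}" "exponents k i \<noteq> exponents l i" using exponents_inj[OF k l] by blast
    with False show ?thesis by (auto intro!: prod_zero)
  qed simp
  finally show "(LINT \<omega>|M. basis k \<omega> * basis l \<omega>) = (if k = l then 1 else 0)" .
qed

text \<open>Expanding each factor in the normalised polynomials of its variable and multiplying out
  gives a sum over all padded multi-indices.\<close>

lemma product_of_polynomials_in_span:
  "(\<lambda>\<omega>. \<Prod>i\<in>{1..N}. poly (p i) (X i \<omega>)) \<in> span_of basis full_index"
proof -
  have "\<forall>i\<in>{1..N}. \<exists>c n. p i = (\<Sum>k\<le>n. smult (c k) (unit_poly i k))"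
    using polynomial_in_graded_basis[of "unit_poly i" for i] unit_poly_degree by blast
  then obtain c n where cn: "\<And>i. i \<in> {1..N} \<Longrightarrow> p i = (\<Sum>k\<le>(n i :: nat). smult (c i k) (unit_poly i k))"
    by metis
  have single: "(\<lambda>\<omega>. \<Prod>i\<in>{1..N}. poly (unit_poly i (\<kappa> i)) (X i \<omega>)) \<in> span_of basis full_index" for \<kappa>
  proof -
    define u where "u = {i \<in> {1..N}. \<kappa> i \<noteq> 0}"
    define k where "k = (u, restrict \<kappa> u)"
    have k: "k \<in> full_index"
      by (auto simp: k_def full_index_def multi_indices_def u_def)
    have ex: "exponents k i = \<kappa> i" if "i \<in> {1..N}" for i
      using that by (auto simp: exponents_def k_def u_def)
    have "(\<Prod>i\<in>{1..N}. poly (unit_poly i (\<kappa> i)) (X i \<omega>)) = (\<Sum>l\<in>{k}. 1 * basis l \<omega>)" for \<omega>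
      using ex by (simp add: basis_eq_product[OF k])
    then show ?thesis unfolding span_of_def
      using k by (intro CollectI exI[of _ "{k}"] exI[of _ "\<lambda>_. 1"]) auto
  qed
  have "(\<Prod>i\<in>{1..N}. poly (p i) (X i \<omega>)) =
      (\<Sum>\<kappa>\<in>PiE {1..N} (\<lambda>i. {..n i}). (\<Prod>i\<in>{1..N}. c i (\<kappa> i)) * (\<Prod>i\<in>{1..N}. poly (unit_poly i (\<kappa> i)) (X i \<omega>)))" for \<omega>
  proof -
    have "(\<Prod>i\<in>{1..N}. poly (p i) (X i \<omega>)) = (\<Prod>i\<in>{1..N}. \<Sum>k\<le>n i. c i k * poly (unit_poly i k) (X i \<omega>))"
      using cn by (intro prod.cong refl) (simp add: poly_sum)
    then show ?thesis by (simp add: prod_sum_PiE prod.distrib)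
  qed
  moreover have "(\<lambda>\<omega>. \<Sum>\<kappa>\<in>F. a \<kappa> * g \<kappa> \<omega>) \<in> span_of basis full_index"
    if "\<And>\<kappa>. g \<kappa> \<in> span_of basis full_index" for F :: "(nat \<Rightarrow> nat) set" and a :: "(nat \<Rightarrow> nat) \<Rightarrow> real" and g
    using linear_space_span_of[of basis full_index] that unfolding linear_space_def
    by (induction F rule: infinite_finite_induct) simp_all
  ultimately show ?thesis using single by simp
qed

end

locale pdd_function = pdd_setting M N A X f P
  for M :: "'w measure" and N A X f P +
  fixes y :: "(nat \<Rightarrow> real) \<Rightarrow> real"
  assumes y_measurable: "y \<in> borel_measurable (borel_box N A)"
    and y_square: "integrable M (\<lambda>\<omega>. (y (input_vec N X \<omega>))\<^sup>2)"
begin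

abbreviation response :: "'w \<Rightarrow> real" where "response \<omega> \<equiv> y (input_vec N X \<omega>)"

lemma response_square_integrable: "square_integrable M response"
  unfolding square_integrable_def using y_square measurable_compose[OF input_measurable y_measurable] by simp

lemma response_in_closure: "response \<in> l2_closure M (span_of basis full_index)"
proof -
  have h: "(\<lambda>\<omega>. \<lambda>i\<in>{1..N}. X i \<omega>) = input_vec N X" by (simp add: input_vec_def fun_eq_iff)
  have "(\<lambda>\<omega>. y (\<lambda>i\<in>{1..N}. X i \<omega>)) \<in> l2_closure M (span_of basis full_index)"
    by (rule products_of_polynomials_dense[where A = A, OF _ independent input_density(3) nontrivial Carleman_condition _
          linear_space_span_of product_of_polynomials_in_span y_measurable])
      (use input_measurable response_square_integrable in \<open>simp_all add: input_vec_def[abs_def]\<close>)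
  then show ?thesis by (simp add: input_vec_def)
qed

lemma response_integrable: "integrable M response"
  using square_integrable_mult[OF response_square_integrable, of "\<lambda>_. 1"] by (simp add: square_integrable_def)

lemma index_in_full: "\<lbrakk>u \<in> nonempty_subsets N; j \<in> multi_indices u\<rbrakk> \<Longrightarrow> (u, j) \<in> full_index"
  by (auto simp: full_index_def nonempty_subsets_def)

lemma response_times_basis_integrable:
  assumes "u \<in> nonempty_subsets N" "j \<in> multi_indices u"
  shows "integrable M (\<lambda>\<omega>. response \<omega> * multi_Psi M X P u j (input_vec N X \<omega>))"
  using square_integrable_mult[OF response_square_integrable b_square_integrable[OF index_in_full[OF assms]]]
  by (simp add: basis_def)

lemma multi_Psi_measurable:
  assumes u: "u \<in> nonempty_subsets N"
  shows "multi_Psi M X P u j \<in> borel_measurable (borel_box N A)"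
  unfolding multi_Psi_def[abs_def]
proof (rule borel_measurable_prod)
  fix i assume "i \<in> u"
  then have i: "i \<in> {1..N}" using u by (auto simp: nonempty_subsets_def)
  have "uni_Psi M X P i (j i) \<in> borel_measurable borel"
    unfolding uni_Psi_def[abs_def] using poly_measurable by (intro borel_measurable_divide) auto
  then have "uni_Psi M X P i (j i) \<in> borel_measurable (restrict_space borel (A i))"
    by (rule measurable_restrict_space1)
  then show "(\<lambda>x. uni_Psi M X P i (j i) (x i)) \<in> borel_measurable (borel_box N A)"
    using i by (intro measurable_compose[OF measurable_component_singleton])
qed

lemma pdd_partial_eq_fourier_sum:
  assumes "finite J" "J \<subseteq> pdd_index N"
  shows "pdd_partial M N X P y J \<omega> = fourier_sum response (insert ({}, \<lambda>_. undefined) J) \<omega>"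
proof -
  have notin: "({}, \<lambda>_. undefined) \<notin> J" using assms(2) by (auto simp: pdd_index_def nonempty_subsets_def)
  have "basis ({}, \<lambda>_. undefined) = (\<lambda>_. 1)" by (simp add: basis_def multi_Psi_def fun_eq_iff)
  then have "fourier_sum response (insert ({}, \<lambda>_. undefined) J) \<omega> =
      pdd_mean M N X y + fourier_sum response J \<omega>"
    unfolding fourier_sum_def using assms(1) notin by (simp add: pdd_mean_def)
  also have "fourier_sum response J \<omega> = (\<Sum>(u, j)\<in>J. pdd_term M N X P y u j \<omega>)"
    unfolding fourier_sum_def
    by (intro sum.cong refl) (auto simp: pdd_term_def pdd_coeff_def basis_def split: prod.split)
  finally show ?thesis by (simp add: pdd_partial_def)
qed

lemma pdd_converges_in_mean_square:
  assumes J: "finite_exhaustion (pdd_index N) J"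
  shows "converges_in_mean_square M (\<lambda>n. pdd_partial M N X P y (J n)) response"
proof -
  let ?o = "({}, \<lambda>_. undefined) :: nat set \<times> (nat \<Rightarrow> nat)"
  let ?J = "\<lambda>n. insert ?o (J n)"
  have fin: "finite (J n)" and sub: "J n \<subseteq> pdd_index N" for n using J by (auto simp: finite_exhaustion_def)
  have ex: "finite_exhaustion full_index ?J"
    using J unfolding finite_exhaustion_def full_index_eq by (auto simp: incseq_def)
  have eq: "pdd_partial M N X P y (J n) = fourier_sum response (?J n)" for n
    using pdd_partial_eq_fourier_sum[OF fin sub] by blast
  have sq: "square_integrable M (fourier_sum response (?J n))" for n
    using sub[of n] by (intro fourier_sum_square_integrable) (auto simp: full_index_eq)
  have "square_integrable M (\<lambda>\<omega>. fourier_sum response (?J n) \<omega> - response \<omega>)" for n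
    by (intro square_integrable_diff sq response_square_integrable)
  moreover have "(\<lambda>n. LINT \<omega>|M. (fourier_sum response (?J n) \<omega> - response \<omega>)\<^sup>2) \<longlonglongrightarrow> 0"
  proof -
    have "(\<lambda>n. (l2norm M (\<lambda>\<omega>. response \<omega> - fourier_sum response (?J n) \<omega>))\<^sup>2) \<longlonglongrightarrow> 0\<^sup>2"
      by (intro tendsto_power fourier_series_converges[OF response_in_closure ex])
    then show ?thesis by (simp add: l2norm_squared power2_commute)
  qed
  ultimately show ?thesis
    unfolding converges_in_mean_square_def eq
    using sq response_square_integrable by (auto simp: square_integrable_def)
qed

lemma finite_graded_block:
  assumes "u \<in> nonempty_subsets N" shows "finite {j \<in> multi_indices u. multi_degree u j \<le> m}"
proof (rule finite_subset)
  have fin: "finite u" using assms by (auto simp: nonempty_subsets_def intro: finite_subset)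
  show "{j \<in> multi_indices u. multi_degree u j \<le> m} \<subseteq> u \<rightarrow>\<^sub>E {..m}"
  proof
    fix j assume j: "j \<in> {j \<in> multi_indices u. multi_degree u j \<le> m}"
    have "j i \<le> m" if "i \<in> u" for i
      using member_le_sum[OF that, of j] fin j by (auto simp: multi_degree_def)
    with j show "j \<in> u \<rightarrow>\<^sub>E {..m}" by (auto simp: multi_indices_def PiE_iff)
  qed
  show "finite (u \<rightarrow>\<^sub>E {..m})" using fin by (intro finite_PiE) auto
qed

lemma finite_nonempty_subsets: "finite (nonempty_subsets N)"
  by (rule finite_subset[of _ "Pow {1..N}"]) (auto simp: nonempty_subsets_def)

lemma graded_index_eq:
  "{(u, j) \<in> pdd_index N. multi_degree u j \<le> m} =
    (SIGMA u:nonempty_subsets N. {j \<in> multi_indices u. multi_degree u j \<le> m})"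
  by (auto simp: pdd_index_def)

lemma graded_exhaustion:
  "finite_exhaustion (pdd_index N) (\<lambda>m. {(u, j) \<in> pdd_index N. multi_degree u j \<le> m})"
  unfolding finite_exhaustion_def
proof (intro conjI allI)
  show "finite {(u, j) \<in> pdd_index N. multi_degree u j \<le> m}" for m
    unfolding graded_index_eq by (intro finite_SigmaI finite_nonempty_subsets finite_graded_block)
  show "incseq (\<lambda>m. {(u, j) \<in> pdd_index N. multi_degree u j \<le> m})"
    by (auto simp: incseq_def)
  show "(\<Union>m. {(u, j) \<in> pdd_index N. multi_degree u j \<le> m}) = pdd_index N" by auto
qed

text \<open>All components of an index are positive, so degrees below \<open>card u\<close> do not occur.\<close>

lemma pdd_graded_eq_partial:
  "pdd_graded M N X P y m \<omega> =
    pdd_partial M N X P y {(u, j) \<in> pdd_index N. multi_degree u j \<le> m} \<omega>"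
proof -
  have "(\<Sum>l\<in>{card u..m}. \<Sum>j\<in>{j \<in> multi_indices u. multi_degree u j = l}. pdd_term M N X P y u j \<omega>) =
      (\<Sum>j\<in>{j \<in> multi_indices u. multi_degree u j \<le> m}. pdd_term M N X P y u j \<omega>)"
    if u: "u \<in> nonempty_subsets N" for u
  proof -
    have "card u \<le> multi_degree u j" if "j \<in> multi_indices u" for j
    proof -
      have "(\<Sum>i\<in>u. 1) \<le> (\<Sum>i\<in>u. j i)"
        using that by (intro sum_mono) (auto simp: multi_indices_def PiE_iff)
      then show ?thesis by (simp add: multi_degree_def)
    qed
    then have "(\<Sum>l\<in>{card u..m}. \<Sum>j\<in>{j \<in> {j \<in> multi_indices u. multi_degree u j \<le> m}. multi_degree u j = l}. pdd_term M N X P y u j \<omega>) =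
      (\<Sum>j\<in>{j \<in> multi_indices u. multi_degree u j \<le> m}. pdd_term M N X P y u j \<omega>)"
      by (intro sum.group finite_graded_block u) auto
    moreover have "{j \<in> {j \<in> multi_indices u. multi_degree u j \<le> m}. multi_degree u j = l} =
        {j \<in> multi_indices u. multi_degree u j = l}" if "l \<in> {card u..m}" for l
      using that by auto
    ultimately show ?thesis by simp
  qed
  then show ?thesis
    unfolding pdd_graded_def pdd_partial_def graded_index_eq
    by (simp add: sum.Sigma finite_nonempty_subsets finite_graded_block)
qed

end

theorem theorem4p1:
  fixes M :: "'w measure"
    and N :: nat
    and A :: "nat \<Rightarrow> real set"
    and X :: "nat \<Rightarrow> 'w \<Rightarrow> real"
    and f :: "nat \<Rightarrow> real \<Rightarrow> real"
    and P :: "nat \<Rightarrow> nat \<Rightarrow> real poly"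
    and y :: "(nat \<Rightarrow> real) \<Rightarrow> real"
  assumes "prob_space M" and "complete_measure M"
    and "1 \<le> N"
    and "input_vec N X \<in> M \<rightarrow>\<^sub>M borel_box N A"
    and "assumption_A M N A X f"
    and "assumption_B M N A X f"
    and "\<forall>i\<in>{1..N}. orthogonal_polynomials M (X i) (P i)"
    and "y \<in> borel_measurable (borel_box N A)"
    and "integrable M (\<lambda>\<omega>. (y (input_vec N X \<omega>))\<^sup>2)"
  shows
    \<comment> \<open>the expansion coefficients are well defined and given by the two integral formulas\<close>
    "(integrable M (\<lambda>\<omega>. y (input_vec N X \<omega>)) \<and>
      set_integrable (lebesgue_box N) (PiE {1..N} A) (\<lambda>x. y x * joint_density N f x) \<and>
      pdd_mean M N X y =
        (LINT x:PiE {1..N} A|lebesgue_box N. y x * joint_density N f x) \<and>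
      (\<forall>u\<in>nonempty_subsets N. \<forall>j\<in>multi_indices u.
         integrable M (\<lambda>\<omega>. y (input_vec N X \<omega>) * multi_Psi M X P u j (input_vec N X \<omega>)) \<and>
         set_integrable (lebesgue_box N) (PiE {1..N} A)
           (\<lambda>x. y x * multi_Psi M X P u j x * joint_density N f x) \<and>
         pdd_coeff M N X P y u j =
           (LINT x:PiE {1..N} A|lebesgue_box N.
              y x * multi_Psi M X P u j x * joint_density N f x)))
     \<and>
     \<comment> \<open>the graded series regroups the series over all multi-indices into finite blocks\<close>
     ((\<forall>u\<in>nonempty_subsets N. \<forall>l. finite {j \<in> multi_indices u. multi_degree u j = l}) \<and>
      (\<forall>m \<omega>. pdd_graded M N X P y m \<omega> =
         pdd_partial M N X P y {(u, j) \<in> pdd_index N. multi_degree u j \<le> m} \<omega>))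
     \<and>
     \<comment> \<open>convergence of the graded series\<close>
     (converges_in_mean_square M (pdd_graded M N X P y) (\<lambda>\<omega>. y (input_vec N X \<omega>)) \<and>
      converges_in_probability M (pdd_graded M N X P y) (\<lambda>\<omega>. y (input_vec N X \<omega>)) \<and>
      converges_in_distribution M (pdd_graded M N X P y) (\<lambda>\<omega>. y (input_vec N X \<omega>)))
     \<and>
     \<comment> \<open>convergence of the series over all multi-indices, in any order of summation\<close>
     (\<forall>J. finite_exhaustion (pdd_index N) J \<longrightarrow>
       converges_in_mean_square M (\<lambda>n. pdd_partial M N X P y (J n)) (\<lambda>\<omega>. y (input_vec N X \<omega>)) \<and>
       converges_in_probability M (\<lambda>n. pdd_partial M N X P y (J n)) (\<lambda>\<omega>. y (input_vec N X \<omega>)) \<and>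
       converges_in_distribution M (\<lambda>n. pdd_partial M N X P y (J n)) (\<lambda>\<omega>. y (input_vec N X \<omega>)))"
proof -
  interpret prob_space M by fact
  interpret pdd_function M N A X f P y
    using assms by unfold_locales auto
  have coeff: "integrable M (\<lambda>\<omega>. y (input_vec N X \<omega>) * multi_Psi M X P u j (input_vec N X \<omega>)) \<and>
      set_integrable (lebesgue_box N) (PiE {1..N} A) (\<lambda>x. y x * multi_Psi M X P u j x * joint_density N f x) \<and>
      pdd_coeff M N X P y u j =
        (LINT x:PiE {1..N} A|lebesgue_box N. y x * multi_Psi M X P u j x * joint_density N f x)"
    if uj: "u \<in> nonempty_subsets N" "j \<in> multi_indices u" for u j
  proof -
    have "(\<lambda>x. y x * multi_Psi M X P u j x) \<in> borel_measurable (borel_box N A)"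
      by (intro borel_measurable_times y_measurable multi_Psi_measurable uj)
    from expectation_eq_density_integral[OF this] response_times_basis_integrable[OF uj] show ?thesis
      by (simp add: pdd_coeff_def)
  qed
  have blocks: "finite {j \<in> multi_indices u. multi_degree u j = l}" if "u \<in> nonempty_subsets N" for u l
    by (rule finite_subset[OF _ finite_graded_block[OF that, of l]]) auto
  have any: "converges_in_mean_square M (\<lambda>n. pdd_partial M N X P y (J n)) response \<and>
      converges_in_probability M (\<lambda>n. pdd_partial M N X P y (J n)) response \<and>
      converges_in_distribution M (\<lambda>n. pdd_partial M N X P y (J n)) response"
    if "finite_exhaustion (pdd_index N) J" for J
    using pdd_converges_in_mean_square[OF that] mean_square_imp_in_probability mean_square_imp_in_distribution
    by blast
  have "pdd_graded M N X P y = (\<lambda>m. pdd_partial M N X P y {(u, j) \<in> pdd_index N. multi_degree u j \<le> m})"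
    by (intro ext pdd_graded_eq_partial)
  then have graded: "converges_in_mean_square M (pdd_graded M N X P y) response \<and>
      converges_in_probability M (pdd_graded M N X P y) response \<and>
      converges_in_distribution M (pdd_graded M N X P y) response"
    using any[OF graded_exhaustion] by simp
  show ?thesis
    using response_integrable expectation_eq_density_integral[OF y_measurable] coeff blocks
      pdd_graded_eq_partial graded any
    by (auto simp: pdd_mean_def)
qed

end
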